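(* Let $d\ge1$, $\beta\in\{1,2\}$ and $0<H<\frac{1}{2\beta+d}$. Let $X\in G^{H,d}_L$ and $f\in\Theta^{\beta}$. Then, for any $t>0$, $\lambda\in\mathbb{R}^d$ and $p\ge1$, as $n\to\infty$, $$n^{H\beta}\Big(n^{Hd}\int_0^t f(n^H(X_s-\lambda))\,ds-L_t(\lambda)\int_{\mathbb{R}^d}f(x)\,dx\Big)\ \overset{L^p}{\longrightarrow}\ \begin{cases}\displaystyle\int_{\mathbb{R}^d}\Big(\sum_{i=1}^dL_t^{(\mathbf{e}_i)}(\lambda)\,x_i\Big)f(x)\,dx & \text{if }\beta=1;\\[2mm] \displaystyle\int_{\mathbb{R}^d}\Big(\frac12\sum_{i,k=1}^dx_i\,L_t^{(\mathbf{e}_i+\mathbf{e}_k)}(\lambda)\,x_k\Big)f(x)\,dx & \text{if }\beta=2,\end{cases}$$ where $\mathbf{e}_i$ is the $i$-th unit vector in $\mathbb{R}^d$, and $L_t^{(\mathbf{e}_i)}(\lambda)$, $L_t^{(\mathbf{e}_i+\mathbf{e}_k)}(\lambda)$ are respectively the first-order partial derivative in $\lambda_i$ and the second-order partial derivative in $\lambda_i,\lambda_k$ of the local time $L_t(\lambda)$ of $X$.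
   Context: $X=\{X_t=(X^1_t,\dots,X^d_t),\,t\ge0\}$ denotes a $d$-dimensional centered Gaussian process with continuous sample paths whose components are independent copies of a one-dimensional centered Gaussian process. Self-similarity with index $H$: for every $a>0$, $(X_{at})_{t\ge0}$ and $(a^HX_t)_{t\ge0}$ have the same law. Strong local nondeterminism: there is $\kappa_H>0$ such that for any integer $m\ge1$ and any times $0=s_0<s_1\le\dots\le s_m<t<\infty$, $\mathrm{Var}(X^1_t\mid X^1_{s_1},\dots,X^1_{s_m})\ge\kappa_H\min_{1\le j\le m}|t-s_j|^{2H}$. Assumption (A): there exist constants $\eta\ge1$, $\sigma>0$ and a non-negative non-decreasing function $\phi$ on $[0,1/\eta]$ with $\lim_{\varepsilon\to0}\phi(\varepsilon)=0$ such that for all $t>0$ and $h\in[0,t/\eta]$, $0\le h^{2H}(\sigma-\phi(h/t))\le\mathrm{Var}(X^1_{t+h}-X^1_t)\le h^{2H}(\sigma+\phi(h/t))$. Assumption (B): there exists a non-negative non-increasing function $\psi$ on $(1,\infty)$ with $\lim_{\eta\to\infty}\psi(\eta)=0$ such that for any $0<t_1<t_2<t_3<t_4<\infty$ and $\eta>1$, with $\Delta t_i=t_i-t_{i-1}$ ($i=2,3,4$), if (i) $\Delta t_2/\Delta t_4\le1/\eta$ or (ii) $\Delta t_2/\Delta t_4\ge\eta$ or (iii) $\max\{\Delta t_2,\Delta t_4\}/\Delta t_3\le1/\eta$, then $|\mathbb{E}(X^1_{t_4}-X^1_{t_3})(X^1_{t_2}-X^1_{t_1})|\le\psi(\eta)\,[\mathbb{E}(X^1_{t_4}-X^1_{t_3})^2]^{1/2}[\mathbb{E}(X^1_{t_2}-X^1_{t_1})^2]^{1/2}$.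 $G^{H,d}_L$ is the class of all such processes $X$ satisfying self-similarity with index $H$, strong local nondeterminism, and Assumptions (A) and (B). Function class (real-valued $f$): $\Theta^1=\{f\in L^2(\mathbb{R}^d):\int_{\mathbb{R}^d}|f(x)||x| dx<\infty\}$ and $\Theta^2=\{f\in L^2(\mathbb{R}^d):\int_{\mathbb{R}^d}|f(x)||x|^2 dx<\infty,\ \int_{\mathbb{R}^d}xf(x)dx=0\}$ (such $f$ belong to $L^1(\mathbb{R}^d)$). Let $p_\varepsilon(x)=(2\pi\varepsilon)^{-d/2}e^{-|x|^2/(2\varepsilon)}$. The local time is $L_t(\lambda)=\lim_{\varepsilon\to0}\int_0^tp_\varepsilon(X_s-\lambda)ds$, and its derivatives are $L_t^{(\mathbf{e}_i)}(\lambda)=\lim_{\varepsilon\to0}\int_0^t\frac{\partial}{\partial\lambda_i}[p_\varepsilon(X_s-\lambda)]ds$ and $L_t^{(\mathbf{e}_i+\mathbf{e}_k)}(\lambda)=\lim_{\varepsilon\to0}\int_0^t\frac{\partial^2}{\partial\lambda_i\partial\lambda_k}[p_\varepsilon(X_s-\lambda)]ds$, all limits being in $L^p$ for every $p\in[1,\infty)$ (they exist under the condition on $H$ above, first order for $\beta=1$, second order for $\beta=2$). *)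

theory Defs
  imports "HOL-Probability.Probability"
begin

section \<open>$L^p$ spaces and $L^p$ limits\<close>

definition Lp_space :: "'a measure \<Rightarrow> real \<Rightarrow> ('a \<Rightarrow> real) set" where
  "Lp_space M p = {Y. Y \<in> borel_measurable M \<and> integrable M (\<lambda>w. \<bar>Y w\<bar> powr p)}"

definition Lp_converges ::
  "'a measure \<Rightarrow> real \<Rightarrow> ('i \<Rightarrow> 'a \<Rightarrow> real) \<Rightarrow> ('a \<Rightarrow> real) \<Rightarrow> 'i filter \<Rightarrow> bool" where
  "Lp_converges M p Y Z F \<longleftrightarrow>
     Z \<in> Lp_space M p \<and> (\<forall>\<^sub>F i in F. Y i \<in> Lp_space M p) \<and>
     ((\<lambda>i. LINT w|M. \<bar>Y i w - Z w\<bar> powr p) \<longlongrightarrow> 0) F"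

text \<open>A version of the limit that is taken in \<open>L\<^sup>p\<close> for every \<open>p\<close> in \<open>[1,\<infinity>)\<close> simultaneously. It is
  unique up to null sets when it exists; otherwise it is an unspecified function.\<close>

definition Lp_lim :: "'a measure \<Rightarrow> ('i \<Rightarrow> 'a \<Rightarrow> real) \<Rightarrow> 'i filter \<Rightarrow> 'a \<Rightarrow> real" where
  "Lp_lim M Y F = (SOME Z. \<forall>p\<ge>1. Lp_converges M p Y Z F)"


section \<open>Processes indexed by $[0,\infty)$\<close>

text \<open>Processes are functions on all of \<open>real\<close>; only their values at times \<open>t \<ge> 0\<close> are used.\<close>

definition sample_path :: "(real \<Rightarrow> 'a \<Rightarrow> 'b) \<Rightarrow> 'a \<Rightarrow> real \<Rightarrow> 'b" where
  "sample_path X w = (\<lambda>t\<in>{0..}. X t w)"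

definition process_law :: "'a measure \<Rightarrow> (real \<Rightarrow> 'a \<Rightarrow> 'b::topological_space) \<Rightarrow> (real \<Rightarrow> 'b) measure" where
  "process_law M X = distr M (PiM {0..} (\<lambda>_. borel)) (sample_path X)"

text \<open>The first disjunct is the degenerate Gaussian law with variance \<open>0\<close>.\<close>

definition centered_gaussian :: "'a measure \<Rightarrow> ('a \<Rightarrow> real) \<Rightarrow> bool" where
  "centered_gaussian M Z \<longleftrightarrow> Z \<in> borel_measurable M \<and>
     ((AE w in M. Z w = 0) \<or> (\<exists>s>0. distributed M lborel Z (normal_density 0 s)))"

definition centered_gaussian_process ::
  "'a measure \<Rightarrow> (real \<Rightarrow> 'a \<Rightarrow> 'b::euclidean_space) \<Rightarrow> bool" where
  "centered_gaussian_process M X \<longleftrightarrow>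
     (\<forall>t\<ge>0. X t \<in> borel_measurable M) \<and>
     (\<forall>T c. finite T \<longrightarrow> T \<subseteq> {0..} \<longrightarrow> centered_gaussian M (\<lambda>w. \<Sum>t\<in>T. c t \<bullet> X t w))"

definition component :: "(real \<Rightarrow> 'a \<Rightarrow> real ^ 'd) \<Rightarrow> 'd \<Rightarrow> real \<Rightarrow> 'a \<Rightarrow> real" where
  "component X i t w = X t w $ i"

definition iid_components :: "'a measure \<Rightarrow> (real \<Rightarrow> 'a \<Rightarrow> real ^ 'd::finite) \<Rightarrow> bool" where
  "iid_components M X \<longleftrightarrow>
     prob_space.indep_vars M (\<lambda>_. PiM {0..} (\<lambda>_. borel)) (\<lambda>i. sample_path (component X i)) UNIV \<and>
     (\<forall>i j. process_law M (component X i) = process_law M (component X j))"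

definition self_similar :: "'a measure \<Rightarrow> real \<Rightarrow> (real \<Rightarrow> 'a \<Rightarrow> 'b::real_normed_vector) \<Rightarrow> bool" where
  "self_similar M H X \<longleftrightarrow>
     (\<forall>a>0. process_law M (\<lambda>t. X (a * t)) = process_law M (\<lambda>t w. (a powr H) *\<^sub>R X t w))"

definition cond_variance :: "'a measure \<Rightarrow> 'a measure \<Rightarrow> ('a \<Rightarrow> real) \<Rightarrow> 'a \<Rightarrow> real" where
  "cond_variance M F Z = real_cond_exp M F (\<lambda>w. (Z w - real_cond_exp M F Z w)\<^sup>2)"

definition strongly_locally_nondeterministic :: "'a measure \<Rightarrow> real \<Rightarrow> (real \<Rightarrow> 'a \<Rightarrow> real) \<Rightarrow> bool" where
  "strongly_locally_nondeterministic M H Y \<longleftrightarrow>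
     (\<exists>\<kappa>>0. \<forall>m\<ge>1. \<forall>(s::nat \<Rightarrow> real) t.
        0 < s 1 \<longrightarrow> (\<forall>j\<in>{1..<m}. s j \<le> s (Suc j)) \<longrightarrow> s m < t \<longrightarrow>
        (AE w in M.
           cond_variance M
             (vimage_algebra (space M) (\<lambda>w. \<lambda>j\<in>{1..m}. Y (s j) w) (PiM {1..m} (\<lambda>_. borel)))
             (Y t) w
           \<ge> \<kappa> * Min ((\<lambda>j. \<bar>t - s j\<bar> powr (2 * H)) ` {1..m})))"

definition assumption_A :: "'a measure \<Rightarrow> real \<Rightarrow> (real \<Rightarrow> 'a \<Rightarrow> real) \<Rightarrow> bool" where
  "assumption_A M H Y \<longleftrightarrow>
     (\<exists>\<eta>\<ge>1. \<exists>\<sigma>>0. \<exists>\<phi>::real \<Rightarrow> real.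
        (\<forall>x\<in>{0..1/\<eta>}. 0 \<le> \<phi> x) \<and> mono_on {0..1/\<eta>} \<phi> \<and> (\<phi> \<longlongrightarrow> 0) (at_right 0) \<and>
        (\<forall>t>0. \<forall>h\<in>{0..t/\<eta>}.
           0 \<le> h powr (2 * H) * (\<sigma> - \<phi> (h / t)) \<and>
           h powr (2 * H) * (\<sigma> - \<phi> (h / t)) \<le> prob_space.variance M (\<lambda>w. Y (t + h) w - Y t w) \<and>
           prob_space.variance M (\<lambda>w. Y (t + h) w - Y t w) \<le> h powr (2 * H) * (\<sigma> + \<phi> (h / t))))"

definition assumption_B :: "'a measure \<Rightarrow> (real \<Rightarrow> 'a \<Rightarrow> real) \<Rightarrow> bool" where
  "assumption_B M Y \<longleftrightarrow>
     (\<exists>\<psi>::real \<Rightarrow> real.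
        (\<forall>x>1. 0 \<le> \<psi> x) \<and> antimono_on {1<..} \<psi> \<and> (\<psi> \<longlongrightarrow> 0) at_top \<and>
        (\<forall>t1 t2 t3 t4 \<eta>. 0 < t1 \<longrightarrow> t1 < t2 \<longrightarrow> t2 < t3 \<longrightarrow> t3 < t4 \<longrightarrow> 1 < \<eta> \<longrightarrow>
           (t2 - t1) / (t4 - t3) \<le> 1 / \<eta> \<or>
           (t2 - t1) / (t4 - t3) \<ge> \<eta> \<or>
           max (t2 - t1) (t4 - t3) / (t3 - t2) \<le> 1 / \<eta> \<longrightarrow>
           \<bar>LINT w|M. (Y t4 w - Y t3 w) * (Y t2 w - Y t1 w)\<bar>
             \<le> \<psi> \<eta> * sqrt (LINT w|M. (Y t4 w - Y t3 w)\<^sup>2) * sqrt (LINT w|M. (Y t2 w - Y t1 w)\<^sup>2)))"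

text \<open>The components have the same law, so a requirement on the law of the first component is the
  same as that requirement on every component.\<close>

definition G_class :: "'a measure \<Rightarrow> real \<Rightarrow> (real \<Rightarrow> 'a \<Rightarrow> real ^ 'd::finite) set" where
  "G_class M H = {X.
     centered_gaussian_process M X \<and>
     (\<forall>w\<in>space M. continuous_on {0..} (\<lambda>t. X t w)) \<and>
     iid_components M X \<and>
     self_similar M H X \<and>
     (\<forall>i. strongly_locally_nondeterministic M H (component X i) \<and>
          assumption_A M H (component X i) \<and>
          assumption_B M (component X i))}"


section \<open>Test functions\<close>

definition Theta1 :: "(real ^ 'd::finite \<Rightarrow> real) set" where
  "Theta1 = {f \<in> Lp_space lborel 2. integrable lborel (\<lambda>x. \<bar>f x\<bar> * norm x)}"

definition Theta2 :: "(real ^ 'd::finite \<Rightarrow> real) set" where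
  "Theta2 = {f \<in> Lp_space lborel 2. integrable lborel (\<lambda>x. \<bar>f x\<bar> * (norm x)\<^sup>2) \<and>
               (LINT x|lborel. f x *\<^sub>R x) = 0}"

definition Theta :: "nat \<Rightarrow> (real ^ 'd::finite \<Rightarrow> real) set" where
  "Theta \<beta> = (if \<beta> = 1 then Theta1 else Theta2)"


section \<open>Local time and its derivatives\<close>

definition heat_kernel :: "real \<Rightarrow> real ^ 'd::finite \<Rightarrow> real" where
  "heat_kernel \<epsilon> x =
     (2 * pi * \<epsilon>) powr (- real CARD('d) / 2) * exp (- (norm x)\<^sup>2 / (2 * \<epsilon>))"

definition partial_deriv :: "'d::finite \<Rightarrow> (real ^ 'd \<Rightarrow> real) \<Rightarrow> real ^ 'd \<Rightarrow> real" where
  "partial_deriv i g y = deriv (\<lambda>u. g (y + u *\<^sub>R axis i 1)) 0"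

definition local_time ::
  "'a measure \<Rightarrow> (real \<Rightarrow> 'a \<Rightarrow> real ^ 'd::finite) \<Rightarrow> real \<Rightarrow> real ^ 'd \<Rightarrow> 'a \<Rightarrow> real" where
  "local_time M X t y = Lp_lim M
     (\<lambda>\<epsilon> w. LINT s:{0..t}|lborel. heat_kernel \<epsilon> (X s w - y)) (at_right 0)"

definition local_time_deriv ::
  "'a measure \<Rightarrow> (real \<Rightarrow> 'a \<Rightarrow> real ^ 'd::finite) \<Rightarrow> 'd \<Rightarrow> real \<Rightarrow> real ^ 'd \<Rightarrow> 'a \<Rightarrow> real" where
  "local_time_deriv M X i t y = Lp_lim M
     (\<lambda>\<epsilon> w. LINT s:{0..t}|lborel. partial_deriv i (\<lambda>z. heat_kernel \<epsilon> (X s w - z)) y)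
     (at_right 0)"

definition local_time_deriv2 ::
  "'a measure \<Rightarrow> (real \<Rightarrow> 'a \<Rightarrow> real ^ 'd::finite) \<Rightarrow> 'd \<Rightarrow> 'd \<Rightarrow> real \<Rightarrow> real ^ 'd \<Rightarrow> 'a \<Rightarrow> real" where
  "local_time_deriv2 M X i k t y = Lp_lim M
     (\<lambda>\<epsilon> w. LINT s:{0..t}|lborel.
        partial_deriv i (partial_deriv k (\<lambda>z. heat_kernel \<epsilon> (X s w - z))) y)
     (at_right 0)"

end

theory Submission imports Defs begin


text \<open>
  All random variables in the theorem are occupation functionals \<open>\<integral> g (X s) ds\<close> over \<open>{0..t}\<close>, or
  limits of such functionals, where \<open>g\<close> is a rescaled copy of \<open>f\<close>, a heat kernel or a derivative of a
  heat kernel. In Fourier space \<open>g\<close> is described by a multiplier. With \<open>r = n powr (- H)\<close>, the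
  multiplier of the rescaled copy of \<open>f\<close> is essentially the Fourier transform of \<open>f\<close> at
  \<open>r *\<^sub>R \<xi>\<close>, while the local time and its derivatives correspond to the Taylor polynomial of that
  transform at the origin. Hence the error in the theorem is a single occupation functional, whose
  multiplier \<open>error_symbol\<close> is the Taylor remainder of order \<open>\<beta>\<close> divided by \<open>r ^ \<beta>\<close>. It is bounded by
  a multiple of \<open>(1 + norm \<xi>) ^ \<beta>\<close> and tends to zero pointwise as \<open>r\<close> tends to zero.

  What is needed is therefore a bound for the moments of an occupation functional that is linear in
  the multiplier \<open>b\<close> for \<open>b\<close> dominated by \<open>C * (1 + norm \<xi>) ^ \<beta>\<close>; this is \<open>moment_weight_exists\<close>. The
  power of a time integral is the integral of its derivative, which brings out one time and one
  frequency at a time (\<open>occupation_power_step\<close>), until the characteristic function of a linear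
  combination of values of \<open>X\<close> remains. By strong local nondeterminism the increments of \<open>X\<close> between
  successive times behave as if they were orthogonal (\<open>variance_ge_energy\<close>, \<open>vector_chain_char_le\<close>),
  so this characteristic function is dominated by a product of Gaussians in the partial sums of the
  frequencies. Integrating out the frequencies leaves an iterated convolution in time of the function
  \<open>\<delta> powr (- H * (d + 2 * \<beta>))\<close> (\<open>chain_kernel_integral_le\<close>), and this function is integrable at \<open>0\<close>
  because \<open>H * (d + 2 * \<beta>) < 1\<close>.

  Multipliers are made integrable by a factor \<open>exp (- \<epsilon> * (norm \<xi>)\<^sup>2 / 2)\<close>, that is, by smoothing
  with the heat kernel. The moment bound shows that the smoothed functionals are Cauchy in every
  moment as \<open>\<epsilon>\<close> tends to zero, so the local time and its derivatives exist (\<open>mollified_limit\<close>). The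
  functional of \<open>f\<close> itself is recovered because the occupation measure has a density in the mean
  (\<open>occupation_density\<close>, \<open>occupation_smoothing_converges\<close>). Fatou's lemma removes the smoothing from
  the moment bound for the error, and dominated convergence in \<open>\<xi>\<close> concludes
  (\<open>rescaled_occupation_expansion\<close>).
\<close>


section \<open>Gaussian integrals in Euclidean space\<close>

lemma lborel_scale_nn_integral:
  fixes f :: "'a::euclidean_space \<Rightarrow> ennreal"
  assumes "c \<noteq> 0" and [measurable]: "f \<in> borel_measurable borel"
  shows "(\<integral>\<^sup>+x. f x \<partial>lborel) = ennreal (\<bar>c\<bar> ^ DIM('a)) * (\<integral>\<^sup>+x. f (u + c *\<^sub>R x) \<partial>lborel)"
  by (subst lborel_affine[OF assms(1), of u])
    (simp add: nn_integral_density nn_integral_distr nn_integral_cmult)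

lemma lborel_scale_integral:
  fixes f :: "'a::euclidean_space \<Rightarrow> 'b::{banach, second_countable_topology}"
  assumes "c \<noteq> 0" and [measurable]: "f \<in> borel_measurable borel"
  shows "(LINT x|lborel. f x) = (\<bar>c\<bar> ^ DIM('a)) *\<^sub>R (LINT x|lborel. f (u + c *\<^sub>R x))"
  by (subst lborel_affine[OF assms(1), of u])
    (simp add: integral_density integral_distr)

lemma lborel_scale_integrable:
  fixes f :: "'a::euclidean_space \<Rightarrow> 'b::{banach, second_countable_topology}"
  assumes "c \<noteq> 0" and "integrable lborel f"
  shows "integrable lborel (\<lambda>x. f (u + c *\<^sub>R x))"
proof -
  have [measurable]: "f \<in> borel_measurable borel"
    using assms(2) by auto
  have "(\<integral>\<^sup>+x. norm (f x) \<partial>lborel) = ennreal (\<bar>c\<bar> ^ DIM('a)) * (\<integral>\<^sup>+x. norm (f (u + c *\<^sub>R x)) \<partial>lborel)"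
    by (rule lborel_scale_nn_integral) (use assms in auto)
  moreover have "(\<integral>\<^sup>+x. norm (f x) \<partial>lborel) < \<infinity>"
    using assms(2) by (simp add: integrable_iff_bounded)
  ultimately have "(\<integral>\<^sup>+x. norm (f (u + c *\<^sub>R x)) \<partial>lborel) < \<infinity>"
    using assms(1) by (auto simp: ennreal_mult_less_top)
  then show ?thesis
    by (intro integrableI_bounded) auto
qed

lemma gaussian_fourier_unit_real:
  "integrable lborel (\<lambda>\<xi>::real. complex_of_real (exp (- \<xi>\<^sup>2 / 2)) * iexp (\<xi> * x))"
  "(LINT \<xi>|lborel. complex_of_real (exp (- \<xi>\<^sup>2 / 2)) * iexp (\<xi> * x)) = sqrt (2 * pi) * exp (- x\<^sup>2 / 2)"
proof -
  have i: "integrable lborel (\<lambda>\<xi>::real. std_normal_density \<xi>)"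
    by simp
  have i2: "integrable lborel (\<lambda>\<xi>::real. exp (- \<xi>\<^sup>2 / 2))"
    using integrable_mult_right[OF i, of "sqrt (2 * pi)"] by (simp add: std_normal_density_def)
  show "integrable lborel (\<lambda>\<xi>::real. complex_of_real (exp (- \<xi>\<^sup>2 / 2)) * iexp (\<xi> * x))"
    by (rule Bochner_Integration.integrable_bound[OF i2]) (auto simp: norm_mult)
  have "char std_normal_distribution x = (LINT \<xi>|lborel. std_normal_density \<xi> *\<^sub>R iexp (x * \<xi>))"
    unfolding char_def by (subst integral_density) auto
  then have "complex_of_real (exp (- (x^2) / 2)) = (LINT \<xi>|lborel. std_normal_density \<xi> *\<^sub>R iexp (x * \<xi>))"
    by (simp add: char_std_normal_distribution)
  also have "\<dots> = (LINT \<xi>|lborel. (1 / sqrt (2 * pi)) *\<^sub>R (complex_of_real (exp (- \<xi>\<^sup>2 / 2)) * iexp (\<xi> * x)))"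
    by (simp add: std_normal_density_def scaleR_conv_of_real mult_ac)
  also have "\<dots> = (1 / sqrt (2 * pi)) *\<^sub>R (LINT \<xi>|lborel. (complex_of_real (exp (- \<xi>\<^sup>2 / 2)) * iexp (\<xi> * x)))"
    by (rule integral_scaleR_right)
  finally show "(LINT \<xi>|lborel. complex_of_real (exp (- \<xi>\<^sup>2 / 2)) * iexp (\<xi> * x)) = sqrt (2 * pi) * exp (- x\<^sup>2 / 2)"
    by (simp add: scaleR_conv_of_real field_simps)
qed

lemma gaussian_fourier_unit:
  fixes x :: "'a::euclidean_space"
  shows "integrable lborel (\<lambda>\<xi>::'a. complex_of_real (exp (- (norm \<xi>)\<^sup>2 / 2)) * iexp (\<xi> \<bullet> x))"
    and "(LINT \<xi>|lborel. complex_of_real (exp (- (norm \<xi>)\<^sup>2 / 2)) * iexp (\<xi> \<bullet> x))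
      = sqrt (2 * pi) ^ DIM('a) * exp (- (norm x)\<^sup>2 / 2)"
proof -
  let ?f = "\<lambda>\<xi>::'a. complex_of_real (exp (- (norm \<xi>)\<^sup>2 / 2)) * iexp (\<xi> \<bullet> x)"
  let ?p = "\<lambda>b (u::real). complex_of_real (exp (- u\<^sup>2 / 2)) * iexp (u * (x \<bullet> b))"
  let ?T = "\<lambda>f. \<Sum>b\<in>Basis. f b *\<^sub>R (b::'a)"
  interpret product_sigma_finite "\<lambda>_::'a. lborel :: real measure" ..
  have T: "?T \<in> (\<Pi>\<^sub>M b\<in>Basis. lborel) \<rightarrow>\<^sub>M borel"
    by measurable
  have norm_T: "(norm (?T u))\<^sup>2 = (\<Sum>b\<in>Basis. (u b)\<^sup>2)" for u
    unfolding power2_norm_eq_inner euclidean_inner[of "?T u" "?T u"]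
    by (intro sum.cong refl) (simp only: inner_sum_left_Basis power2_eq_square)
  have inner_T: "?T u \<bullet> x = (\<Sum>b\<in>Basis. u b * (x \<bullet> b))" for u
    unfolding inner_sum_left inner_scaleR_left by (simp only: inner_commute)
  have fT: "?f (?T u) = (\<Prod>b\<in>Basis. ?p b (u b))" for u
    unfolding norm_T inner_T
  proof -
    have "(\<Prod>b\<in>Basis. ?p b (u b))
       = exp (\<Sum>b\<in>Basis. complex_of_real (- (u b)\<^sup>2 / 2) + \<i> * complex_of_real (u b * (x \<bullet> b)))"
      by (simp only: exp_sum[OF finite_Basis] exp_add exp_of_real)
    also have "(\<Sum>b\<in>Basis. complex_of_real (- (u b)\<^sup>2 / 2) + \<i> * complex_of_real (u b * (x \<bullet> b)))
       = complex_of_real (- (\<Sum>b\<in>Basis. (u b)\<^sup>2) / 2) + \<i> * complex_of_real (\<Sum>b\<in>Basis. u b * (x \<bullet> b))"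
      unfolding sum.distrib sum_distrib_left[symmetric] of_real_sum[symmetric] sum_divide_distrib[symmetric] sum_negf ..
    finally show "complex_of_real (exp (- (\<Sum>b\<in>Basis. (u b)\<^sup>2) / 2)) * iexp (\<Sum>b\<in>Basis. u b * (x \<bullet> b)) = (\<Prod>b\<in>Basis. ?p b (u b))"
      by (simp only: exp_add exp_of_real)
  qed
  have Ti: "integrable (\<Pi>\<^sub>M b\<in>Basis. lborel) (\<lambda>u. ?f (?T u))"
    unfolding fT by (intro product_integrable_prod[OF finite_Basis gaussian_fourier_unit_real(1)])
  show "integrable lborel ?f"
    unfolding lborel_eq[where 'a='a] by (subst integrable_distr_eq[OF T]) (use Ti in auto)
  have "(LINT \<xi>|lborel. ?f \<xi>) = (LINT u|(\<Pi>\<^sub>M b\<in>Basis. lborel). ?f (?T u))"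
    unfolding lborel_eq[where 'a='a] by (subst integral_distr[OF T]) auto
  also have "\<dots> = (\<Prod>b\<in>(Basis::'a set). LINT u|lborel. ?p b u)"
    unfolding fT by (rule product_integral_prod[OF finite_Basis gaussian_fourier_unit_real(1)])
  also have "\<dots> = (\<Prod>b\<in>(Basis::'a set). complex_of_real (sqrt (2 * pi)) * complex_of_real (exp (- (x \<bullet> b)\<^sup>2 / 2)))"
    by (intro prod.cong refl) (simp only: gaussian_fourier_unit_real(2), simp only: of_real_mult)
  also have "\<dots> = sqrt (2 * pi) ^ DIM('a) * exp (- (norm x)\<^sup>2 / 2)"
  proof -
    have "(\<Prod>b\<in>(Basis::'a set). exp (- (x \<bullet> b)\<^sup>2 / 2)) = exp (- (norm x)\<^sup>2 / 2)"
      unfolding power2_norm_eq_inner euclidean_inner[of x x]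
      by (simp only: exp_sum[symmetric, OF finite_Basis] sum_divide_distrib[symmetric] sum_negf power2_eq_square)
    then show ?thesis
      unfolding prod.distrib of_real_prod[symmetric] by simp
  qed
  finally show "(LINT \<xi>|lborel. ?f \<xi>) = sqrt (2 * pi) ^ DIM('a) * exp (- (norm x)\<^sup>2 / 2)" .
qed

lemma gaussian_integrable:
  assumes "a > 0"
  shows "integrable lborel (\<lambda>\<xi>::'a::euclidean_space. exp (- a * (norm \<xi>)\<^sup>2))"
proof -
  have "integrable lborel (\<lambda>\<xi>::'a. norm (complex_of_real (exp (- (norm \<xi>)\<^sup>2 / 2)) * iexp (\<xi> \<bullet> 0)))"
    by (intro integrable_norm gaussian_fourier_unit)
  then have "integrable lborel (\<lambda>\<xi>::'a. exp (- (norm \<xi>)\<^sup>2 / 2))"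
    by simp
  from lborel_scale_integrable[OF _ this, of "sqrt (2 * a)" 0] assms show ?thesis
    by (simp add: power_mult_distrib)
qed

lemma one_plus_power_le_exp:
  fixes u a :: real
  assumes "u \<ge> 0" "a > 0"
  shows "(1 + u) ^ k * exp (- a * u\<^sup>2) \<le> fact k * exp (1 + 1 / (2 * a)) * exp (- (a / 2) * u\<^sup>2)"
proof -
  have "(1 + u) ^ k / fact k \<le> exp (1 + u)"
  proof -
    have s: "summable (\<lambda>n. (1 + u) ^ n /\<^sub>R fact n)"
      by (rule summable_exp_generic)
    have "sum (\<lambda>n. (1 + u) ^ n /\<^sub>R fact n) {k} \<le> (\<Sum>n. (1 + u) ^ n /\<^sub>R fact n)"
      by (rule sum_le_suminf[OF s]) (use assms in auto)
    then show ?thesis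
      by (simp add: exp_def divide_inverse mult.commute)
  qed
  then have "(1 + u) ^ k \<le> fact k * exp (1 + u)"
    by (simp add: field_simps)
  moreover have "u \<le> 1 / (2 * a) + (a / 2) * u\<^sup>2"
  proof -
    have "0 \<le> (a * u - 1)\<^sup>2 / (2 * a)"
      using assms by simp
    also have "\<dots> = (a / 2) * u\<^sup>2 - u + 1 / (2 * a)"
      using assms by (simp add: field_simps power2_eq_square)
    finally show ?thesis by simp
  qed
  ultimately have "(1 + u) ^ k \<le> fact k * exp (1 + (1 / (2 * a) + (a / 2) * u\<^sup>2))"
    by (meson add_left_mono exp_le_cancel_iff fact_ge_zero mult_left_mono order_trans)
  then have "(1 + u) ^ k * exp (- a * u\<^sup>2) \<le> fact k * exp (1 + (1 / (2 * a) + (a / 2) * u\<^sup>2)) * exp (- a * u\<^sup>2)"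
    by (rule mult_right_mono) simp
  also have "\<dots> = fact k * exp (1 + 1 / (2 * a)) * exp (- (a / 2) * u\<^sup>2)"
    by (simp add: mult.assoc mult_exp_exp algebra_simps)
  finally show ?thesis .
qed

lemma gaussian_moment_integrable:
  assumes "a > 0"
  shows "integrable lborel (\<lambda>\<xi>::'a::euclidean_space. (1 + norm \<xi>) ^ k * exp (- a * (norm \<xi>)\<^sup>2))"
proof (rule Bochner_Integration.integrable_bound)
  show "integrable lborel (\<lambda>\<xi>::'a. (fact k * exp (1 + 1 / (2 * a))) * exp (- (a / 2) * (norm \<xi>)\<^sup>2))"
    using assms by (intro integrable_mult_right gaussian_integrable) auto
  show "AE \<xi> in lborel. norm ((1 + norm (\<xi>::'a)) ^ k * exp (- a * (norm \<xi>)\<^sup>2))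
      \<le> norm (fact k * exp (1 + 1 / (2 * a)) * exp (- (a / 2) * (norm \<xi>)\<^sup>2))"
    using one_plus_power_le_exp[of "norm (_::'a)" a k] assms by (intro always_eventually allI) (auto simp: abs_mult)
qed simp

text \<open>Rescaling by \<open>\<delta> powr H\<close> turns the Gaussian weight into a fixed one; each of the \<open>k\<close> factors
  \<open>1 + norm v\<close> and each of the dimensions costs one power of \<open>\<delta> powr (- H)\<close>.\<close>

lemma gaussian_moment_scaling:
  fixes c H T :: real
  assumes "c > 0" "H > 0" "T > 0"
  shows "\<exists>C\<ge>0. \<forall>\<delta>. 0 < \<delta> \<and> \<delta> \<le> T \<longrightarrow>
    (\<integral>\<^sup>+v. ennreal ((1 + norm (v::'a::euclidean_space)) ^ k * exp (- c * (norm v)\<^sup>2 * \<delta> powr (2 * H))) \<partial>lborel)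
      \<le> ennreal (C * \<delta> powr (- H * (real DIM('a) + real k)))"
proof -
  define I where "I = (LINT z|lborel. (1 + norm (z::'a)) ^ k * exp (- c * (norm z)\<^sup>2))"
  define C where "C = max 1 (T powr H) ^ k * I"
  have I0: "I \<ge> 0"
    unfolding I_def by (intro integral_nonneg_AE) auto
  have I: "(\<integral>\<^sup>+z. ennreal ((1 + norm (z::'a)) ^ k * exp (- c * (norm z)\<^sup>2)) \<partial>lborel) = ennreal I"
    unfolding I_def by (rule nn_integral_eq_integral[OF gaussian_moment_integrable[OF assms(1)]]) auto
  show ?thesis
  proof (intro exI[of _ C] conjI allI impI)
    show "C \<ge> 0"
      unfolding C_def using I0 by (simp add: le_max_iff_disj)
    fix \<delta> assume \<delta>: "0 < \<delta> \<and> \<delta> \<le> T"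
    define q where "q = \<delta> powr (- H)"
    have q0: "q > 0" using \<delta> by (simp add: q_def)
    have q2: "q\<^sup>2 * \<delta> powr (2 * H) = 1"
      using \<delta> by (simp add: q_def power2_eq_square powr_add[symmetric])
    define m where "m = max 1 (T powr H)"
    have m1: "m \<ge> 1" "m > 0" by (auto simp: m_def)
    have qm: "m * q \<ge> 1"
    proof -
      have "1 = \<delta> powr H * q" using \<delta> by (simp add: q_def powr_add[symmetric])
      also have "\<dots> \<le> m * q"
        using \<delta> assms q0 by (intro mult_right_mono) (auto simp: m_def intro!: max.coboundedI2 powr_mono2)
      finally show ?thesis .
    qed
    have "(\<integral>\<^sup>+v. ennreal ((1 + norm (v::'a)) ^ k * exp (- c * (norm v)\<^sup>2 * \<delta> powr (2 * H))) \<partial>lborel)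
       = ennreal (\<bar>q\<bar> ^ DIM('a)) * (\<integral>\<^sup>+z. ennreal ((1 + norm (0 + q *\<^sub>R (z::'a))) ^ k * exp (- c * (norm (0 + q *\<^sub>R z))\<^sup>2 * \<delta> powr (2 * H))) \<partial>lborel)"
      using q0 by (intro lborel_scale_nn_integral) auto
    also have "\<dots> \<le> ennreal (q ^ DIM('a)) * (\<integral>\<^sup>+z. ennreal ((m * q) ^ k) * ennreal ((1 + norm (z::'a)) ^ k * exp (- c * (norm z)\<^sup>2)) \<partial>lborel)"
    proof (intro mult_mono nn_integral_mono)
      fix z :: 'a
      have "(1 + norm (0 + q *\<^sub>R z)) ^ k \<le> ((m * q) * (1 + norm z)) ^ k"
      proof (intro power_mono)
        have "1 * (q * norm z) \<le> m * (q * norm z)"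
          using q0 m1 by (intro mult_right_mono) auto
        from add_mono[OF qm this] show "1 + norm (0 + q *\<^sub>R z) \<le> (m * q) * (1 + norm z)"
          using q0 qm by (simp add: distrib_left mult.assoc del: mult_le_cancel_left)
      qed auto
      moreover have "- c * (norm (0 + q *\<^sub>R z))\<^sup>2 * \<delta> powr (2 * H) = - c * (norm z)\<^sup>2 * (q\<^sup>2 * \<delta> powr (2 * H))"
        by (simp add: power_mult_distrib)
      ultimately show "ennreal ((1 + norm (0 + q *\<^sub>R z)) ^ k * exp (- c * (norm (0 + q *\<^sub>R z))\<^sup>2 * \<delta> powr (2 * H)))
          \<le> ennreal ((m * q) ^ k) * ennreal ((1 + norm z) ^ k * exp (- c * (norm z)\<^sup>2))"
        using q0 m1 unfolding q2 mult_1_right power_mult_distrib[of "m * q"]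
        by (subst ennreal_mult[symmetric]) (auto intro!: ennreal_leI mult_right_mono simp only: mult.assoc[symmetric] zero_le_power mult_nonneg_nonneg less_imp_le norm_ge_zero exp_ge_zero add_nonneg_nonneg zero_le_one)
    qed (use q0 in auto)
    also have "\<dots> = ennreal (q ^ DIM('a)) * (ennreal ((m * q) ^ k) * ennreal I)"
      by (subst nn_integral_cmult) (simp, simp only: I)
    also have "\<dots> = ennreal (C * q ^ (DIM('a) + k))"
      using q0 m1 I0 by (simp add: C_def m_def[symmetric] ennreal_mult[symmetric] power_add power_mult_distrib mult_ac)
    also have "q ^ (DIM('a) + k) = \<delta> powr (- H * (real DIM('a) + real k))"
    proof -
      have "q ^ (DIM('a) + k) = q powr (real (DIM('a) + k))"
        using q0 by (rule powr_realpow[symmetric])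
      also have "\<dots> = \<delta> powr (- H * (real DIM('a) + real k))"
        unfolding q_def powr_powr by simp
      finally show ?thesis .
    qed
    finally show "(\<integral>\<^sup>+v. ennreal ((1 + norm (v::'a)) ^ k * exp (- c * (norm v)\<^sup>2 * \<delta> powr (2 * H))) \<partial>lborel)
      \<le> ennreal (C * \<delta> powr (- H * (real DIM('a) + real k)))" .
  qed
qed

section \<open>Variance of a chain of increments\<close>

definition square_integrable :: "'a measure \<Rightarrow> ('a \<Rightarrow> real) \<Rightarrow> bool" where
  "square_integrable M f \<longleftrightarrow> f \<in> borel_measurable M \<and> integrable M (\<lambda>w. (f w)\<^sup>2)"

lemma square_integrable_measurable: "square_integrable M f \<Longrightarrow> f \<in> borel_measurable M"
  by (simp add: square_integrable_def)

lemma square_integrable_mult: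
  assumes "square_integrable M f" "square_integrable M g"
  shows "integrable M (\<lambda>w. f w * g w)"
proof (rule Bochner_Integration.integrable_bound)
  show "integrable M (\<lambda>w. (f w)\<^sup>2 + (g w)\<^sup>2)"
    using assms by (auto simp: square_integrable_def)
  have "\<bar>f w * g w\<bar> \<le> (f w)\<^sup>2 + (g w)\<^sup>2" for w
  proof -
    have "2 * (\<bar>f w\<bar> * \<bar>g w\<bar>) \<le> \<bar>f w\<bar>\<^sup>2 + \<bar>g w\<bar>\<^sup>2"
      using sum_squares_bound[of "\<bar>f w\<bar>" "\<bar>g w\<bar>"] by simp
    moreover have "0 \<le> \<bar>f w\<bar> * \<bar>g w\<bar>" by simp
    ultimately show ?thesis unfolding abs_mult power2_abs by linarith
  qed
  then show "AE w in M. norm (f w * g w) \<le> norm ((f w)\<^sup>2 + (g w)\<^sup>2)"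
    by simp
qed (use assms in \<open>auto simp: square_integrable_def\<close>)

lemma square_integrable_add:
  assumes "square_integrable M f" "square_integrable M g"
  shows "square_integrable M (\<lambda>w. f w + g w)"
  using assms square_integrable_mult[OF assms]
  unfolding square_integrable_def power2_sum by (auto simp: mult.assoc)

lemma square_integrable_cmult:
  assumes "square_integrable M f"
  shows "square_integrable M (\<lambda>w. c * f w)"
  using assms unfolding square_integrable_def power_mult_distrib by auto

lemma square_integrable_diff:
  assumes "square_integrable M f" "square_integrable M g"
  shows "square_integrable M (\<lambda>w. f w - g w)"
  using square_integrable_add[OF assms(1) square_integrable_cmult[OF assms(2), of "-1"]] by simp

lemma square_integrable_sum:
  assumes "finite T" "\<And>s. s \<in> T \<Longrightarrow> square_integrable M (f s)"
  shows "square_integrable M (\<lambda>w. \<Sum>s\<in>T. f s w)"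
  using assms
proof (induction T rule: finite_induct)
  case empty
  then show ?case by (simp add: square_integrable_def)
next
  case (insert x F)
  then show ?case by (simp add: square_integrable_add)
qed

lemma second_moment_add_le:
  assumes "square_integrable M f" "square_integrable M g"
  shows "(LINT w|M. (f w + g w)\<^sup>2) \<le> 2 * (LINT w|M. (f w)\<^sup>2) + 2 * (LINT w|M. (g w)\<^sup>2)"
proof -
  have "(LINT w|M. (f w + g w)\<^sup>2) \<le> (LINT w|M. 2 * (f w)\<^sup>2 + 2 * (g w)\<^sup>2)"
  proof (rule integral_mono)
    show "integrable M (\<lambda>w. (f w + g w)\<^sup>2)"
      using square_integrable_add[OF assms] by (simp add: square_integrable_def)
    show "integrable M (\<lambda>w. 2 * (f w)\<^sup>2 + 2 * (g w)\<^sup>2)"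
      using assms by (simp add: square_integrable_def)
    show "(f w + g w)\<^sup>2 \<le> 2 * (f w)\<^sup>2 + 2 * (g w)\<^sup>2" for w
      using sum_squares_bound[of "f w" "g w"] by (simp add: power2_sum)
  qed
  also have "\<dots> = 2 * (LINT w|M. (f w)\<^sup>2) + 2 * (LINT w|M. (g w)\<^sup>2)"
    using assms by (simp add: square_integrable_def)
  finally show ?thesis .
qed

text \<open>A chain is a list of pairs \<open>(s, u)\<close> with increasing times; the entry \<open>(s, u)\<close> contributes the
  increment of the process that ends at \<open>s\<close>, with coefficient \<open>u\<close>.\<close>

fun ascending :: "real \<Rightarrow> (real \<times> 'b) list \<Rightarrow> bool" where
  "ascending r [] = True"
| "ascending r ((s, u) # L) = (r < s \<and> ascending s L)"

fun increments :: "(real \<Rightarrow> 'a \<Rightarrow> 'b::real_inner) \<Rightarrow> real \<Rightarrow> (real \<times> 'b) list \<Rightarrow> 'a \<Rightarrow> real" where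
  "increments Y r [] w = 0"
| "increments Y r ((s, u) # L) w = u \<bullet> (Y s w - Y r w) + increments Y s L w"

fun energy :: "real \<Rightarrow> real \<Rightarrow> (real \<times> 'b::real_normed_vector) list \<Rightarrow> real" where
  "energy H r [] = 0"
| "energy H r ((s, u) # L) = (norm u)\<^sup>2 * (s - r) powr (2 * H) + energy H s L"

definition last_time :: "real \<Rightarrow> (real \<times> 'b) list \<Rightarrow> real" where
  "last_time r L = (if L = [] then r else fst (last L))"

lemma last_time_simps [simp]:
  "last_time r [] = r" "last_time r ((s, u) # L) = last_time s L"
  by (auto simp: last_time_def)

lemma increments_snoc:
  "increments Y r (L @ [(t, u)]) w = increments Y r L w + u \<bullet> (Y t w - Y (last_time r L) w)"
  by (induction Y r L w rule: increments.induct) auto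

lemma energy_snoc:
  "energy H r (L @ [(t, u)]) = energy H r L + (norm u)\<^sup>2 * (t - last_time r L) powr (2 * H)"
  by (induction H r L rule: energy.induct) auto

lemma ascending_snoc:
  "ascending r (L @ [(t, u)]) \<longleftrightarrow> ascending r L \<and> last_time r L < t"
  by (induction r L rule: ascending.induct) auto

lemma last_time_ge: "ascending r L \<Longrightarrow> r \<le> last_time r L"
  by (induction r L rule: ascending.induct) auto

lemma energy_nonneg: "energy H r L \<ge> 0"
  by (induction H r L rule: energy.induct) auto

text \<open>The index set is nonempty because nondeterminism is stated for conditioning on at least one
  time.\<close>

definition past_combination :: "(real \<Rightarrow> 'a \<Rightarrow> real) \<Rightarrow> real \<Rightarrow> ('a \<Rightarrow> real) \<Rightarrow> bool" where
  "past_combination Y q Z \<longleftrightarrow>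
     (\<exists>T a. finite T \<and> T \<noteq> {} \<and> T \<subseteq> {0<..q} \<and> Z = (\<lambda>w. \<Sum>s\<in>T. a s * Y s w))"

lemma past_combination_single:
  "0 < s \<Longrightarrow> past_combination Y s (\<lambda>w. u * Y s w)"
  unfolding past_combination_def by (intro exI[of _ "{s}"] exI[of _ "\<lambda>_. u"]) auto

lemma past_combination_add:
  assumes "past_combination Y q Z" "q \<le> q'" "0 < s" "s \<le> q'"
  shows "past_combination Y q' (\<lambda>w. Z w + u * Y s w)"
proof -
  obtain T a where T: "finite T" "T \<noteq> {}" "T \<subseteq> {0<..q}" "Z = (\<lambda>w. \<Sum>s\<in>T. a s * Y s w)"
    using assms(1) unfolding past_combination_def by blast
  define a' where "a' = (\<lambda>x. (if x \<in> T then a x else 0) + (if x = s then u else 0))"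
  have "Z w + u * Y s w = (\<Sum>x\<in>insert s T. a' x * Y x w)" for w
  proof -
    have "(\<Sum>x\<in>insert s T. a' x * Y x w)
      = (\<Sum>x\<in>insert s T. (if x \<in> T then a x else 0) * Y x w) + (\<Sum>x\<in>insert s T. (if x = s then u else 0) * Y x w)"
      by (simp only: a'_def distrib_right sum.distrib)
    also have "(\<Sum>x\<in>insert s T. (if x \<in> T then a x else 0) * Y x w) = (\<Sum>x\<in>T. a x * Y x w)"
      using T(1) by (intro sum.mono_neutral_cong_right) auto
    also have "(\<Sum>x\<in>insert s T. (if x = s then u else 0) * Y x w) = (\<Sum>x\<in>{s}. u * Y x w)"
      using T(1) by (intro sum.mono_neutral_cong_right) auto
    finally show ?thesis using T(4) by simp
  qed
  then show ?thesis
    unfolding past_combination_def using T assms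
    by (intro exI[of _ "insert s T"] exI[of _ a']) auto
qed

lemma past_combination_increments:
  assumes "0 < r" "ascending r L"
  shows "past_combination Y (last_time r L) (\<lambda>w. u * Y r w + increments Y r L w)"
  using assms(2)
proof (induction L rule: rev_induct)
  case Nil
  then show ?case using past_combination_single[OF assms(1)] by simp
next
  case (snoc x L)
  obtain t v where x: "x = (t, v)" by force
  have L: "ascending r L" "last_time r L < t" using snoc.prems by (auto simp: x ascending_snoc)
  have l0: "0 < last_time r L" using last_time_ge[OF L(1)] assms(1) by linarith
  have e: "u * Y r w + increments Y r (L @ [x]) w =
      u * Y r w + increments Y r L w + v * Y t w + (- v) * Y (last_time r L) w" for w
    by (simp add: x increments_snoc algebra_simps)
  have e2: "last_time r (L @ [x]) = t" by (simp add: last_time_def x)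
  show ?case
    unfolding e e2
    by (rule past_combination_add[where q = t, OF past_combination_add[where q' = t, OF snoc.IH[OF L(1)]]])
      (use L(2) l0 in auto)
qed

lemma past_combination_square_integrable:
  assumes "past_combination Y q Z" "\<And>s. s > 0 \<Longrightarrow> square_integrable M (Y s)"
  shows "square_integrable M Z"
proof -
  obtain T a where T: "finite T" "T \<subseteq> {0<..q}" "Z = (\<lambda>w. \<Sum>s\<in>T. a s * Y s w)"
    using assms(1) unfolding past_combination_def by blast
  have "\<And>s. s \<in> T \<Longrightarrow> square_integrable M (\<lambda>w. a s * Y s w)"
    using T(2) by (intro square_integrable_cmult assms(2)) auto
  then show ?thesis
    unfolding T(3) using T(1) by (intro square_integrable_sum) auto
qed

text \<open>The latest increment cannot be cancelled by the past, so a chain \<open>Z + u \<Delta>\<close> has variance at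
  least a multiple of \<open>u\<^sup>2\<close> times the scale of \<open>\<Delta>\<close>. Since \<open>\<Delta>\<close> itself has variance at most another
  multiple of that scale, the variance of \<open>Z\<close> is controlled by that of \<open>Z + u \<Delta>\<close> as well, and one
  proceeds by induction from the last increment downwards.\<close>

lemma variance_ge_energy:
  fixes Y :: "real \<Rightarrow> 'a \<Rightarrow> real"
  assumes sq: "\<And>s. s > 0 \<Longrightarrow> square_integrable M (Y s)"
    and "\<kappa> > 0" and nondet: "\<And>q t Z u. \<lbrakk>past_combination Y q Z; 0 < q; q < t\<rbrakk> \<Longrightarrow>
        (LINT w|M. (Z w + u * Y t w)\<^sup>2) \<ge> \<kappa> * u\<^sup>2 * (t - q) powr (2 * H)"
    and "C \<ge> 0" and upper: "\<And>s t. \<lbrakk>0 < s; s < t\<rbrakk> \<Longrightarrow>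
        (LINT w|M. (Y t w - Y s w)\<^sup>2) \<le> C * (t - s) powr (2 * H)"
    and "v > 0" and lower: "\<And>s. s > 0 \<Longrightarrow> (LINT w|M. (Y s w)\<^sup>2) \<ge> v * s powr (2 * H)"
  shows "\<exists>c>0. \<forall>r>0. \<forall>u L. ascending r L \<and> length L = n \<longrightarrow>
     (LINT w|M. (u * Y r w + increments Y r L w)\<^sup>2) \<ge> c * (u\<^sup>2 * r powr (2 * H) + energy H r L)"
proof (induction n)
  case 0
  show ?case
  proof (intro exI[of _ v] conjI allI impI)
    fix r u :: real and L :: "(real \<times> real) list"
    assume "0 < r" "ascending r L \<and> length L = 0"
    then show "v * (u\<^sup>2 * r powr (2 * H) + energy H r L) \<le> (LINT w|M. (u * Y r w + increments Y r L w)\<^sup>2)"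
      using mult_left_mono[OF lower[of r], of "u\<^sup>2"] by (simp add: power_mult_distrib mult_ac)
  qed fact
next
  case (Suc n)
  then obtain c where c: "c > 0" and IH: "\<And>r u L. \<lbrakk>r > 0; ascending r L; length L = n\<rbrakk> \<Longrightarrow>
      (LINT w|M. (u * Y r w + increments Y r L w)\<^sup>2) \<ge> c * (u\<^sup>2 * r powr (2 * H) + energy H r L)"
    by blast
  define c' where "c' = min (\<kappa> / 2) (c / (4 + 4 * C / \<kappa>))"
  have den: "4 + 4 * C / \<kappa> > 0" using \<open>\<kappa> > 0\<close> \<open>C \<ge> 0\<close> by (simp add: add_pos_nonneg)
  show ?case
  proof (intro exI[of _ c'] conjI allI impI)
    show "c' > 0" unfolding c'_def using \<open>\<kappa> > 0\<close> c den by simp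
    fix r u :: real and L' :: "(real \<times> real) list"
    assume r: "0 < r" and L': "ascending r L' \<and> length L' = Suc n"
    then have "L' \<noteq> []" by auto
    then obtain L t x where Lt: "L' = L @ [(t, x)]"
      by (metis append_butlast_last_id surj_pair)
    have L: "ascending r L" "last_time r L < t" "length L = n"
      using L' by (auto simp: Lt ascending_snoc)
    define q where "q = last_time r L"
    have q: "0 < q" "q < t" using last_time_ge[OF L(1)] r L by (auto simp: q_def)
    define Z where "Z = (\<lambda>w. u * Y r w + increments Y r L w)"
    have pc: "past_combination Y q Z"
      unfolding Z_def q_def by (rule past_combination_increments[OF r L(1)])
    define d where "d = (t - q) powr (2 * H)"
    have d0: "d \<ge> 0" by (simp add: d_def)
    define Q where "Q = (LINT w|M. (u * Y r w + increments Y r L' w)\<^sup>2)"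
    have Q1: "u * Y r w + increments Y r L' w = Z w + (- x) * Y q w + x * Y t w" for w
      by (simp add: Lt increments_snoc Z_def q_def algebra_simps)
    have Qk: "Q \<ge> \<kappa> * x\<^sup>2 * d"
      unfolding Q_def Q1 d_def
      by (rule nondet[OF past_combination_add[OF pc]]) (use q in auto)
    have sqZ: "square_integrable M Z" by (rule past_combination_square_integrable[OF pc sq])
    have sqYt: "square_integrable M (Y t)" "square_integrable M (Y q)"
      using q sq by auto
    have sq1: "square_integrable M (\<lambda>w. u * Y r w + increments Y r L' w)"
      unfolding Q1 by (intro square_integrable_add square_integrable_cmult sqZ sqYt)
    have sq2: "square_integrable M (\<lambda>w. (- x) * (Y t w - Y q w))"
      by (intro square_integrable_cmult square_integrable_diff sqYt)
    have "(LINT w|M. (Z w)\<^sup>2) = (LINT w|M. (u * Y r w + increments Y r L' w + (- x) * (Y t w - Y q w))\<^sup>2)"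
      by (intro Bochner_Integration.integral_cong refl) (simp only: Q1, simp add: algebra_simps)
    also have "\<dots> \<le> 2 * Q + 2 * (LINT w|M. ((- x) * (Y t w - Y q w))\<^sup>2)"
      unfolding Q_def by (rule second_moment_add_le[OF sq1 sq2])
    also have "(LINT w|M. ((- x) * (Y t w - Y q w))\<^sup>2) = x\<^sup>2 * (LINT w|M. (Y t w - Y q w)\<^sup>2)"
      by (simp add: power_mult_distrib)
    also have "\<dots> \<le> x\<^sup>2 * (C * d)"
      unfolding d_def by (intro mult_left_mono upper q) auto
    also have "x\<^sup>2 * (C * d) \<le> C / \<kappa> * Q"
      using mult_left_mono[OF Qk, of "C / \<kappa>"] \<open>\<kappa> > 0\<close> \<open>C \<ge> 0\<close> by (simp add: mult_ac)
    finally have EZ: "(LINT w|M. (Z w)\<^sup>2) \<le> (2 + 2 * C / \<kappa>) * Q"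
      by (simp add: algebra_simps)
    define E where "E = u\<^sup>2 * r powr (2 * H) + energy H r L"
    have E0: "E \<ge> 0" by (simp add: E_def energy_nonneg)
    have "c * E \<le> (2 + 2 * C / \<kappa>) * Q"
      using IH[OF r L(1,3), of u] EZ by (simp add: Z_def E_def)
    then have "c * E / (4 + 4 * C / \<kappa>) \<le> Q / 2"
    proof (subst pos_divide_le_eq[OF den])
      assume "c * E \<le> (2 + 2 * C / \<kappa>) * Q"
      also have "\<dots> = Q / 2 * (4 + 4 * C / \<kappa>)" by (simp add: algebra_simps)
      finally show "c * E \<le> Q / 2 * (4 + 4 * C / \<kappa>)" .
    qed
    moreover have "\<kappa> / 2 * (x\<^sup>2 * d) \<le> Q / 2" using Qk by simp
    moreover have "c' * E \<le> c / (4 + 4 * C / \<kappa>) * E" unfolding c'_def by (intro mult_right_mono E0) auto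
    moreover have "c' * (x\<^sup>2 * d) \<le> \<kappa> / 2 * (x\<^sup>2 * d)" unfolding c'_def by (intro mult_right_mono min.cobounded1) (simp add: d0)
    ultimately have "c' * (E + x\<^sup>2 * d) \<le> Q"
      unfolding distrib_left times_divide_eq_left by linarith
    then show "c' * (u\<^sup>2 * r powr (2 * H) + energy H r L') \<le> (LINT w|M. (u * Y r w + increments Y r L' w)\<^sup>2)"
      by (simp add: Q_def E_def Lt energy_snoc d_def q_def add.assoc)
  qed
qed

section \<open>Strong local nondeterminism as a statement about linear combinations\<close>

text \<open>The conditional variance is the smallest mean square error of an approximation by a random
  variable that is measurable with respect to the past.\<close>

lemma cond_variance_le_second_moment:
  assumes "prob_space M" and sub: "subalgebra M F"
    and V: "square_integrable M V" and Z: "square_integrable M Z" and ZF: "Z \<in> borel_measurable F"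
    and cv: "AE w in M. cond_variance M F V w \<ge> k"
  shows "(LINT w|M. (V w + Z w)\<^sup>2) \<ge> k"
proof -
  interpret prob_space M by fact
  interpret finite_measure_subalgebra M F by standard fact
  define C where "C = real_cond_exp M F V"
  have intsq: "integrable M W" if "square_integrable M W" for W
    using square_integrable_mult[OF that, of "\<lambda>_. 1"] by (simp add: square_integrable_def)
  have CF: "C \<in> borel_measurable F" unfolding C_def by simp
  have [measurable]: "C \<in> borel_measurable M" "V \<in> borel_measurable M" "Z \<in> borel_measurable M"
    using V Z unfolding C_def by (auto simp: square_integrable_def)
  have C: "square_integrable M C"
    unfolding square_integrable_def C_def
    using V by (auto intro!: integrable_convex_cond_exp[where I = UNIV and q = power2, OF intsq[OF V]]
        simp: convex_power2 square_integrable_def)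
  have D: "square_integrable M (\<lambda>w. V w - C w)" and S: "square_integrable M (\<lambda>w. C w + Z w)"
    by (intro square_integrable_diff square_integrable_add V C Z)+
  have SV: "integrable M (\<lambda>w. (C w + Z w) * V w)" by (rule square_integrable_mult[OF S V])
  have "(LINT w|M. (C w + Z w) * C w) = (LINT w|M. (C w + Z w) * V w)"
    unfolding C_def by (rule real_cond_exp_intg(2)) (use SV CF ZF in \<open>auto simp: C_def\<close>)
  then have orth: "(LINT w|M. (V w - C w) * (C w + Z w)) = 0"
    using SV square_integrable_mult[OF S C]
    by (simp add: left_diff_distrib mult.commute[of "C _ + Z _"])
  have "k = (LINT w|M. k)" by (simp add: prob_space)
  also have "\<dots> \<le> (LINT w|M. cond_variance M F V w)"
    using D cv unfolding cond_variance_def C_def[symmetric]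
    by (intro integral_mono_AE real_cond_exp_int(1)) (auto simp: square_integrable_def)
  also have "\<dots> = (LINT w|M. (V w - C w)\<^sup>2)"
    using D unfolding cond_variance_def C_def[symmetric]
    by (intro real_cond_exp_int(2)) (auto simp: square_integrable_def)
  also have "\<dots> \<le> (LINT w|M. (V w - C w)\<^sup>2) + (LINT w|M. (C w + Z w)\<^sup>2)"
    by simp
  also have "\<dots> = (LINT w|M. (V w - C w)\<^sup>2 + (C w + Z w)\<^sup>2 + 2 * ((V w - C w) * (C w + Z w)))"
    using D S square_integrable_mult[OF D S] orth by (simp add: square_integrable_def)
  also have "\<dots> = (LINT w|M. (V w + Z w)\<^sup>2)"
    by (intro Bochner_Integration.integral_cong refl) (simp add: power2_eq_square algebra_simps)
  finally show ?thesis .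
qed

lemma strongly_locally_nondeterministic_combination:
  assumes "prob_space M" and sq: "\<And>s. s > 0 \<Longrightarrow> square_integrable M (Y s)"
    and slnd: "strongly_locally_nondeterministic M H Y" and "H > 0"
  shows "\<exists>\<kappa>>0. \<forall>q t Z u. past_combination Y q Z \<and> 0 < q \<and> q < t \<longrightarrow>
    (LINT w|M. (Z w + u * Y t w)\<^sup>2) \<ge> \<kappa> * u\<^sup>2 * (t - q) powr (2 * H)"
proof -
  obtain \<kappa> where "\<kappa> > 0" and nd: "\<And>m s t. \<lbrakk>m \<ge> 1; 0 < s 1; \<forall>j\<in>{1..<m}. s j \<le> s (Suc j); s m < t\<rbrakk> \<Longrightarrow>
      (AE w in M. cond_variance M
             (vimage_algebra (space M) (\<lambda>w. \<lambda>j\<in>{1..m}. Y (s j) w) (PiM {1..m} (\<lambda>_. borel))) (Y t) w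
           \<ge> \<kappa> * Min ((\<lambda>j. \<bar>t - s j\<bar> powr (2 * H)) ` {1..m}))"
    using slnd unfolding strongly_locally_nondeterministic_def by blast
  have "(LINT w|M. (Z w + u * Y t w)\<^sup>2) \<ge> \<kappa> * u\<^sup>2 * (t - q) powr (2 * H)"
    if pc: "past_combination Y q Z" and "0 < q" "q < t" for q t Z u
  proof (cases "u = 0")
    case True
    then show ?thesis by simp
  next
    case False
    obtain T a where T: "finite T" "T \<noteq> {}" "T \<subseteq> {0<..q}" and Z: "Z = (\<lambda>w. \<Sum>s\<in>T. a s * Y s w)"
      using pc unfolding past_combination_def by blast
    define m where "m = card T"
    define s where "s = (\<lambda>j. sorted_list_of_set T ! (j - 1))"
    define F where "F = vimage_algebra (space M) (\<lambda>w. \<lambda>j\<in>{1..m}. Y (s j) w) (PiM {1..m} (\<lambda>_. borel :: real measure))"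
    have m: "m \<ge> 1" using T by (simp add: m_def Suc_leI card_gt_0_iff)
    have sT: "bij_betw s {1..m} T"
    proof -
      have "bij_betw (\<lambda>i. sorted_list_of_set T ! i) {..<m} T"
        using bij_betw_nth[of "sorted_list_of_set T" "{..<m}" T] T(1) by (simp add: m_def)
      moreover have "bij_betw (\<lambda>j. j - 1) {1..m} {..<m}"
        by (rule bij_betwI[of _ _ _ Suc]) auto
      ultimately show ?thesis
        unfolding s_def using bij_betw_trans by (fastforce simp: comp_def)
    qed
    then have sin: "s j \<in> T" if "j \<in> {1..m}" for j using that by (auto simp: bij_betw_def)
    have sub: "subalgebra M F"
    proof -
      have "(\<lambda>w. \<lambda>j\<in>{1..m}. Y (s j) w) \<in> M \<rightarrow>\<^sub>M PiM {1..m} (\<lambda>_. borel :: real measure)"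
        using sin T(3) by (intro measurable_restrict square_integrable_measurable sq) force
      then have "sets (vimage_algebra (space M) (\<lambda>w. \<lambda>j\<in>{1..m}. Y (s j) w) (PiM {1..m} (\<lambda>_. borel :: real measure))) \<subseteq> sets M"
        by (subst sets_vimage_algebra2) (auto simp: measurable_def)
      then show ?thesis
        by (simp add: subalgebra_def F_def)
    qed
    define Z' where "Z' = (\<lambda>w. (1 / u) * Z w)"
    have Z': "Z' \<in> borel_measurable F"
    proof -
      have P: "(\<lambda>w. \<lambda>j\<in>{1..m}. Y (s j) w) \<in> F \<rightarrow>\<^sub>M PiM {1..m} (\<lambda>_. borel :: real measure)"
        unfolding F_def by (rule measurable_vimage_algebra1) (auto simp: space_PiM)
      have "(\<lambda>x. (1 / u) * (\<Sum>j\<in>{1..m}. a (s j) * x j)) \<in> borel_measurable (PiM {1..m} (\<lambda>_. borel :: real measure))"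
        by measurable
      from measurable_compose[OF P this]
      have "(\<lambda>w. (1 / u) * (\<Sum>j\<in>{1..m}. a (s j) * Y (s j) w)) \<in> borel_measurable F"
        by simp
      moreover have "(\<Sum>j\<in>{1..m}. a (s j) * Y (s j) w) = Z w" for w
        unfolding Z by (rule sum.reindex_bij_betw[OF sT])
      ultimately show ?thesis by (simp add: Z'_def)
    qed
    have AE: "AE w in M. cond_variance M F (Y t) w \<ge> \<kappa> * Min ((\<lambda>j. \<bar>t - s j\<bar> powr (2 * H)) ` {1..m})"
      unfolding F_def
    proof (rule nd[OF m])
      show "0 < s 1" using sin[of 1] m T(3) by auto
      show "s m < t" using sin[of m] m T(3) \<open>q < t\<close> by force
      show "\<forall>j\<in>{1..<m}. s j \<le> s (Suc j)"
      proof
        fix j assume j: "j \<in> {1..<m}"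
        then show "s j \<le> s (Suc j)"
          unfolding s_def using T(1) by (intro sorted_nth_mono) (auto simp: m_def)
      qed
    qed
    have "(t - q) powr (2 * H) \<le> Min ((\<lambda>j. \<bar>t - s j\<bar> powr (2 * H)) ` {1..m})"
    proof (rule Min.boundedI)
      fix x assume "x \<in> (\<lambda>j. \<bar>t - s j\<bar> powr (2 * H)) ` {1..m}"
      then obtain j where j: "j \<in> {1..m}" "x = \<bar>t - s j\<bar> powr (2 * H)" by auto
      have "s j \<le> q" using sin[OF j(1)] T(3) by auto
      then show "(t - q) powr (2 * H) \<le> x"
        unfolding j(2) using \<open>q < t\<close> \<open>H > 0\<close> by (intro powr_mono2) auto
    qed (use m in auto)
    then have le: "(t - q) powr (2 * H) \<le> Min ((\<lambda>j. \<bar>t - s j\<bar> powr (2 * H)) ` {1..m})" .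
    from AE have AE2: "AE w in M. cond_variance M F (Y t) w \<ge> \<kappa> * (t - q) powr (2 * H)"
    proof (rule eventually_mono)
      fix w assume w: "\<kappa> * Min ((\<lambda>j. \<bar>t - s j\<bar> powr (2 * H)) ` {1..m}) \<le> cond_variance M F (Y t) w"
      have "\<kappa> * (t - q) powr (2 * H) \<le> \<kappa> * Min ((\<lambda>j. \<bar>t - s j\<bar> powr (2 * H)) ` {1..m})"
        using \<open>\<kappa> > 0\<close> le by (intro mult_left_mono) auto
      then show "\<kappa> * (t - q) powr (2 * H) \<le> cond_variance M F (Y t) w" using w by (rule order_trans)
    qed
    have sqZ: "square_integrable M Z'"
      unfolding Z'_def by (intro square_integrable_cmult past_combination_square_integrable[OF pc sq])
    have "\<kappa> * (t - q) powr (2 * H) \<le> (LINT w|M. (Y t w + Z' w)\<^sup>2)"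
      using \<open>0 < q\<close> \<open>q < t\<close>
      by (intro cond_variance_le_second_moment[OF \<open>prob_space M\<close> sub _ sqZ Z' AE2] sq) auto
    then have "u\<^sup>2 * (\<kappa> * (t - q) powr (2 * H)) \<le> u\<^sup>2 * (LINT w|M. (Y t w + Z' w)\<^sup>2)"
      by (intro mult_left_mono) auto
    also have "\<dots> = (LINT w|M. u\<^sup>2 * (Y t w + Z' w)\<^sup>2)"
      by simp
    also have "\<dots> = (LINT w|M. (Z w + u * Y t w)\<^sup>2)"
      using False by (intro Bochner_Integration.integral_cong refl)
        (simp add: Z'_def power_mult_distrib[symmetric] distrib_left add.commute)
    finally show ?thesis by (simp add: mult_ac)
  qed
  then show ?thesis using \<open>\<kappa> > 0\<close> by blast
qed

section \<open>The chain kernel\<close>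

lemma indicator_interval_measurable [measurable (raw)]:
  fixes f g :: "'a \<Rightarrow> real"
  assumes [measurable]: "f \<in> borel_measurable N" "g \<in> borel_measurable N"
  shows "(\<lambda>x. indicator {0<..<f x} (g x) :: ennreal) \<in> borel_measurable N"
proof -
  have "(\<lambda>x. indicator {0<..<f x} (g x) :: ennreal) = (\<lambda>x. if 0 < g x \<and> g x < f x then 1 else 0)"
    by (auto simp: indicator_def)
  then show ?thesis by simp
qed

lemma measurable_case_prod_apply:
  assumes "(\<lambda>(s, u). K s u) \<in> borel_measurable (borel \<Otimes>\<^sub>M borel)"
    "f \<in> borel_measurable N" "g \<in> borel_measurable N"
  shows "(\<lambda>x. K (f x) (g x)) \<in> borel_measurable N"
  using measurable_compose[OF measurable_Pair[OF assms(2,3)] assms(1)] by simp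

text \<open>The bound that the moments of the occupation functionals satisfy: one time and one frequency are
  integrated out in each step, the frequency with weight \<open>G\<close>. The chain is continued downwards from
  time \<open>s\<close>, where \<open>u\<close> is the sum of the frequencies collected so far.\<close>

primrec chain_kernel :: "real \<Rightarrow> real \<Rightarrow> ('b::euclidean_space \<Rightarrow> real) \<Rightarrow> nat \<Rightarrow> real \<Rightarrow> 'b \<Rightarrow> ennreal" where
  "chain_kernel c H G 0 = (\<lambda>s u. ennreal (exp (- c * (norm u)\<^sup>2 * s powr (2 * H))))"
| "chain_kernel c H G (Suc n) = (\<lambda>s u. \<integral>\<^sup>+r. indicator {0<..<s} r *
     (\<integral>\<^sup>+\<xi>. ennreal (G \<xi> * exp (- c * (norm u)\<^sup>2 * (s - r) powr (2 * H))) * chain_kernel c H G n r (u + \<xi>) \<partial>lborel) \<partial>lborel)"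

lemma chain_kernel_measurable:
  assumes [measurable]: "G \<in> borel_measurable borel"
  shows "(\<lambda>(s, u). chain_kernel c H G n s u) \<in> borel_measurable (borel \<Otimes>\<^sub>M borel)"
proof (induction n)
  case 0
  then show ?case by simp
next
  case (Suc n)
  note [measurable (raw)] = measurable_case_prod_apply[OF Suc]
  show ?case unfolding chain_kernel.simps by measurable
qed

lemma chain_kernel_measurable' [measurable (raw)]:
  assumes "G \<in> borel_measurable borel" "f \<in> borel_measurable N" "g \<in> borel_measurable N"
  shows "(\<lambda>x. chain_kernel c H G n (f x) (g x)) \<in> borel_measurable N"
  by (rule measurable_case_prod_apply[OF chain_kernel_measurable[OF assms(1)] assms(2,3)])

definition scale_kernel :: "real \<Rightarrow> real \<Rightarrow> ('b::euclidean_space \<Rightarrow> real) \<Rightarrow> real \<Rightarrow> ennreal" where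
  "scale_kernel c H G \<delta> = (\<integral>\<^sup>+v. ennreal ((G v)\<^sup>2 * exp (- c * (norm v)\<^sup>2 * \<delta> powr (2 * H))) \<partial>lborel)"

lemma scale_kernel_measurable [measurable]:
  assumes [measurable]: "G \<in> borel_measurable borel"
  shows "scale_kernel c H G \<in> borel_measurable borel"
  unfolding scale_kernel_def[abs_def] by measurable

text \<open>A submultiplicative weight allows to replace the frequencies by their partial sums, at the price
  of squaring the weight. In terms of the partial sums the kernel is an iterated convolution in time
  of \<open>scale_kernel\<close>.\<close>

lemma chain_kernel_step_le:
  fixes G :: "'b::euclidean_space \<Rightarrow> real"
  assumes [measurable]: "G \<in> borel_measurable borel" and G0: "\<And>x. G x \<ge> 0"
    and sub: "\<And>u x. G x \<le> G u * G (u + x)"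
  shows "(\<integral>\<^sup>+u. ennreal (G u) * chain_kernel c H G (Suc n) s u \<partial>lborel)
    \<le> (\<integral>\<^sup>+r. indicator {0<..<s} r * (scale_kernel c H G (s - r) * (\<integral>\<^sup>+u. ennreal (G u) * chain_kernel c H G n r u \<partial>lborel)) \<partial>lborel)"
proof -
  define B where "B = (\<lambda>r. \<integral>\<^sup>+u. ennreal (G u) * chain_kernel c H G n r u \<partial>lborel)"
  have [measurable]: "B \<in> borel_measurable borel" unfolding B_def by measurable
  define e where "e u r = exp (- c * (norm u)\<^sup>2 * (s - r) powr (2 * H))" for u :: 'b and r
  have [measurable (raw)]: "(\<lambda>x. e (f x) (g x)) \<in> borel_measurable N"
    if [measurable]: "f \<in> borel_measurable N" "g \<in> borel_measurable N" for f g and N :: "(real \<times> 'b) measure"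
    unfolding e_def by measurable
  have [measurable]: "(\<lambda>u. e u r) \<in> borel_measurable borel" "e u \<in> borel_measurable borel" for r u
    unfolding e_def[abs_def] by measurable
  have e0: "e u r \<ge> 0" for u r by (simp add: e_def)
  have inner: "(\<integral>\<^sup>+\<xi>. ennreal (G \<xi> * e u r) * chain_kernel c H G n r (u + \<xi>) \<partial>lborel)
      \<le> ennreal (G u * e u r) * B r" for u r
  proof -
    have "(\<integral>\<^sup>+\<xi>. ennreal (G \<xi> * e u r) * chain_kernel c H G n r (u + \<xi>) \<partial>lborel)
      \<le> (\<integral>\<^sup>+\<xi>. ennreal (G u * e u r) * (ennreal (G (u + \<xi>)) * chain_kernel c H G n r (u + \<xi>)) \<partial>lborel)"
    proof (rule nn_integral_mono)
      fix \<xi> :: 'b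
      have "G \<xi> * e u r \<le> G u * G (u + \<xi>) * e u r" by (intro mult_right_mono sub e0)
      then have "ennreal (G \<xi> * e u r) \<le> ennreal (G u * e u r * G (u + \<xi>))"
        by (intro ennreal_leI) (simp add: mult_ac)
      also have "\<dots> = ennreal (G u * e u r) * ennreal (G (u + \<xi>))"
        using G0 e0 by (intro ennreal_mult mult_nonneg_nonneg) auto
      finally show "ennreal (G \<xi> * e u r) * chain_kernel c H G n r (u + \<xi>) \<le>
         ennreal (G u * e u r) * (ennreal (G (u + \<xi>)) * chain_kernel c H G n r (u + \<xi>))"
        unfolding mult.assoc[symmetric] by (intro mult_right_mono) auto
    qed
    also have "\<dots> = ennreal (G u * e u r) * (\<integral>\<^sup>+\<xi>. ennreal (G (u + \<xi>)) * chain_kernel c H G n r (u + \<xi>) \<partial>lborel)"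
      by (rule nn_integral_cmult) measurable
    also have "(\<integral>\<^sup>+\<xi>. ennreal (G (u + \<xi>)) * chain_kernel c H G n r (u + \<xi>) \<partial>lborel) = B r"
      using lborel_scale_nn_integral[of 1 "\<lambda>x. ennreal (G x) * chain_kernel c H G n r x" u]
      by (simp add: B_def)
    finally show ?thesis .
  qed
  have "(\<integral>\<^sup>+u. ennreal (G u) * chain_kernel c H G (Suc n) s u \<partial>lborel)
     \<le> (\<integral>\<^sup>+u. ennreal (G u) * (\<integral>\<^sup>+r. indicator {0<..<s} r * (ennreal (G u * e u r) * B r) \<partial>lborel) \<partial>lborel)"
    unfolding chain_kernel.simps e_def[symmetric]
    by (intro nn_integral_mono mult_left_mono inner) auto
  also have "\<dots> = (\<integral>\<^sup>+u. (\<integral>\<^sup>+r. indicator {0<..<s} r * (ennreal ((G u)\<^sup>2 * e u r) * B r) \<partial>lborel) \<partial>lborel)"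
  proof (rule nn_integral_cong)
    fix u :: 'b
    have "ennreal (G u) * (indicator {0<..<s} r * (ennreal (G u * e u r) * B r))
       = indicator {0<..<s} r * (ennreal ((G u)\<^sup>2 * e u r) * B r)" for r
      using G0[of u] e0[of u r] by (simp add: power2_eq_square ennreal_mult' ennreal_mult'' mult_ac)
    then show "ennreal (G u) * (\<integral>\<^sup>+r. indicator {0<..<s} r * (ennreal (G u * e u r) * B r) \<partial>lborel)
      = (\<integral>\<^sup>+r. indicator {0<..<s} r * (ennreal ((G u)\<^sup>2 * e u r) * B r) \<partial>lborel)"
      by (subst nn_integral_cmult[symmetric]) auto
  qed
  also have "\<dots> = (\<integral>\<^sup>+r. (\<integral>\<^sup>+u. indicator {0<..<s} r * (ennreal ((G u)\<^sup>2 * e u r) * B r) \<partial>lborel) \<partial>lborel)"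
    by (rule lborel_pair.Fubini') measurable
  also have "\<dots> = (\<integral>\<^sup>+r. indicator {0<..<s} r * (scale_kernel c H G (s - r) * B r) \<partial>lborel)"
    unfolding scale_kernel_def e_def[symmetric]
    by (intro nn_integral_cong) (simp add: nn_integral_cmult nn_integral_multc)
  finally show ?thesis unfolding B_def .
qed

text \<open>Young's inequality for the convolution, once per step: the sum of the time gaps is at most \<open>t\<close>,
  so each gap may be integrated over \<open>{0<..<t}\<close> independently of the others.\<close>

lemma chain_kernel_integral_le:
  fixes G :: "'b::euclidean_space \<Rightarrow> real"
  assumes [measurable]: "G \<in> borel_measurable borel" and G1: "\<And>x. G x \<ge> 1"
    and sub: "\<And>u x. G x \<le> G u * G (u + x)"
  shows "(\<integral>\<^sup>+s. indicator {0<..<t} s * (\<integral>\<^sup>+u. ennreal (G u) * chain_kernel c H G n s u \<partial>lborel) \<partial>lborel)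
    \<le> (\<integral>\<^sup>+s. indicator {0<..<t} s * scale_kernel c H G s \<partial>lborel) ^ Suc n"
proof (induction n)
  case 0
  have "ennreal (G u) * ennreal (exp (- c * (norm u)\<^sup>2 * s powr (2 * H)))
     \<le> ennreal ((G u)\<^sup>2 * exp (- c * (norm u)\<^sup>2 * s powr (2 * H)))" for s u
    using G1[of u] by (subst ennreal_mult[symmetric]) (auto intro!: ennreal_leI mult_right_mono simp: power2_eq_square)
  then show ?case
    by (auto intro!: nn_integral_mono mult_left_mono simp: scale_kernel_def)
next
  case (Suc n)
  define B where "B = (\<lambda>r. \<integral>\<^sup>+u. ennreal (G u) * chain_kernel c H G n r u \<partial>lborel)"
  define K where "K = scale_kernel c H G"
  have [measurable]: "B \<in> borel_measurable borel" unfolding B_def by measurable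
  have [measurable]: "K \<in> borel_measurable borel" unfolding K_def by measurable
  have G0: "G x \<ge> 0" for x using G1[of x] by simp
  have "(\<integral>\<^sup>+s. indicator {0<..<t} s * (\<integral>\<^sup>+u. ennreal (G u) * chain_kernel c H G (Suc n) s u \<partial>lborel) \<partial>lborel)
     \<le> (\<integral>\<^sup>+s. indicator {0<..<t} s * (\<integral>\<^sup>+r. indicator {0<..<s} r * (K (s - r) * B r) \<partial>lborel) \<partial>lborel)"
    unfolding B_def K_def by (intro nn_integral_mono mult_left_mono chain_kernel_step_le G0 sub) auto
  also have "\<dots> = (\<integral>\<^sup>+s. (\<integral>\<^sup>+r. indicator {0<..<t} s * (indicator {0<..<s} r * (K (s - r) * B r)) \<partial>lborel) \<partial>lborel)"
    by (intro nn_integral_cong) (auto simp: nn_integral_cmult)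
  also have "\<dots> = (\<integral>\<^sup>+r. (\<integral>\<^sup>+s. indicator {0<..<t} s * (indicator {0<..<s} r * (K (s - r) * B r)) \<partial>lborel) \<partial>lborel)"
    by (rule lborel_pair.Fubini') measurable
  also have "\<dots> \<le> (\<integral>\<^sup>+r. indicator {0<..<t} r * B r * (\<integral>\<^sup>+s. indicator {0<..<t} s * K s \<partial>lborel) \<partial>lborel)"
  proof (rule nn_integral_mono)
    fix r :: real
    have "(\<integral>\<^sup>+s. indicator {0<..<t} s * (indicator {0<..<s} r * (K (s - r) * B r)) \<partial>lborel)
       \<le> (\<integral>\<^sup>+s. (indicator {0<..<t} r * B r) * (indicator {0<..<t} (s - r) * K (s - r)) \<partial>lborel)"
      by (intro nn_integral_mono) (auto simp: indicator_def mult_ac)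
    also have "\<dots> = (indicator {0<..<t} r * B r) * (\<integral>\<^sup>+s. (indicator {0<..<t} (s - r) * K (s - r)) \<partial>lborel)"
      by (rule nn_integral_cmult) measurable
    also have "(\<integral>\<^sup>+s. (indicator {0<..<t} (s - r) * K (s - r)) \<partial>lborel) = (\<integral>\<^sup>+s. indicator {0<..<t} s * K s \<partial>lborel)"
      using lborel_scale_nn_integral[of 1 "\<lambda>s. indicator {0<..<t} s * K s" "- r"] by (simp add: add.commute)
    finally show "(\<integral>\<^sup>+s. indicator {0<..<t} s * (indicator {0<..<s} r * (K (s - r) * B r)) \<partial>lborel)
       \<le> indicator {0<..<t} r * B r * (\<integral>\<^sup>+s. indicator {0<..<t} s * K s \<partial>lborel)" .
  qed
  also have "\<dots> = (\<integral>\<^sup>+r. indicator {0<..<t} r * B r \<partial>lborel) * (\<integral>\<^sup>+s. indicator {0<..<t} s * K s \<partial>lborel)"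
    by (rule nn_integral_multc) measurable
  also have "\<dots> \<le> (\<integral>\<^sup>+s. indicator {0<..<t} s * K s \<partial>lborel) ^ Suc n * (\<integral>\<^sup>+s. indicator {0<..<t} s * K s \<partial>lborel)"
    using Suc unfolding B_def K_def by (intro mult_right_mono) auto
  finally show ?case by (simp add: K_def mult.commute)
qed

lemma nn_integral_powr_less_top:
  fixes a t :: real
  assumes "a < 1" "t > 0"
  shows "(\<integral>\<^sup>+s. indicator {0<..<t} s * ennreal (s powr (- a)) \<partial>lborel) < \<infinity>"
proof -
  have "(\<lambda>s. s powr (- a)) integrable_on {0..t}"
    by (rule integrable_on_powr_from_0) (use assms in auto)
  hence "(\<lambda>s. s powr (- a)) absolutely_integrable_on {0..t}"
    by (subst absolutely_integrable_on_iff_nonneg) auto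
  then have "integrable lborel (\<lambda>s. indicat_real {0..t} s *\<^sub>R s powr (- a))"
    unfolding set_integrable_def by (subst (asm) integrable_completion) auto
  then have "(\<integral>\<^sup>+s. ennreal (norm (indicat_real {0..t} s *\<^sub>R s powr (- a))) \<partial>lborel) < \<infinity>"
    by (simp add: integrable_iff_bounded)
  moreover have "(\<integral>\<^sup>+s. indicator {0<..<t} s * ennreal (s powr (- a)) \<partial>lborel)
      \<le> (\<integral>\<^sup>+s. ennreal (norm (indicat_real {0..t} s *\<^sub>R s powr (- a))) \<partial>lborel)"
    by (intro nn_integral_mono) (auto simp: indicator_def)
  ultimately show ?thesis by (rule le_less_trans[rotated])
qed

lemma scale_kernel_integral_less_top:
  fixes c H t B :: real
  assumes "c > 0" "H > 0" "t > 0" and "H * (real DIM('b::euclidean_space) + 2 * real \<beta>) < 1"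
  shows "(\<integral>\<^sup>+s. indicator {0<..<t} s * scale_kernel c H (\<lambda>x::'b. B * (1 + norm x) ^ \<beta>) s \<partial>lborel) < \<infinity>"
proof -
  obtain C where C: "C \<ge> 0" "\<And>\<delta>. \<lbrakk>0 < \<delta>; \<delta> \<le> t\<rbrakk> \<Longrightarrow>
    (\<integral>\<^sup>+v. ennreal ((1 + norm (v::'b)) ^ (2 * \<beta>) * exp (- c * (norm v)\<^sup>2 * \<delta> powr (2 * H))) \<partial>lborel)
      \<le> ennreal (C * \<delta> powr (- H * (real DIM('b) + real (2 * \<beta>))))"
    using gaussian_moment_scaling[OF assms(1-3), where k = "2 * \<beta>" and 'a = 'b] by blast
  define \<alpha> where "\<alpha> = H * (real DIM('b) + 2 * real \<beta>)"
  have le: "scale_kernel c H (\<lambda>x::'b. B * (1 + norm x) ^ \<beta>) s \<le> ennreal (B\<^sup>2) * ennreal (C * s powr (- \<alpha>))"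
    if s: "0 < s" "s < t" for s
  proof -
    have "scale_kernel c H (\<lambda>x::'b. B * (1 + norm x) ^ \<beta>) s
      = (\<integral>\<^sup>+v. ennreal (B\<^sup>2) * ennreal ((1 + norm (v::'b)) ^ (2 * \<beta>) * exp (- c * (norm v)\<^sup>2 * s powr (2 * H))) \<partial>lborel)"
      unfolding scale_kernel_def
      by (intro nn_integral_cong)
        (simp add: power_mult_distrib power_mult[symmetric] mult.commute[of \<beta>] ennreal_mult[symmetric] mult.assoc)
    also have "\<dots> = ennreal (B\<^sup>2) * (\<integral>\<^sup>+v. ennreal ((1 + norm (v::'b)) ^ (2 * \<beta>) * exp (- c * (norm v)\<^sup>2 * s powr (2 * H))) \<partial>lborel)"
      by (rule nn_integral_cmult) measurable
    also have "\<dots> \<le> ennreal (B\<^sup>2) * ennreal (C * s powr (- \<alpha>))"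
      using C(2)[of s] s by (intro mult_left_mono) (auto simp: \<alpha>_def)
    finally show ?thesis .
  qed
  have "(\<integral>\<^sup>+s. indicator {0<..<t} s * scale_kernel c H (\<lambda>x::'b. B * (1 + norm x) ^ \<beta>) s \<partial>lborel)
    \<le> (\<integral>\<^sup>+s. ennreal (B\<^sup>2 * C) * (indicator {0<..<t} s * ennreal (s powr (- \<alpha>))) \<partial>lborel)"
    using le C(1) by (intro nn_integral_mono) (auto simp: indicator_def ennreal_mult mult.assoc)
  also have "\<dots> = ennreal (B\<^sup>2 * C) * (\<integral>\<^sup>+s. indicator {0<..<t} s * ennreal (s powr (- \<alpha>)) \<partial>lborel)"
    by (rule nn_integral_cmult) measurable
  also have "\<dots> < \<infinity>"
    using nn_integral_powr_less_top[of \<alpha> t] assms by (simp add: ennreal_mult_less_top \<alpha>_def)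
  finally show ?thesis .
qed

section \<open>Moments of occupation functionals\<close>

definition occupation :: "(real \<Rightarrow> 'a \<Rightarrow> 'b) \<Rightarrow> ('b \<Rightarrow> real) \<Rightarrow> real \<Rightarrow> 'a \<Rightarrow> real" where
  "occupation X g s w = (LINT r:{0..s}|lborel. g (X r w))"

text \<open>The normalising factor of the Fourier transform is part of the multiplier \<open>b\<close>.\<close>

definition fourier_of :: "('b::euclidean_space \<Rightarrow> complex) \<Rightarrow> ('b \<Rightarrow> real) \<Rightarrow> bool" where
  "fourier_of b g \<longleftrightarrow> integrable lborel b \<and> (\<forall>x. complex_of_real (g x) = (LINT \<xi>|lborel. b \<xi> * iexp (\<xi> \<bullet> x)))"

lemma power_of_primitive:
  fixes f :: "real \<Rightarrow> real"
  assumes "continuous_on {0..s} f" "0 \<le> s"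
  shows "(LINT r:{0..s}|lborel. f r) ^ Suc n
    = (LINT r:{0..s}|lborel. real (Suc n) * f r * (LINT q:{0..r}|lborel. f q) ^ n)"
proof -
  define F where "F r = integral {0..r} f" for r
  have F: "(LINT q:{0..r}|lborel. f q) = F r" if "r \<in> {0..s}" for r
    unfolding F_def using that assms
    by (intro set_borel_integral_eq_integral borel_integrable_atLeastAtMost') (auto intro: continuous_on_subset)
  have d: "(F has_real_derivative f r) (at r within {0..s})" if "r \<in> {0..s}" for r
    unfolding F_def[abs_def] by (rule integral_has_real_derivative[OF assms(1) that])
  have cF: "continuous_on {0..s} F"
    by (rule DERIV_continuous_on[OF d])
  have "(LINT r:{0..s}|lborel. real (Suc n) * f r * (LINT q:{0..r}|lborel. f q) ^ n)
      = (LINT r:{0..s}|lborel. real (Suc n) * f r * F r ^ n)"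
    by (rule set_lebesgue_integral_cong) (auto simp: F)
  also have "\<dots> = F s ^ Suc n - F 0 ^ Suc n"
    unfolding set_lebesgue_integral_def
  proof (rule integral_FTC_atLeastAtMost[OF assms(2)])
    show "((\<lambda>r. F r ^ Suc n) has_vector_derivative real (Suc n) * f r * F r ^ n) (at r within {0..s})"
      if "0 \<le> r" "r \<le> s" for r
      using DERIV_power[OF d[of r], of "Suc n"] that
      by (simp add: has_real_derivative_iff_has_vector_derivative[symmetric] mult_ac)
    show "continuous_on {0..s} (\<lambda>r. real (Suc n) * f r * F r ^ n)"
      by (intro continuous_intros assms cF)
  qed
  also have "\<dots> = (LINT r:{0..s}|lborel. f r) ^ Suc n"
    using F[of s] assms(2) by (simp add: F_def)
  finally show ?thesis ..
qed

lemma fourier_of_bounded: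
  assumes "fourier_of b g"
  shows "\<bar>g x\<bar> \<le> (LINT \<xi>|lborel. norm (b \<xi>))"
proof -
  have "\<bar>g x\<bar> = norm (LINT \<xi>|lborel. b \<xi> * iexp (\<xi> \<bullet> x))"
    using assms unfolding fourier_of_def by (metis norm_of_real)
  also have "\<dots> \<le> (LINT \<xi>|lborel. norm (b \<xi> * iexp (\<xi> \<bullet> x)))"
    by (rule integral_norm_bound)
  finally show ?thesis by (simp add: norm_mult)
qed

lemma fourier_of_continuous:
  fixes b :: "'b::euclidean_space \<Rightarrow> complex"
  assumes "fourier_of b g"
  shows "continuous_on UNIV g"
proof -
  have b: "integrable lborel b" using assms by (simp add: fourier_of_def)
  have [measurable]: "b \<in> borel_measurable borel" using b by auto
  have "continuous_on UNIV (\<lambda>x. complex_of_real (g x))"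
  proof (subst continuous_on_sequentially, safe)
    fix f :: "nat \<Rightarrow> 'b" and a :: 'b assume lim: "f \<longlonglongrightarrow> a"
    have "(\<lambda>n. LINT \<xi>|lborel. b \<xi> * iexp (\<xi> \<bullet> f n)) \<longlonglongrightarrow> (LINT \<xi>|lborel. b \<xi> * iexp (\<xi> \<bullet> a))"
    proof (rule integral_dominated_convergence)
      show "integrable lborel (\<lambda>\<xi>. norm (b \<xi>))" using b by auto
      show "AE \<xi> in lborel. (\<lambda>n. b \<xi> * iexp (\<xi> \<bullet> f n)) \<longlonglongrightarrow> b \<xi> * iexp (\<xi> \<bullet> a)"
        using lim by (intro always_eventually allI tendsto_intros)
    qed (auto simp: norm_mult)
    then show "((\<lambda>x. complex_of_real (g x)) \<circ> f) \<longlonglongrightarrow> complex_of_real (g a)"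
      using assms by (simp add: fourier_of_def comp_def)
  qed
  then have "continuous_on UNIV (\<lambda>x. Re (complex_of_real (g x)))"
    by (rule continuous_on_Re)
  then show ?thesis by simp
qed

lemma fourier_of_measurable:
  assumes "fourier_of b g"
  shows "g \<in> borel_measurable borel"
  by (rule borel_measurable_continuous_onI[OF fourier_of_continuous[OF assms]])

lemma norm_integral_le_nn_integral:
  fixes f :: "'a \<Rightarrow> 'b::{banach, second_countable_topology}"
  shows "ennreal (norm (integral\<^sup>L M f)) \<le> (\<integral>\<^sup>+x. ennreal (norm (f x)) \<partial>M)"
  by (cases "integrable M f") (auto intro: integral_norm_bound_ennreal simp: not_integrable_integral_eq)

lemma (in pair_sigma_finite) norm_iterated_integral_le:
  fixes f :: "'a \<Rightarrow> 'b \<Rightarrow> complex"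
  assumes "integrable (M1 \<Otimes>\<^sub>M M2) (\<lambda>(x, y). f x y)"
  shows "ennreal (norm (LINT y|M2. LINT x|M1. f x y)) \<le> (\<integral>\<^sup>+x. ennreal (norm (LINT y|M2. f x y)) \<partial>M1)"
  using Fubini_integral[OF assms] norm_integral_le_nn_integral[of M1 "\<lambda>x. LINT y|M2. f x y"] by simp

locale path_process = prob_space M for M :: "'a measure" +
  fixes X :: "real \<Rightarrow> 'a \<Rightarrow> 'b::euclidean_space"
  assumes X_measurable [measurable]: "\<And>s. X s \<in> borel_measurable M"
    and X_continuous: "\<And>w. w \<in> space M \<Longrightarrow> continuous_on UNIV (\<lambda>s. X s w)"
begin

lemma integrable_pair_bounded:
  fixes F :: "'c::euclidean_space \<Rightarrow> 'a \<Rightarrow> complex"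
  assumes [measurable]: "(\<lambda>(x, w). F x w) \<in> borel_measurable (lborel \<Otimes>\<^sub>M M)"
    and h: "integrable lborel h" and le: "\<And>x w. norm (F x w) \<le> h x"
  shows "integrable (lborel \<Otimes>\<^sub>M M) (\<lambda>(x, w). F x w)"
proof (rule integrableI_bounded)
  have [measurable]: "h \<in> borel_measurable borel" using h by auto
  have h0: "h x \<ge> 0" for x using order_trans[OF norm_ge_zero le] .
  have "(\<integral>\<^sup>+p. ennreal (norm (case p of (x, w) \<Rightarrow> F x w)) \<partial>(lborel \<Otimes>\<^sub>M M)) \<le> (\<integral>\<^sup>+p. ennreal (h (fst p)) \<partial>(lborel \<Otimes>\<^sub>M M))"
    by (intro nn_integral_mono) (auto simp: case_prod_unfold intro!: ennreal_leI le)
  also have "\<dots> = (\<integral>\<^sup>+x. \<integral>\<^sup>+w. ennreal (h x) \<partial>M \<partial>lborel)"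
    by (subst nn_integral_fst[symmetric]) auto
  also have "\<dots> = (\<integral>\<^sup>+x. ennreal (h x) \<partial>lborel)"
    by (simp add: emeasure_space_1)
  also have "\<dots> < \<infinity>"
    using h h0 by (simp add: integrable_iff_bounded)
  finally show "(\<integral>\<^sup>+p. ennreal (norm (case p of (x, w) \<Rightarrow> F x w)) \<partial>(lborel \<Otimes>\<^sub>M M)) < \<infinity>" .
qed fact

lemma X_jointly_measurable: "(\<lambda>(s, w). X s w) \<in> borel_measurable (borel \<Otimes>\<^sub>M M)"
proof (rule borel_measurable_LIMSEQ_metric)
  let ?d = "\<lambda>k s. real_of_int \<lfloor>real (Suc k) * s\<rfloor> / real (Suc k)"
  show "(\<lambda>(s, w). X (?d k s) w) \<in> borel_measurable (borel \<Otimes>\<^sub>M M)" for k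
    unfolding case_prod_unfold
    by (rule measurable_compose_countable[where f = "\<lambda>i p. X (real_of_int i / real (Suc k)) (snd p)"
          and g = "\<lambda>p. \<lfloor>real (Suc k) * fst p\<rfloor>"]) measurable
  fix p assume p: "p \<in> space (borel \<Otimes>\<^sub>M M :: (real \<times> 'a) measure)"
  obtain s w where sw: "p = (s, w)" "w \<in> space M" using p by (auto simp: space_pair_measure)
  have "(\<lambda>k. ?d k s) \<longlonglongrightarrow> s"
  proof (rule real_tendsto_sandwich)
    show "\<forall>\<^sub>F k in sequentially. s - inverse (real (Suc k)) \<le> ?d k s"
    proof (intro always_eventually allI)
      fix k
      have "real (Suc k) * s - 1 \<le> real_of_int \<lfloor>real (Suc k) * s\<rfloor>" by linarith
      then have "(real (Suc k) * s - 1) / real (Suc k) \<le> ?d k s" by (rule divide_right_mono) simp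
      then show "s - inverse (real (Suc k)) \<le> ?d k s" by (simp add: diff_divide_distrib inverse_eq_divide del: of_nat_Suc)
    qed
    show "\<forall>\<^sub>F k in sequentially. ?d k s \<le> s"
    proof (intro always_eventually allI)
      fix k
      have "real_of_int \<lfloor>real (Suc k) * s\<rfloor> \<le> real (Suc k) * s" by linarith
      then have "?d k s \<le> (real (Suc k) * s) / real (Suc k)" by (rule divide_right_mono) simp
      then show "?d k s \<le> s" by (simp del: of_nat_Suc)
    qed
    show "(\<lambda>k. s - inverse (real (Suc k))) \<longlonglongrightarrow> s"
      using tendsto_diff[OF tendsto_const LIMSEQ_inverse_real_of_nat] by simp
  qed simp
  moreover have "isCont (\<lambda>s. X s w) s"
    using X_continuous[OF sw(2)] by (simp add: continuous_on_eq_continuous_at)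
  ultimately have "(\<lambda>k. X (?d k s) w) \<longlonglongrightarrow> X s w"
    by (intro isCont_tendsto_compose[where g = "\<lambda>s. X s w"])
  then show "(\<lambda>k. (case p of (s, w) \<Rightarrow> X (?d k s) w)) \<longlonglongrightarrow> (case p of (s, w) \<Rightarrow> X s w)"
    by (simp add: sw)
qed

lemma X_measurable_apply [measurable (raw)]:
  assumes "f \<in> borel_measurable N" "g \<in> N \<rightarrow>\<^sub>M M"
  shows "(\<lambda>x. X (f x) (g x)) \<in> borel_measurable N"
  using measurable_compose[OF measurable_Pair[OF assms] X_jointly_measurable] by simp

lemma occupation_measurable_apply [measurable (raw)]:
  assumes [measurable]: "f \<in> borel_measurable N" "h \<in> N \<rightarrow>\<^sub>M M" "g \<in> borel_measurable borel"
  shows "(\<lambda>x. occupation X g (f x) (h x)) \<in> borel_measurable N"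
proof -
  have "(\<lambda>x. occupation X g (f x) (h x)) =
     (\<lambda>x. LINT r|lborel. (if 0 \<le> r \<and> r \<le> f x then g (X r (h x)) else 0))"
    unfolding occupation_def set_lebesgue_integral_def
    by (intro ext Bochner_Integration.integral_cong refl) (simp add: indicator_def)
  also have "\<dots> \<in> borel_measurable N"
    by measurable
  finally show ?thesis .
qed

lemma increments_measurable [measurable]: "increments X r L \<in> borel_measurable M"
proof (induction L arbitrary: r)
  case Nil
  then show ?case by (simp add: increments.simps[abs_def])
next
  case (Cons x L)
  obtain s u where x: "x = (s, u)" by force
  note [measurable] = Cons
  show ?case unfolding x increments.simps(2)[abs_def] by measurable
qed

lemma occupation_bounded:
  assumes "\<And>x. \<bar>g x\<bar> \<le> B" "0 \<le> s"
  shows "\<bar>occupation X g s w\<bar> \<le> B * s"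
proof -
  have "\<bar>occupation X g s w\<bar> \<le> (LINT r|lborel. norm (indicator {0..s} r *\<^sub>R g (X r w)))"
    unfolding occupation_def set_lebesgue_integral_def real_norm_def[symmetric] by (rule integral_norm_bound)
  also have "\<dots> \<le> (LINT r|lborel. B * indicator {0..s} r)"
  proof (rule Bochner_Integration.integral_mono')
    show "integrable lborel (\<lambda>r. B * indicator {0..s} r)"
      by (intro integrable_mult_right integrable_real_indicator) (auto simp: emeasure_lborel_Icc_eq)
    show "norm (indicator {0..s} r *\<^sub>R g (X r w)) \<le> B * indicator {0..s} r" for r
      using assms(1)[of "X r w"] by (simp add: indicator_def)
    show "0 \<le> B * indicator {0..s} r" for r
      using order_trans[OF abs_ge_zero assms(1)] by (simp add: indicator_def)
  qed
  also have "\<dots> = B * s" using assms(2) by simp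
  finally show ?thesis .
qed

end

text \<open>The assumption \<open>char_le\<close> is all that the moment bound uses of the law of \<open>X\<close>. The constant
  depends on the length of the chain, which grows with the order of the moment.\<close>

locale chain_process = path_process +
  fixes H :: real
  assumes H_pos: "H > 0"
    and char_le: "\<And>n. \<exists>c>0. \<forall>r>0. \<forall>u L. ascending r L \<and> length L = n \<longrightarrow>
      norm (LINT w|M. iexp (u \<bullet> X r w + increments X r L w)) \<le> exp (- c * ((norm u)\<^sup>2 * r powr (2 * H) + energy H r L))"
begin

definition joint_moment :: "('b \<Rightarrow> real) \<Rightarrow> nat \<Rightarrow> real \<Rightarrow> ('a \<Rightarrow> real) \<Rightarrow> ennreal" where
  "joint_moment g n s Z = ennreal (norm (LINT w|M. iexp (Z w) * complex_of_real (occupation X g s w ^ n)))"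

text \<open>One step of the recursion: the \<open>n + 1\<close>-st power of the occupation functional is the integral
  of its derivative, which brings out one time \<open>r\<close>, and the Fourier representation of \<open>g\<close> brings
  out one frequency \<open>\<xi>\<close>. Both are appended at the lower end of the chain.\<close>

lemma occupation_power_step:
  assumes g: "fourier_of b g" and [measurable]: "Z \<in> borel_measurable M" and "0 \<le> s"
  shows "joint_moment g (Suc n) s Z \<le> (\<integral>\<^sup>+r. indicator {0<..<s} r * (ennreal (real (Suc n)) * (\<integral>\<^sup>+\<xi>. ennreal (norm (b \<xi>)) *
         joint_moment g n r (\<lambda>w. Z w + \<xi> \<bullet> X r w) \<partial>lborel)) \<partial>lborel)"
proof -
  have b: "integrable lborel b" using g by (simp add: fourier_of_def)
  have [measurable]: "b \<in> borel_measurable borel" using b by auto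
  have [measurable]: "g \<in> borel_measurable borel" by (rule fourier_of_measurable[OF g])
  define B where "B = (LINT \<xi>|lborel. norm (b \<xi>))"
  have gB: "\<bar>g x\<bar> \<le> B" for x unfolding B_def by (rule fourier_of_bounded[OF g])
  have B0: "B \<ge> 0" using gB[of 0] by linarith
  have AB: "\<bar>occupation X g r w ^ n\<bar> \<le> (B * s) ^ n" if "r \<in> {0..s}" for r w
  proof -
    have "\<bar>occupation X g r w\<bar> \<le> B * s"
    proof -
      have "\<bar>occupation X g r w\<bar> \<le> B * r" by (rule occupation_bounded[OF gB]) (use that in auto)
      also have "\<dots> \<le> B * s" using that B0 by (intro mult_left_mono) auto
      finally show ?thesis .
    qed
    then show ?thesis unfolding power_abs by (intro power_mono) auto
  qed
  have bound: "norm (b \<xi> * (iexp y * complex_of_real (occupation X g r w ^ n))) \<le> (B * s) ^ n * norm (b \<xi>)"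
    if "r \<in> {0..s}" for r w \<xi> y
    using mult_left_mono[OF AB[OF that, of w] norm_ge_zero[of "b \<xi>"]]
    by (simp add: norm_mult norm_power mult.commute power_abs)
  interpret lM: pair_sigma_finite "lborel :: 'b measure" M ..
  interpret lR: pair_sigma_finite "lborel :: real measure" M ..
  have inner: "ennreal (norm (LINT w|M. iexp (Z w) * complex_of_real (g (X r w) * occupation X g r w ^ n)))
    \<le> (\<integral>\<^sup>+\<xi>. ennreal (norm (b \<xi>)) * joint_moment g n r (\<lambda>w. Z w + \<xi> \<bullet> X r w) \<partial>lborel)"
    if r: "r \<in> {0..s}" for r
  proof -
    have "(LINT w|M. iexp (Z w) * complex_of_real (g (X r w) * occupation X g r w ^ n))
       = (LINT w|M. LINT \<xi>|lborel. b \<xi> * (iexp (Z w + \<xi> \<bullet> X r w) * complex_of_real (occupation X g r w ^ n)))"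
    proof (intro Bochner_Integration.integral_cong refl)
      fix w
      have "iexp (Z w) * complex_of_real (g (X r w) * occupation X g r w ^ n)
        = (LINT \<xi>|lborel. b \<xi> * iexp (\<xi> \<bullet> X r w)) * (iexp (Z w) * complex_of_real (occupation X g r w ^ n))"
        using g by (simp add: fourier_of_def mult_ac)
      also have "\<dots> = (LINT \<xi>|lborel. b \<xi> * (iexp (Z w + \<xi> \<bullet> X r w) * complex_of_real (occupation X g r w ^ n)))"
        by (subst integral_mult_left_zero[symmetric])
          (intro Bochner_Integration.integral_cong refl, simp add: exp_add distrib_left mult_ac)
      finally show "iexp (Z w) * complex_of_real (g (X r w) * occupation X g r w ^ n)
       = (LINT \<xi>|lborel. b \<xi> * (iexp (Z w + \<xi> \<bullet> X r w) * complex_of_real (occupation X g r w ^ n)))" .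
    qed
    also have "ennreal (norm \<dots>) \<le> (\<integral>\<^sup>+\<xi>. ennreal (norm (LINT w|M. b \<xi> * (iexp (Z w + \<xi> \<bullet> X r w) * complex_of_real (occupation X g r w ^ n)))) \<partial>lborel)"
    proof (rule lM.norm_iterated_integral_le)
      show "integrable (lborel \<Otimes>\<^sub>M M) (\<lambda>(\<xi>, w). b \<xi> * (iexp (Z w + \<xi> \<bullet> X r w) * complex_of_real (occupation X g r w ^ n)))"
      proof (rule integrable_pair_bounded)
        show "integrable lborel (\<lambda>\<xi>. (B * s) ^ n * norm (b \<xi>))" using b by simp
        show "norm (b \<xi> * (iexp (Z w + \<xi> \<bullet> X r w) * complex_of_real (occupation X g r w ^ n))) \<le> (B * s) ^ n * norm (b \<xi>)" for \<xi> w
          by (rule bound[OF r])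
      qed measurable
    qed
    finally show ?thesis by (simp add: joint_moment_def norm_mult ennreal_mult)
  qed
  have "(LINT w|M. iexp (Z w) * complex_of_real (occupation X g s w ^ Suc n))
    = (LINT w|M. LINT r|lborel. indicator {0..s} r * (iexp (Z w) * complex_of_real (real (Suc n) * (g (X r w) * occupation X g r w ^ n))))"
  proof (intro Bochner_Integration.integral_cong refl)
    fix w assume w: "w \<in> space M"
    have "continuous_on {0..s} (\<lambda>r. g (X r w))"
      by (rule continuous_on_compose2[OF fourier_of_continuous[OF g]])
        (auto intro: continuous_on_subset[OF X_continuous[OF w]])
    from power_of_primitive[OF this \<open>0 \<le> s\<close>, of n]
    have "occupation X g s w ^ Suc n = (LINT r|lborel. indicator {0..s} r * (real (Suc n) * (g (X r w) * occupation X g r w ^ n)))"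
      by (simp only: occupation_def set_lebesgue_integral_def mult.assoc real_scaleR_def)
    then have "iexp (Z w) * complex_of_real (occupation X g s w ^ Suc n)
       = iexp (Z w) * (LINT r|lborel. complex_of_real (indicator {0..s} r * (real (Suc n) * (g (X r w) * occupation X g r w ^ n))))"
      by (simp only: integral_complex_of_real)
    also have "\<dots> = (LINT r|lborel. indicator {0..s} r * (iexp (Z w) * complex_of_real (real (Suc n) * (g (X r w) * occupation X g r w ^ n))))"
      by (subst integral_mult_right_zero[symmetric])
        (intro Bochner_Integration.integral_cong refl, simp add: indicator_def)
    finally show "iexp (Z w) * complex_of_real (occupation X g s w ^ Suc n)
       = (LINT r|lborel. indicator {0..s} r * (iexp (Z w) * complex_of_real (real (Suc n) * (g (X r w) * occupation X g r w ^ n))))" .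
  qed
  also have "ennreal (norm \<dots>) \<le> (\<integral>\<^sup>+r. ennreal (norm (LINT w|M. indicator {0..s} r * (iexp (Z w) * complex_of_real (real (Suc n) * (g (X r w) * occupation X g r w ^ n))))) \<partial>lborel)"
  proof (rule lR.norm_iterated_integral_le)
    show "integrable (lborel \<Otimes>\<^sub>M M) (\<lambda>(r, w). indicator {0..s} r * (iexp (Z w) * complex_of_real (real (Suc n) * (g (X r w) * occupation X g r w ^ n))))"
    proof (rule integrable_pair_bounded)
      show "integrable lborel (\<lambda>r. real (Suc n) * (B * (B * s) ^ n) * indicator {0..s} r)"
        by (intro integrable_mult_right integrable_real_indicator) (auto simp: emeasure_lborel_Icc_eq)
      fix r w
      show "norm (indicator {0..s} r * (iexp (Z w) * complex_of_real (real (Suc n) * (g (X r w) * occupation X g r w ^ n))))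
        \<le> real (Suc n) * (B * (B * s) ^ n) * indicator {0..s} r"
      proof (cases "r \<in> {0..s}")
        case True
        have "\<bar>g (X r w)\<bar> * \<bar>occupation X g r w ^ n\<bar> \<le> B * (B * s) ^ n"
          by (intro mult_mono gB AB[OF True] B0) auto
        then show ?thesis using True
          by (simp only: norm_mult norm_exp_i_times norm_of_real abs_mult abs_of_nat indicator_simps norm_one mult_1 mult_1_right)
            (simp add: mult_left_mono)
      qed simp
    qed measurable
  qed
  also have "\<dots> \<le> (\<integral>\<^sup>+r. indicator {0<..<s} r * (ennreal (real (Suc n)) * (\<integral>\<^sup>+\<xi>. ennreal (norm (b \<xi>)) *
         joint_moment g n r (\<lambda>w. Z w + \<xi> \<bullet> X r w) \<partial>lborel)) \<partial>lborel)"
  proof (rule nn_integral_mono_AE)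
    have "AE r in lborel. r \<noteq> 0 \<and> r \<noteq> s"
      by (intro AE_conjI AE_lborel_singleton)
    then show "AE r in lborel. ennreal (norm (LINT w|M. indicator {0..s} r * (iexp (Z w) * complex_of_real (real (Suc n) * (g (X r w) * occupation X g r w ^ n)))))
      \<le> indicator {0<..<s} r * (ennreal (real (Suc n)) * (\<integral>\<^sup>+\<xi>. ennreal (norm (b \<xi>)) *
         joint_moment g n r (\<lambda>w. Z w + \<xi> \<bullet> X r w) \<partial>lborel))"
    proof (rule eventually_mono)
      fix r assume r: "r \<noteq> 0 \<and> r \<noteq> s"
      show "ennreal (norm (LINT w|M. indicator {0..s} r * (iexp (Z w) * complex_of_real (real (Suc n) * (g (X r w) * occupation X g r w ^ n)))))
      \<le> indicator {0<..<s} r * (ennreal (real (Suc n)) * (\<integral>\<^sup>+\<xi>. ennreal (norm (b \<xi>)) *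
         joint_moment g n r (\<lambda>w. Z w + \<xi> \<bullet> X r w) \<partial>lborel))"
      proof (cases "r \<in> {0..s}")
        case True
        have "(LINT w|M. indicator {0..s} r * (iexp (Z w) * complex_of_real (real (Suc n) * (g (X r w) * occupation X g r w ^ n))))
           = complex_of_real (real (Suc n)) * (LINT w|M. iexp (Z w) * complex_of_real (g (X r w) * occupation X g r w ^ n))"
          using True by (subst integral_mult_right_zero[symmetric])
            (intro Bochner_Integration.integral_cong refl, simp)
        then have "ennreal (norm (LINT w|M. indicator {0..s} r * (iexp (Z w) * complex_of_real (real (Suc n) * (g (X r w) * occupation X g r w ^ n)))))
          = ennreal (real (Suc n)) * ennreal (norm (LINT w|M. iexp (Z w) * complex_of_real (g (X r w) * occupation X g r w ^ n)))"
          by (simp only: norm_mult norm_of_real ennreal_mult abs_of_nat of_nat_0_le_iff norm_ge_zero)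
        also have "\<dots> \<le> ennreal (real (Suc n)) * (\<integral>\<^sup>+\<xi>. ennreal (norm (b \<xi>)) *
         joint_moment g n r (\<lambda>w. Z w + \<xi> \<bullet> X r w) \<partial>lborel)"
          by (intro mult_left_mono inner True) auto
        finally show ?thesis using True r by (simp add: indicator_def)
      qed simp
    qed
  qed
  finally show ?thesis unfolding joint_moment_def[of g "Suc n"] .
qed

text \<open>The chain \<open>L\<close> lies above the time \<open>s\<close> and its coefficients are partial sums of frequencies
  already, so a new pair \<open>(r, \<xi>)\<close> with \<open>r < s\<close> only closes the increment from \<open>r\<close> to \<open>s\<close> and changes the
  coefficient at the lower end to \<open>u + \<xi>\<close>. When no power is left, the bound is that on the
  characteristic function of the whole chain.\<close>

lemma char_occupation_power_le:
  fixes c :: real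
  assumes g: "fourier_of b g" and [measurable]: "G \<in> borel_measurable borel" and G: "\<And>\<xi>. norm (b \<xi>) \<le> G \<xi>"
    and c: "\<And>r u L. \<lbrakk>r > 0; ascending r L; length L = N\<rbrakk> \<Longrightarrow>
      norm (LINT w|M. iexp (u \<bullet> X r w + increments X r L w)) \<le> exp (- c * ((norm u)\<^sup>2 * r powr (2 * H) + energy H r L))"
  shows "s > 0 \<Longrightarrow> ascending s L \<Longrightarrow> length L + n = N \<Longrightarrow>
    joint_moment g n s (\<lambda>w. u \<bullet> X s w + increments X s L w)
    \<le> ennreal (fact n) * (ennreal (exp (- c * energy H s L)) * chain_kernel c H G n s u)"
proof (induction n arbitrary: s u L)
  case 0
  then have "norm (LINT w|M. iexp (u \<bullet> X s w + increments X s L w)) \<le> exp (- c * ((norm u)\<^sup>2 * s powr (2 * H) + energy H s L))"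
    by (intro c) auto
  also have "\<dots> = exp (- c * energy H s L) * exp (- c * (norm u)\<^sup>2 * s powr (2 * H))"
    by (simp add: mult_exp_exp algebra_simps)
  finally show ?case
    by (simp add: joint_moment_def ennreal_mult[symmetric])
next
  case (Suc n)
  define E where "E r \<xi> = joint_moment g n r (\<lambda>w. (u \<bullet> X s w + increments X s L w) + \<xi> \<bullet> X r w)" for r \<xi>
  have step: "E r \<xi> \<le> ennreal (fact n) * (ennreal (exp (- c * energy H s L)) *
      (ennreal (exp (- c * (norm u)\<^sup>2 * (s - r) powr (2 * H))) * chain_kernel c H G n r (u + \<xi>)))"
    if r: "0 < r" "r < s" for r \<xi>
  proof -
    have "E r \<xi> = joint_moment g n r (\<lambda>w. (u + \<xi>) \<bullet> X r w + increments X r ((s, u) # L) w)"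
      unfolding E_def by (simp add: inner_diff_right inner_add_left algebra_simps)
    also have "\<dots> \<le> ennreal (fact n) * (ennreal (exp (- c * energy H r ((s, u) # L))) * chain_kernel c H G n r (u + \<xi>))"
      using Suc.prems r by (intro Suc.IH) auto
    also have "exp (- c * energy H r ((s, u) # L)) = exp (- c * energy H s L) * exp (- c * (norm u)\<^sup>2 * (s - r) powr (2 * H))"
      by (simp add: mult_exp_exp algebra_simps)
    finally show ?thesis by (simp add: ennreal_mult mult.assoc)
  qed
  have "joint_moment g (Suc n) s (\<lambda>w. u \<bullet> X s w + increments X s L w)
    \<le> (\<integral>\<^sup>+r. indicator {0<..<s} r * (ennreal (real (Suc n)) * (\<integral>\<^sup>+\<xi>. ennreal (norm (b \<xi>)) * E r \<xi> \<partial>lborel)) \<partial>lborel)"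
    unfolding E_def by (rule occupation_power_step[OF g]) (use Suc.prems in auto)
  also have "\<dots> \<le> (\<integral>\<^sup>+r. (ennreal (fact (Suc n)) * ennreal (exp (- c * energy H s L))) * (indicator {0<..<s} r *
     (\<integral>\<^sup>+\<xi>. ennreal (G \<xi> * exp (- c * (norm u)\<^sup>2 * (s - r) powr (2 * H))) * chain_kernel c H G n r (u + \<xi>) \<partial>lborel)) \<partial>lborel)"
  proof (rule nn_integral_mono)
    fix r :: real
    define A where "A = ennreal (fact n) * ennreal (exp (- c * energy H s L))"
    define e where "e = exp (- c * (norm u)\<^sup>2 * (s - r) powr (2 * H))"
    have A: "ennreal (real (Suc n)) * A = ennreal (fact (Suc n)) * ennreal (exp (- c * energy H s L))"
      by (simp add: A_def ennreal_mult[symmetric] mult.assoc[symmetric] del: of_nat_Suc)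
    show "indicator {0<..<s} r * (ennreal (real (Suc n)) * (\<integral>\<^sup>+\<xi>. ennreal (norm (b \<xi>)) * E r \<xi> \<partial>lborel))
      \<le> (ennreal (fact (Suc n)) * ennreal (exp (- c * energy H s L))) * (indicator {0<..<s} r *
     (\<integral>\<^sup>+\<xi>. ennreal (G \<xi> * exp (- c * (norm u)\<^sup>2 * (s - r) powr (2 * H))) * chain_kernel c H G n r (u + \<xi>) \<partial>lborel))"
    proof (cases "r \<in> {0<..<s}")
      case True
      have "(\<integral>\<^sup>+\<xi>. ennreal (norm (b \<xi>)) * E r \<xi> \<partial>lborel)
         \<le> (\<integral>\<^sup>+\<xi>. A * (ennreal (G \<xi> * e) * chain_kernel c H G n r (u + \<xi>)) \<partial>lborel)"
      proof (rule nn_integral_mono)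
        fix \<xi>
        have "ennreal (norm (b \<xi>)) * E r \<xi> \<le> ennreal (G \<xi>) * (A * (ennreal e * chain_kernel c H G n r (u + \<xi>)))"
          using step[of r \<xi>] True G[of \<xi>] by (intro mult_mono ennreal_leI) (auto simp: A_def e_def mult.assoc)
        also have "\<dots> = A * (ennreal (G \<xi> * e) * chain_kernel c H G n r (u + \<xi>))"
          using order_trans[OF norm_ge_zero G[of \<xi>]] by (simp add: ennreal_mult e_def mult_ac)
        finally show "ennreal (norm (b \<xi>)) * E r \<xi> \<le> A * (ennreal (G \<xi> * e) * chain_kernel c H G n r (u + \<xi>))" .
      qed
      also have "\<dots> = A * (\<integral>\<^sup>+\<xi>. ennreal (G \<xi> * e) * chain_kernel c H G n r (u + \<xi>) \<partial>lborel)"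
        by (rule nn_integral_cmult) measurable
      finally have "ennreal (real (Suc n)) * (\<integral>\<^sup>+\<xi>. ennreal (norm (b \<xi>)) * E r \<xi> \<partial>lborel)
        \<le> ennreal (real (Suc n)) * (A * (\<integral>\<^sup>+\<xi>. ennreal (G \<xi> * e) * chain_kernel c H G n r (u + \<xi>) \<partial>lborel))"
        by (rule mult_left_mono) simp
      then show ?thesis using True by (simp only: mult.assoc[symmetric] A e_def indicator_simps mult_1 mult_1_right)
    qed simp
  qed
  also have "\<dots> = (ennreal (fact (Suc n)) * ennreal (exp (- c * energy H s L))) * chain_kernel c H G (Suc n) s u"
    unfolding chain_kernel.simps by (rule nn_integral_cmult) measurable
  also have "\<dots> = ennreal (fact (Suc n)) * (ennreal (exp (- c * energy H s L)) * chain_kernel c H G (Suc n) s u)"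
    by (rule mult.assoc)
  finally show ?case .
qed

text \<open>The moment bound is linear in the multiplier \<open>b\<close>: all but one of its occurrences have
  been replaced by the majorant \<open>G\<close>, and what remains is integration against a weight \<open>W\<close>. This
  is what makes dominated convergence in \<open>b\<close> immediate.\<close>

definition moment_weight :: "real \<Rightarrow> nat \<Rightarrow> ('b \<Rightarrow> real) \<Rightarrow> ('b \<Rightarrow> ennreal) \<Rightarrow> bool" where
  "moment_weight t n G W \<longleftrightarrow> W \<in> borel_measurable borel \<and> (\<integral>\<^sup>+\<xi>. ennreal (G \<xi>) * W \<xi> \<partial>lborel) < \<infinity> \<and>
    (\<forall>b g. fourier_of b g \<longrightarrow> (\<forall>\<xi>. norm (b \<xi>) \<le> G \<xi>) \<longrightarrow>
      (\<integral>\<^sup>+w. ennreal (occupation X g t w ^ n) \<partial>M) \<le> (\<integral>\<^sup>+\<xi>. ennreal (norm (b \<xi>)) * W \<xi> \<partial>lborel))"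

lemma moment_weightD:
  assumes "moment_weight t n G W" "fourier_of b g" "\<And>\<xi>. norm (b \<xi>) \<le> G \<xi>"
  shows "(\<integral>\<^sup>+w. ennreal (occupation X g t w ^ n) \<partial>M) \<le> (\<integral>\<^sup>+\<xi>. ennreal (norm (b \<xi>)) * W \<xi> \<partial>lborel)"
  using assms unfolding moment_weight_def by blast

lemma moment_weight_tendsto:
  assumes "moment_weight t n G W" and G: "\<And>\<xi>. G \<xi> > 0"
    and [measurable]: "\<And>k. a k \<in> borel_measurable borel" "G \<in> borel_measurable borel"
    and le: "\<And>k \<xi>. a k \<xi> \<le> G \<xi>" and lim: "\<And>\<xi>. (\<lambda>k. a k \<xi>) \<longlonglongrightarrow> 0"
  shows "(\<lambda>k. \<integral>\<^sup>+\<xi>. ennreal (a k \<xi>) * W \<xi> \<partial>lborel) \<longlonglongrightarrow> 0"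
proof -
  have [measurable]: "W \<in> borel_measurable borel" and W: "(\<integral>\<^sup>+\<xi>. ennreal (G \<xi>) * W \<xi> \<partial>lborel) < \<infinity>"
    using assms(1) by (auto simp: moment_weight_def)
  have "(\<lambda>k. \<integral>\<^sup>+\<xi>. ennreal (a k \<xi>) * W \<xi> \<partial>lborel) \<longlonglongrightarrow> (\<integral>\<^sup>+\<xi>. 0 \<partial>(lborel :: 'b measure))"
  proof (rule nn_integral_dominated_convergence[OF _ _ _ _ W])
    show "AE \<xi> in lborel. ennreal (a k \<xi>) * W \<xi> \<le> ennreal (G \<xi>) * W \<xi>" for k
      by (intro always_eventually allI mult_right_mono ennreal_leI le) simp
    have "AE \<xi> in lborel. ennreal (G \<xi>) * W \<xi> \<noteq> \<infinity>"
      using W by (intro nn_integral_PInf_AE) auto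
    then show "AE \<xi> in lborel. (\<lambda>k. ennreal (a k \<xi>) * W \<xi>) \<longlonglongrightarrow> 0"
    proof eventually_elim
      case (elim \<xi>)
      have "ennreal (G \<xi>) \<noteq> 0" using G[of \<xi>] by (simp add: ennreal_eq_0_iff)
      with elim have "W \<xi> \<noteq> \<infinity>"
        by (auto simp: ennreal_mult_eq_top_iff)
      moreover have "(\<lambda>k. ennreal (a k \<xi>)) \<longlonglongrightarrow> ennreal 0"
        by (intro tendsto_ennrealI lim)
      ultimately have "(\<lambda>k. ennreal (a k \<xi>) * W \<xi>) \<longlonglongrightarrow> ennreal 0 * W \<xi>"
        by (intro tendsto_mult_ennreal) auto
      then show ?case by simp
    qed
  qed measurable
  then show ?thesis by simp
qed

lemma moment_weight_exists:
  assumes "even n" "n \<noteq> 0" and "t > 0" and small: "H * (real DIM('b) + 2 * real \<beta>) < 1" and C: "C \<ge> 1"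
  shows "\<exists>W. moment_weight t n (\<lambda>\<xi>. C * (1 + norm \<xi>) ^ \<beta>) W"
proof -
  define N where "N = n - 1"
  have n: "n = Suc N" using assms(2) by (simp add: N_def)
  define G where "G = (\<lambda>x::'b. C * (1 + norm x) ^ \<beta>)"
  have [measurable]: "G \<in> borel_measurable borel" unfolding G_def by measurable
  have G1: "G x \<ge> 1" for x
    using mult_mono[OF C one_le_power[of "1 + norm x" \<beta>]] C by (simp add: G_def)
  have Gsub: "G x \<le> G u * G (u + x)" for u x
  proof -
    have "norm x \<le> norm u + norm (u + x)"
      using norm_triangle_ineq4[of "u + x" u] by simp
    then have "1 + norm x \<le> (1 + norm u) * (1 + norm (u + x))"
      using mult_nonneg_nonneg[OF norm_ge_zero[of u] norm_ge_zero[of "u + x"]]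
      unfolding distrib_left distrib_right mult_1 mult_1_right by linarith
    then have "(1 + norm x) ^ \<beta> \<le> (1 + norm u) ^ \<beta> * (1 + norm (u + x)) ^ \<beta>"
      unfolding power_mult_distrib[symmetric] by (intro power_mono) auto
    then have "C * (1 + norm x) ^ \<beta> \<le> (C * C) * ((1 + norm u) ^ \<beta> * (1 + norm (u + x)) ^ \<beta>)"
      using mult_mono[OF C C] C by (intro mult_mono) auto
    then show ?thesis unfolding G_def by (simp only: mult_ac)
  qed
  obtain c where c: "c > 0" and char: "\<And>r u L. \<lbrakk>r > 0; ascending r L; length L = N\<rbrakk> \<Longrightarrow>
      norm (LINT w|M. iexp (u \<bullet> X r w + increments X r L w)) \<le> exp (- c * ((norm u)\<^sup>2 * r powr (2 * H) + energy H r L))"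
    using char_le[of N] by blast
  define W where "W \<xi> = ennreal (fact n) * (\<integral>\<^sup>+s. indicator {0<..<t} s * chain_kernel c H G N s \<xi> \<partial>lborel)" for \<xi>
  have [measurable]: "W \<in> borel_measurable borel" unfolding W_def[abs_def] by measurable
  have fin: "(\<integral>\<^sup>+\<xi>. ennreal (G \<xi>) * W \<xi> \<partial>lborel) < \<infinity>"
  proof -
    have "(\<integral>\<^sup>+\<xi>. ennreal (G \<xi>) * W \<xi> \<partial>lborel)
      = (\<integral>\<^sup>+\<xi>. (\<integral>\<^sup>+s. ennreal (fact n) * (indicator {0<..<t} s * (ennreal (G \<xi>) * chain_kernel c H G N s \<xi>)) \<partial>lborel) \<partial>lborel)"
      unfolding W_def by (intro nn_integral_cong) (simp add: nn_integral_cmult[symmetric] mult_ac)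
    also have "\<dots> = (\<integral>\<^sup>+s. (\<integral>\<^sup>+\<xi>. ennreal (fact n) * (indicator {0<..<t} s * (ennreal (G \<xi>) * chain_kernel c H G N s \<xi>)) \<partial>lborel) \<partial>lborel)"
      by (rule lborel_pair.Fubini') measurable
    also have "\<dots> = ennreal (fact n) * (\<integral>\<^sup>+s. indicator {0<..<t} s * (\<integral>\<^sup>+\<xi>. ennreal (G \<xi>) * chain_kernel c H G N s \<xi> \<partial>lborel) \<partial>lborel)"
      by (simp add: nn_integral_cmult)
    also have "\<dots> < \<infinity>"
    proof -
      have "(\<integral>\<^sup>+s. indicator {0<..<t} s * scale_kernel c H G s \<partial>lborel) < \<infinity>"
        unfolding G_def by (rule scale_kernel_integral_less_top[OF c H_pos assms(3) small])
      then have "(\<integral>\<^sup>+s. indicator {0<..<t} s * scale_kernel c H G s \<partial>lborel) ^ Suc N < \<infinity>"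
        by (simp add: power_less_top_ennreal del: power_Suc)
      from le_less_trans[OF chain_kernel_integral_le[OF _ G1 Gsub] this]
      show ?thesis by (simp add: ennreal_mult_less_top)
    qed
    finally show ?thesis .
  qed
  have "(\<integral>\<^sup>+w. ennreal (occupation X g t w ^ n) \<partial>M) \<le> (\<integral>\<^sup>+\<xi>. ennreal (norm (b \<xi>)) * W \<xi> \<partial>lborel)"
    if g: "fourier_of b g" and bG: "\<And>\<xi>. norm (b \<xi>) \<le> G \<xi>" for b g
  proof -
    have [measurable]: "g \<in> borel_measurable borel" "b \<in> borel_measurable borel"
      using fourier_of_measurable[OF g] g by (auto simp: fourier_of_def)
    have pos: "occupation X g t w ^ n \<ge> 0" for w using assms(1) by (simp add: zero_le_even_power)
    have int: "integrable M (\<lambda>w. occupation X g t w ^ n)"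
    proof (rule integrable_const_bound)
      show "AE w in M. norm (occupation X g t w ^ n) \<le> ((LINT \<xi>|lborel. norm (b \<xi>)) * t) ^ n"
      proof (intro always_eventually allI)
        fix w
        have "\<bar>occupation X g t w\<bar> \<le> (LINT \<xi>|lborel. norm (b \<xi>)) * t"
          by (rule occupation_bounded[OF fourier_of_bounded[OF g]]) (use assms(3) in simp)
        then show "norm (occupation X g t w ^ n) \<le> ((LINT \<xi>|lborel. norm (b \<xi>)) * t) ^ n"
          unfolding real_norm_def power_abs by (rule power_mono) simp
      qed
    qed measurable
    have "(\<integral>\<^sup>+w. ennreal (occupation X g t w ^ n) \<partial>M) = ennreal (LINT w|M. occupation X g t w ^ n)"
      using int pos by (intro nn_integral_eq_integral) auto
    also have "(LINT w|M. occupation X g t w ^ n) = norm (LINT w|M. iexp 0 * complex_of_real (occupation X g t w ^ Suc N))"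
    proof -
      have "0 \<le> (LINT w|M. occupation X g t w ^ n)" by (intro integral_nonneg_AE) (use pos in simp)
      then show ?thesis by (simp only: n[symmetric] of_real_0 mult_zero_right exp_zero mult_1 integral_complex_of_real norm_of_real abs_of_nonneg)
    qed
    also have "ennreal \<dots> = joint_moment g (Suc N) t (\<lambda>_. 0)" by (simp add: joint_moment_def)
    also have "\<dots> \<le> (\<integral>\<^sup>+r. indicator {0<..<t} r * (ennreal (real (Suc N)) * (\<integral>\<^sup>+\<xi>. ennreal (norm (b \<xi>)) *
         joint_moment g N r (\<lambda>w. 0 + \<xi> \<bullet> X r w) \<partial>lborel)) \<partial>lborel)"
      by (rule occupation_power_step[OF g, of "\<lambda>_. 0"]) (use assms(3) in auto)
    also have "\<dots> \<le> (\<integral>\<^sup>+r. indicator {0<..<t} r * (ennreal (real (Suc N)) * (\<integral>\<^sup>+\<xi>. ennreal (norm (b \<xi>)) *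
         (ennreal (fact N) * chain_kernel c H G N r \<xi>) \<partial>lborel)) \<partial>lborel)"
    proof (rule nn_integral_mono)
      fix r :: real
      have bound: "joint_moment g N r (\<lambda>w. 0 + \<xi> \<bullet> X r w)
        \<le> ennreal (fact N) * chain_kernel c H G N r \<xi>" if "r > 0" for \<xi>
      proof -
        have "joint_moment g N r (\<lambda>w. \<xi> \<bullet> X r w + increments X r [] w)
          \<le> ennreal (fact N) * (ennreal (exp (- c * energy H r ([] :: (real \<times> 'b) list))) * chain_kernel c H G N r \<xi>)"
        proof (rule char_occupation_power_le[where b = b and g = g and G = G and c = c and N = N])
          show "norm (LINT w|M. iexp (u \<bullet> X r w + increments X r L w)) \<le> exp (- c * ((norm u)\<^sup>2 * r powr (2 * H) + energy H r L))"
            if "r > 0" "ascending r L" "length L = N" for r u L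
            by (rule char[OF that])
        qed (fact g, measurable, fact bG, fact that, simp_all)
        then show ?thesis
          by (simp only: increments.simps energy.simps add_0_left add_0_right mult_zero_right exp_zero ennreal_1 mult_1)
      qed
      show "indicator {0<..<t} r * (ennreal (real (Suc N)) * (\<integral>\<^sup>+\<xi>. ennreal (norm (b \<xi>)) *
         joint_moment g N r (\<lambda>w. 0 + \<xi> \<bullet> X r w) \<partial>lborel))
        \<le> indicator {0<..<t} r * (ennreal (real (Suc N)) * (\<integral>\<^sup>+\<xi>. ennreal (norm (b \<xi>)) *
         (ennreal (fact N) * chain_kernel c H G N r \<xi>) \<partial>lborel))"
      proof (cases "r > 0")
        case True
        show ?thesis by (intro mult_left_mono nn_integral_mono bound True) auto
      qed simp
    qed
    also have "\<dots> = (\<integral>\<^sup>+r. (\<integral>\<^sup>+\<xi>. ennreal (fact n) * (indicator {0<..<t} r * (ennreal (norm (b \<xi>)) * chain_kernel c H G N r \<xi>)) \<partial>lborel) \<partial>lborel)"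
    proof (rule nn_integral_cong)
      fix r :: real
      define J where "J = (\<integral>\<^sup>+\<xi>. ennreal (norm (b \<xi>)) * chain_kernel c H G N r \<xi> \<partial>lborel)"
      have "(\<integral>\<^sup>+\<xi>. ennreal (norm (b \<xi>)) * (ennreal (fact N) * chain_kernel c H G N r \<xi>) \<partial>lborel)
         = (\<integral>\<^sup>+\<xi>. ennreal (fact N) * (ennreal (norm (b \<xi>)) * chain_kernel c H G N r \<xi>) \<partial>lborel)"
        by (intro nn_integral_cong) (simp only: mult_ac)
      also have "\<dots> = ennreal (fact N) * J" unfolding J_def by (rule nn_integral_cmult) measurable
      finally have 1: "(\<integral>\<^sup>+\<xi>. ennreal (norm (b \<xi>)) * (ennreal (fact N) * chain_kernel c H G N r \<xi>) \<partial>lborel)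
         = ennreal (fact N) * J" .
      have "(\<integral>\<^sup>+\<xi>. ennreal (fact n) * (indicator {0<..<t} r * (ennreal (norm (b \<xi>)) * chain_kernel c H G N r \<xi>)) \<partial>lborel)
        = ennreal (fact n) * (\<integral>\<^sup>+\<xi>. indicator {0<..<t} r * (ennreal (norm (b \<xi>)) * chain_kernel c H G N r \<xi>) \<partial>lborel)"
        by (rule nn_integral_cmult) measurable
      also have "\<dots> = ennreal (fact n) * (indicator {0<..<t} r * J)"
        unfolding J_def by (subst nn_integral_cmult) measurable
      finally have 2: "(\<integral>\<^sup>+\<xi>. ennreal (fact n) * (indicator {0<..<t} r * (ennreal (norm (b \<xi>)) * chain_kernel c H G N r \<xi>)) \<partial>lborel)
        = ennreal (fact n) * (indicator {0<..<t} r * J)" .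
      have "ennreal (fact n) = ennreal (real (Suc N)) * ennreal (fact N)"
        unfolding n fact_Suc by (rule ennreal_mult) auto
      then show "indicator {0<..<t} r * (ennreal (real (Suc N)) * (\<integral>\<^sup>+\<xi>. ennreal (norm (b \<xi>)) *
         (ennreal (fact N) * chain_kernel c H G N r \<xi>) \<partial>lborel))
         = (\<integral>\<^sup>+\<xi>. ennreal (fact n) * (indicator {0<..<t} r * (ennreal (norm (b \<xi>)) * chain_kernel c H G N r \<xi>)) \<partial>lborel)"
        unfolding 1 2 by (simp only: mult_ac)
    qed
    also have "\<dots> = (\<integral>\<^sup>+\<xi>. (\<integral>\<^sup>+r. ennreal (fact n) * (indicator {0<..<t} r * (ennreal (norm (b \<xi>)) * chain_kernel c H G N r \<xi>)) \<partial>lborel) \<partial>lborel)"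
      by (rule lborel_pair.Fubini') measurable
    also have "\<dots> = (\<integral>\<^sup>+\<xi>. ennreal (norm (b \<xi>)) * W \<xi> \<partial>lborel)"
    proof (rule nn_integral_cong)
      fix \<xi> :: 'b
      have "(\<integral>\<^sup>+r. ennreal (fact n) * (indicator {0<..<t} r * (ennreal (norm (b \<xi>)) * chain_kernel c H G N r \<xi>)) \<partial>lborel)
        = (\<integral>\<^sup>+r. (ennreal (norm (b \<xi>)) * ennreal (fact n)) * (indicator {0<..<t} r * chain_kernel c H G N r \<xi>) \<partial>lborel)"
        by (intro nn_integral_cong) (simp only: mult_ac)
      also have "\<dots> = (ennreal (norm (b \<xi>)) * ennreal (fact n)) * (\<integral>\<^sup>+r. indicator {0<..<t} r * chain_kernel c H G N r \<xi> \<partial>lborel)"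
        by (rule nn_integral_cmult) measurable
      finally show "(\<integral>\<^sup>+r. ennreal (fact n) * (indicator {0<..<t} r * (ennreal (norm (b \<xi>)) * chain_kernel c H G N r \<xi>)) \<partial>lborel)
        = ennreal (norm (b \<xi>)) * W \<xi>" unfolding W_def by (simp only: mult.assoc)
    qed
    finally show ?thesis .
  qed
  then have "moment_weight t n G W"
    using fin unfolding moment_weight_def by auto
  then show ?thesis unfolding G_def by blast
qed

end

section \<open>The heat kernel\<close>

text \<open>The factor \<open>(2 * pi) powr (- d)\<close> of the inverse Fourier transform is included.\<close>

definition heat_multiplier :: "real \<Rightarrow> real ^ 'd::finite \<Rightarrow> real" where
  "heat_multiplier \<epsilon> \<xi> = (2 * pi) powr (- real CARD('d)) * exp (- \<epsilon> * (norm \<xi>)\<^sup>2 / 2)"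

lemma heat_multiplier_measurable [measurable]: "heat_multiplier \<epsilon> \<in> borel_measurable borel"
  unfolding heat_multiplier_def[abs_def] by measurable

lemma heat_kernel_measurable [measurable]: "heat_kernel \<epsilon> \<in> borel_measurable borel"
  unfolding heat_kernel_def[abs_def] by measurable

lemma heat_multiplier_moment_integrable:
  assumes "\<epsilon> > 0"
  shows "integrable lborel (\<lambda>\<xi>::real ^ 'd::finite. (1 + norm \<xi>) ^ k * heat_multiplier \<epsilon> \<xi>)"
proof -
  have "integrable lborel (\<lambda>\<xi>::real ^ 'd. (2 * pi) powr (- real CARD('d)) * ((1 + norm \<xi>) ^ k * exp (- (\<epsilon> / 2) * (norm \<xi>)\<^sup>2)))"
    using assms by (intro integrable_mult_right gaussian_moment_integrable) auto
  then show ?thesis by (simp add: heat_multiplier_def mult_ac)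
qed

lemma heat_multiplier_nonneg: "heat_multiplier \<epsilon> \<xi> \<ge> 0"
  by (simp add: heat_multiplier_def)

lemma sqrt_power_eq_powr:
  fixes a :: real
  assumes "a > 0"
  shows "sqrt a ^ n = a powr (real n / 2)"
proof -
  have "sqrt a ^ n = sqrt a powr real n"
    using assms by (intro powr_realpow[symmetric]) simp
  also have "\<dots> = a powr (real n / 2)"
    using assms by (simp add: powr_half_sqrt[symmetric] powr_powr)
  finally show ?thesis .
qed

lemma heat_kernel_fourier:
  fixes x :: "real ^ 'd::finite"
  assumes "\<epsilon> > 0"
  shows "complex_of_real (heat_kernel \<epsilon> x) = (LINT \<xi>|lborel. complex_of_real (heat_multiplier \<epsilon> \<xi>) * iexp (\<xi> \<bullet> x))"
proof -
  define q where "q = sqrt \<epsilon>"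
  have q: "q > 0" "q\<^sup>2 = \<epsilon>" using assms by (auto simp: q_def)
  let ?f = "\<lambda>\<xi>::real ^ 'd. complex_of_real (exp (- (norm \<xi>)\<^sup>2 / 2)) * iexp (\<xi> \<bullet> ((1 / q) *\<^sub>R x))"
  have "sqrt (2 * pi) ^ CARD('d) * exp (- (norm ((1 / q) *\<^sub>R x))\<^sup>2 / 2) = (LINT \<xi>|lborel. ?f \<xi>)"
    using gaussian_fourier_unit(2)[of "(1 / q) *\<^sub>R x"] by simp
  also have "\<dots> = (\<bar>q\<bar> ^ DIM(real ^ 'd)) *\<^sub>R (LINT \<xi>|lborel. ?f (0 + q *\<^sub>R \<xi>))"
    using q by (intro lborel_scale_integral) auto
  also have "(\<lambda>\<xi>. ?f (0 + q *\<^sub>R \<xi>)) = (\<lambda>\<xi>. complex_of_real (exp (- \<epsilon> * (norm \<xi>)\<^sup>2 / 2)) * iexp (\<xi> \<bullet> x))"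
    using q by (auto simp: power_mult_distrib)
  finally have e: "complex_of_real (sqrt (2 * pi) ^ CARD('d) * exp (- (norm ((1 / q) *\<^sub>R x))\<^sup>2 / 2))
     = (q ^ CARD('d)) *\<^sub>R (LINT \<xi>|lborel. complex_of_real (exp (- \<epsilon> * (norm \<xi>)\<^sup>2 / 2)) * iexp (\<xi> \<bullet> x))"
    using q by simp
  have n: "(norm ((1 / q) *\<^sub>R x))\<^sup>2 / 2 = (norm x)\<^sup>2 / (2 * \<epsilon>)"
    using q by (simp add: power_mult_distrib power_divide)
  have "(2 * pi * \<epsilon>) powr (- real CARD('d) / 2) * q ^ CARD('d) = (2 * pi) powr (- real CARD('d)) * sqrt (2 * pi) ^ CARD('d)"
  proof -
    have "q ^ CARD('d) = \<epsilon> powr (real CARD('d) / 2)"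
      unfolding q_def by (rule sqrt_power_eq_powr[OF assms])
    moreover have "sqrt (2 * pi) ^ CARD('d) = (2 * pi) powr (real CARD('d) / 2)"
      by (rule sqrt_power_eq_powr) simp
    moreover have "(2 * pi * \<epsilon>) powr (- real CARD('d) / 2) = (2 * pi) powr (- real CARD('d) / 2) * \<epsilon> powr (- real CARD('d) / 2)"
      using assms by (simp add: powr_mult)
    moreover have "(2 * pi) powr (- real CARD('d)) * (2 * pi) powr (real CARD('d) / 2) = (2 * pi) powr (- real CARD('d) / 2)"
      by (simp add: powr_add[symmetric])
    moreover have "\<epsilon> powr (- real CARD('d) / 2) * \<epsilon> powr (real CARD('d) / 2) = 1"
      using assms by (simp add: powr_add[symmetric])
    ultimately show ?thesis by simp
  qed
  then have "heat_kernel \<epsilon> x * q ^ CARD('d) = (2 * pi) powr (- real CARD('d)) * (sqrt (2 * pi) ^ CARD('d) * exp (- (norm ((1 / q) *\<^sub>R x))\<^sup>2 / 2))"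
    unfolding heat_kernel_def using n by (simp add: mult_ac)
  then have "complex_of_real (heat_kernel \<epsilon> x) * complex_of_real (q ^ CARD('d)) = complex_of_real ((2 * pi) powr (- real CARD('d))) *
      complex_of_real (sqrt (2 * pi) ^ CARD('d) * exp (- (norm ((1 / q) *\<^sub>R x))\<^sup>2 / 2))"
    by (simp only: of_real_mult[symmetric])
  also have "\<dots> = complex_of_real (q ^ CARD('d)) * (LINT \<xi>|lborel. complex_of_real (heat_multiplier \<epsilon> \<xi>) * iexp (\<xi> \<bullet> x))"
  proof -
    have "(LINT \<xi>|lborel. complex_of_real (heat_multiplier \<epsilon> \<xi>) * iexp (\<xi> \<bullet> x))
      = (LINT \<xi>|lborel. complex_of_real ((2 * pi) powr (- real CARD('d))) *
          (complex_of_real (exp (- \<epsilon> * (norm \<xi>)\<^sup>2 / 2)) * iexp (\<xi> \<bullet> x)))"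
      unfolding heat_multiplier_def of_real_mult mult.assoc ..
    also have "\<dots> = complex_of_real ((2 * pi) powr (- real CARD('d))) *
       (LINT \<xi>|lborel. complex_of_real (exp (- \<epsilon> * (norm \<xi>)\<^sup>2 / 2)) * iexp (\<xi> \<bullet> x))"
      by (rule integral_mult_right_zero)
    finally show ?thesis
      unfolding e by (simp only: scaleR_conv_of_real[where 'a = complex] mult_ac)
  qed
  finally show ?thesis using q by simp
qed

lemma heat_kernel_nonneg: "heat_kernel \<epsilon> x \<ge> 0"
  by (simp add: heat_kernel_def)

lemma heat_kernel_scale:
  fixes z :: "real ^ 'd::finite"
  assumes "\<epsilon> > 0"
  shows "sqrt \<epsilon> ^ CARD('d) * heat_kernel \<epsilon> (sqrt \<epsilon> *\<^sub>R z) = heat_kernel 1 z"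
proof -
  have "sqrt \<epsilon> ^ CARD('d) = \<epsilon> powr (real CARD('d) / 2)"
    by (rule sqrt_power_eq_powr[OF assms])
  moreover have "(2 * pi * \<epsilon>) powr (- real CARD('d) / 2) = (2 * pi) powr (- real CARD('d) / 2) * \<epsilon> powr (- real CARD('d) / 2)"
    using assms by (simp add: powr_mult)
  moreover have "\<epsilon> powr (real CARD('d) / 2) * \<epsilon> powr (- (real CARD('d) / 2)) = 1"
    using assms by (simp add: powr_add[symmetric])
  ultimately show ?thesis
    using assms by (simp add: heat_kernel_def power_mult_distrib)
qed

lemma heat_kernel_integrable: "integrable lborel (heat_kernel 1 :: real ^ 'd::finite \<Rightarrow> real)"
proof -
  have "integrable lborel (\<lambda>\<xi>::real ^ 'd. (2 * pi) powr (- real CARD('d) / 2) * exp (- (1 / 2) * (norm \<xi>)\<^sup>2))"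
    by (intro integrable_mult_right gaussian_integrable) auto
  then show ?thesis by (simp add: heat_kernel_def[abs_def])
qed

lemma heat_kernel_mass: "(LINT z|lborel. heat_kernel 1 (z :: real ^ 'd::finite)) = 1"
proof -
  have "complex_of_real (LINT z|lborel. exp (- (norm (z :: real ^ 'd))\<^sup>2 / 2)) = complex_of_real (sqrt (2 * pi) ^ CARD('d))"
    using gaussian_fourier_unit(2)[of "0 :: real ^ 'd"] by simp
  then have "(LINT z|lborel. exp (- (norm (z :: real ^ 'd))\<^sup>2 / 2)) = sqrt (2 * pi) ^ CARD('d)"
    by (simp only: of_real_eq_iff)
  also have "\<dots> = (2 * pi) powr (real CARD('d) / 2)"
    by (rule sqrt_power_eq_powr) simp
  finally show ?thesis
    by (simp add: heat_kernel_def powr_add[symmetric])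
qed

lemma heat_kernel_nn_mass: "(\<integral>\<^sup>+z. ennreal (heat_kernel 1 (z :: real ^ 'd::finite)) \<partial>lborel) = 1"
  by (subst nn_integral_eq_integral[OF heat_kernel_integrable]) (auto simp: heat_kernel_mass heat_kernel_nonneg)

section \<open>Gaussian smoothing\<close>

text \<open>Convolution with the heat kernel at time \<open>\<epsilon>\<close>, after the substitution that makes the Gaussian
  weight independent of \<open>\<epsilon>\<close>.\<close>

definition smoothing :: "(real ^ 'd::finite \<Rightarrow> real) \<Rightarrow> real \<Rightarrow> real ^ 'd \<Rightarrow> real" where
  "smoothing F \<epsilon> x = (LINT z|lborel. F (x + sqrt \<epsilon> *\<^sub>R z) * heat_kernel 1 z)"

lemma smoothing_measurable [measurable (raw)]:
  fixes F :: "real ^ 'd::finite \<Rightarrow> real"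
  assumes [measurable]: "F \<in> borel_measurable borel" "f \<in> borel_measurable N"
  shows "(\<lambda>x. smoothing F \<epsilon> (f x)) \<in> borel_measurable N"
  unfolding smoothing_def by measurable

lemma heat_kernel_le: "heat_kernel 1 (z :: real ^ 'd::finite) \<le> (2 * pi) powr (- real CARD('d) / 2)"
  by (simp add: heat_kernel_def)

lemma smoothing_integrand_integrable:
  fixes F :: "real ^ 'd::finite \<Rightarrow> real"
  assumes "integrable lborel F" "\<epsilon> > 0"
  shows "integrable lborel (\<lambda>z. F (x + sqrt \<epsilon> *\<^sub>R z) * heat_kernel 1 z)"
proof (rule Bochner_Integration.integrable_bound)
  have [measurable]: "F \<in> borel_measurable borel" using assms(1) by auto
  show "integrable lborel (\<lambda>z. (2 * pi) powr (- real CARD('d) / 2) * \<bar>F (x + sqrt \<epsilon> *\<^sub>R z)\<bar>)"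
    using assms by (intro integrable_mult_right integrable_abs lborel_scale_integrable) auto
  show "AE z in lborel. norm (F (x + sqrt \<epsilon> *\<^sub>R z) * heat_kernel 1 z)
     \<le> norm ((2 * pi) powr (- real CARD('d) / 2) * \<bar>F (x + sqrt \<epsilon> *\<^sub>R z)\<bar>)"
    using mult_left_mono[OF heat_kernel_le abs_ge_zero]
    by (intro always_eventually allI) (simp add: abs_mult heat_kernel_nonneg mult.commute[of "(2 * pi) powr _"])
  show "(\<lambda>z. F (x + sqrt \<epsilon> *\<^sub>R z) * heat_kernel 1 z) \<in> borel_measurable lborel" by measurable
qed

lemma smoothing_L1_le:
  fixes F :: "real ^ 'd::finite \<Rightarrow> real"
  assumes [measurable]: "F \<in> borel_measurable borel"
  shows "(\<integral>\<^sup>+x. ennreal \<bar>smoothing F \<epsilon> x\<bar> \<partial>lborel) \<le> (\<integral>\<^sup>+x. ennreal \<bar>F x\<bar> \<partial>lborel)"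
proof -
  have "(\<integral>\<^sup>+x. ennreal \<bar>smoothing F \<epsilon> x\<bar> \<partial>lborel)
    \<le> (\<integral>\<^sup>+x. \<integral>\<^sup>+z. ennreal \<bar>F (x + sqrt \<epsilon> *\<^sub>R z)\<bar> * ennreal (heat_kernel 1 z) \<partial>lborel \<partial>lborel)"
  proof (rule nn_integral_mono)
    fix x
    show "ennreal \<bar>smoothing F \<epsilon> x\<bar> \<le> (\<integral>\<^sup>+z. ennreal \<bar>F (x + sqrt \<epsilon> *\<^sub>R z)\<bar> * ennreal (heat_kernel 1 z) \<partial>lborel)"
      using norm_integral_le_nn_integral[of lborel "\<lambda>z. F (x + sqrt \<epsilon> *\<^sub>R z) * heat_kernel 1 z"]
      by (simp add: smoothing_def abs_mult heat_kernel_nonneg ennreal_mult)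
  qed
  also have "\<dots> = (\<integral>\<^sup>+z. \<integral>\<^sup>+x. ennreal \<bar>F (x + sqrt \<epsilon> *\<^sub>R z)\<bar> * ennreal (heat_kernel 1 z) \<partial>lborel \<partial>lborel)"
    by (rule lborel_pair.Fubini'[symmetric]) measurable
  also have "\<dots> = (\<integral>\<^sup>+z. (\<integral>\<^sup>+x. ennreal \<bar>F x\<bar> \<partial>lborel) * ennreal (heat_kernel 1 (z :: real ^ 'd)) \<partial>lborel)"
  proof (rule nn_integral_cong)
    fix z :: "real ^ 'd"
    have "(\<integral>\<^sup>+x. ennreal \<bar>F x\<bar> \<partial>lborel) = (\<integral>\<^sup>+x. ennreal \<bar>F (x + sqrt \<epsilon> *\<^sub>R z)\<bar> \<partial>lborel)"
      using lborel_scale_nn_integral[of 1 "\<lambda>x. ennreal \<bar>F x\<bar>" "sqrt \<epsilon> *\<^sub>R z"] by (simp add: add.commute)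
    then show "(\<integral>\<^sup>+x. ennreal \<bar>F (x + sqrt \<epsilon> *\<^sub>R z)\<bar> * ennreal (heat_kernel 1 z) \<partial>lborel) = (\<integral>\<^sup>+x. ennreal \<bar>F x\<bar> \<partial>lborel) * ennreal (heat_kernel 1 z)"
      by (simp add: nn_integral_multc)
  qed
  also have "\<dots> = (\<integral>\<^sup>+x. ennreal \<bar>F x\<bar> \<partial>lborel)"
    by (simp add: nn_integral_cmult heat_kernel_nn_mass)
  finally show ?thesis .
qed

lemma smoothing_tendsto:
  fixes g :: "real ^ 'd::finite \<Rightarrow> real"
  assumes g: "continuous_on UNIV g" and B: "\<And>x. \<bar>g x\<bar> \<le> B" and e: "\<And>n. e n \<ge> 0" "e \<longlonglongrightarrow> 0"
  shows "(\<lambda>n. smoothing g (e n) x) \<longlonglongrightarrow> g x" and "\<bar>smoothing g \<epsilon> x\<bar> \<le> B"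
proof -
  have [measurable]: "g \<in> borel_measurable borel" by (rule borel_measurable_continuous_onI[OF g])
  have h: "integrable lborel (\<lambda>z::real ^ 'd. B * heat_kernel 1 z)"
    by (intro integrable_mult_right heat_kernel_integrable)
  have le: "\<bar>g y * heat_kernel 1 z\<bar> \<le> B * heat_kernel 1 z" for y z
    using B[of y] heat_kernel_nonneg[of 1 z] by (simp add: abs_mult mult_right_mono)
  have "(\<lambda>n. smoothing g (e n) x) \<longlonglongrightarrow> (LINT z|lborel. g x * heat_kernel 1 (z :: real ^ 'd))"
    unfolding smoothing_def
  proof (rule integral_dominated_convergence[OF _ _ h])
    show "AE z in lborel. (\<lambda>n. g (x + sqrt (e n) *\<^sub>R z) * heat_kernel 1 z) \<longlonglongrightarrow> g x * heat_kernel 1 z"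
    proof (intro always_eventually allI tendsto_mult_right)
      fix z :: "real ^ 'd"
      have "(\<lambda>n. x + sqrt (e n) *\<^sub>R z) \<longlonglongrightarrow> x + sqrt 0 *\<^sub>R z"
        by (intro tendsto_intros e)
      then have "(\<lambda>n. x + sqrt (e n) *\<^sub>R z) \<longlonglongrightarrow> x" by simp
      moreover have "isCont g x" using g by (simp add: continuous_on_eq_continuous_at)
      ultimately show "(\<lambda>n. g (x + sqrt (e n) *\<^sub>R z)) \<longlonglongrightarrow> g x"
        by (intro isCont_tendsto_compose[where g = g])
    qed
    show "AE z in lborel. norm (g (x + sqrt (e n) *\<^sub>R z) * heat_kernel 1 z) \<le> B * heat_kernel 1 z" for n
      by (intro always_eventually allI) (simp only: real_norm_def le)
  qed measurable
  then show "(\<lambda>n. smoothing g (e n) x) \<longlonglongrightarrow> g x"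
    by (simp add: heat_kernel_mass)
  have "\<bar>smoothing g \<epsilon> x\<bar> \<le> (LINT z|lborel. B * heat_kernel 1 (z :: real ^ 'd))"
    unfolding smoothing_def real_norm_def[symmetric]
  proof (rule order_trans[OF integral_norm_bound integral_mono[OF integrable_norm h]])
    show "integrable lborel (\<lambda>z. g (x + sqrt \<epsilon> *\<^sub>R z) * heat_kernel 1 z)"
    proof (rule Bochner_Integration.integrable_bound[OF h])
      show "AE z in lborel. norm (g (x + sqrt \<epsilon> *\<^sub>R z) * heat_kernel 1 z) \<le> norm (B * heat_kernel 1 z)"
        by (intro always_eventually allI) (simp only: real_norm_def order_trans[OF le abs_ge_self])
    qed measurable
    show "norm (g (x + sqrt \<epsilon> *\<^sub>R z) * heat_kernel 1 z) \<le> B * heat_kernel 1 z" for z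
      by (simp only: real_norm_def le)
  qed
  then show "\<bar>smoothing g \<epsilon> x\<bar> \<le> B"
    by (simp add: heat_kernel_mass)
qed

text \<open>For an indicator function, interpolate by Urysohn's lemma between a closed set inside and an open
  set outside that differ by little.\<close>

lemma integrable_approx_continuous:
  fixes F :: "'b::euclidean_space \<Rightarrow> real"
  assumes "integrable lborel F" "e > 0"
  shows "\<exists>g B. continuous_on UNIV g \<and> (\<forall>x. \<bar>g x\<bar> \<le> B) \<and> integrable lborel g \<and> (LINT x|lborel. \<bar>F x - g x\<bar>) < e"
  using assms
proof (induction F arbitrary: e rule: integrable_induct)
  case (base A c)
  define d where "d = e / (3 * (\<bar>c\<bar> + 1))"
  have d: "d > 0" using base by (simp add: d_def)
  have A: "A \<in> sets borel" "emeasure lborel A < \<infinity>" using base by auto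
  obtain U where U: "open U" "A \<subseteq> U" "emeasure lborel (U - A) < d"
    using outer_regular_lborel[OF A(1) d] by blast
  obtain V where V: "open V" "- A \<subseteq> V" "emeasure lborel (V - (- A)) < d"
    using outer_regular_lborel[of "- A" d] A(1) d by auto
  obtain h :: "'b \<Rightarrow> real" where h: "continuous_on UNIV h" "\<And>x. h x \<in> closed_segment 0 1"
    "\<And>x. x \<in> - U \<Longrightarrow> h x = 0" "\<And>x. x \<in> - V \<Longrightarrow> h x = 1"
    using Urysohn[of "- U" "- V" "0::real" 1] U(1,2) V(1,2) by (auto simp: closed_Compl)
  have h01: "0 \<le> h x" "h x \<le> 1" for x using h(2)[of x] by (auto simp: closed_segment_eq_real_ivl)
  have [measurable]: "h \<in> borel_measurable borel" "U \<in> sets borel" "V \<in> sets borel" "A \<in> sets borel"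
    using borel_measurable_continuous_onI[OF h(1)] U V A by auto
  have UA: "emeasure lborel (U - A) < \<infinity>" "emeasure lborel (V \<inter> A) < \<infinity>"
    using less_trans[OF U(3)] less_trans[OF V(3)] by (auto simp: Diff_eq ennreal_less_top)
  have hi: "integrable lborel h"
  proof (rule Bochner_Integration.integrable_bound)
    have "emeasure lborel U \<le> emeasure lborel A + emeasure lborel (U - A)"
      using emeasure_subadditive[of A lborel "U - A"] U(2) by (simp add: Un_absorb1)
    also have "\<dots> < \<infinity>" using A UA by simp
    finally show "integrable lborel (indicat_real U)" by (intro integrable_real_indicator) auto
    show "AE x in lborel. norm (h x) \<le> norm (indicat_real U x)"
      using h(3) h01 by (auto simp: indicator_def)
  qed measurable
  have "(LINT x|lborel. \<bar>indicator A x *\<^sub>R c - c * h x\<bar>)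
     \<le> (LINT x|lborel. \<bar>c\<bar> * (indicat_real (U - A) x + indicat_real (V \<inter> A) x))"
  proof (rule integral_mono)
    show "integrable lborel (\<lambda>x. \<bar>c\<bar> * (indicat_real (U - A) x + indicat_real (V \<inter> A) x))"
      using UA by (intro integrable_mult_right Bochner_Integration.integrable_add integrable_real_indicator) auto
    show "integrable lborel (\<lambda>x. \<bar>indicator A x *\<^sub>R c - c * h x\<bar>)"
      using hi A by (intro integrable_abs Bochner_Integration.integrable_diff integrable_mult_right integrable_scaleR_left integrable_real_indicator) auto
    fix x
    have "\<bar>indicat_real A x - h x\<bar> \<le> indicat_real (U - A) x + indicat_real (V \<inter> A) x"
      using h01[of x] h(3,4)[of x] by (auto simp: indicator_def)
    then have "\<bar>c\<bar> * \<bar>indicat_real A x - h x\<bar> \<le> \<bar>c\<bar> * (indicat_real (U - A) x + indicat_real (V \<inter> A) x)"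
      by (rule mult_left_mono) simp
    moreover have "\<bar>c\<bar> * \<bar>indicat_real A x - h x\<bar> = \<bar>indicator A x *\<^sub>R c - c * h x\<bar>"
      unfolding abs_mult[symmetric] by (simp add: right_diff_distrib mult.commute)
    ultimately show "\<bar>indicator A x *\<^sub>R c - c * h x\<bar> \<le> \<bar>c\<bar> * (indicat_real (U - A) x + indicat_real (V \<inter> A) x)"
      by simp
  qed
  also have "\<dots> = \<bar>c\<bar> * (measure lborel (U - A) + measure lborel (V \<inter> A))"
    using UA by (simp add: integrable_real_indicator)
  also have "\<dots> \<le> \<bar>c\<bar> * (d + d)"
    using U(3) V(3) d UA
    by (intro mult_left_mono add_mono) (auto simp: emeasure_eq_ennreal_measure Diff_eq ennreal_less_iff less_top)
  also have "\<dots> < e"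
  proof -
    have "0 \<le> \<bar>c\<bar> * d" using d by simp
    then have "\<bar>c\<bar> * (d + d) < d * (3 * (\<bar>c\<bar> + 1))"
      using d unfolding distrib_left mult.commute[of d] distrib_right by linarith
    also have "\<dots> = e" by (simp add: d_def add_pos_nonneg)
    finally show ?thesis .
  qed
  finally show ?case
    using h hi h01 by (intro exI[of _ "\<lambda>x. c * h x"] exI[of _ "\<bar>c\<bar>"])
      (auto intro!: continuous_intros simp: abs_mult mult_left_le)
next
  case (add f g)
  obtain f' B1 where f': "continuous_on UNIV f'" "\<And>x. \<bar>f' x\<bar> \<le> B1" "integrable lborel f'" "(LINT x|lborel. \<bar>f x - f' x\<bar>) < e / 2"
    using add.IH(1)[of "e / 2"] add.prems by auto
  obtain g' B2 where g': "continuous_on UNIV g'" "\<And>x. \<bar>g' x\<bar> \<le> B2" "integrable lborel g'" "(LINT x|lborel. \<bar>g x - g' x\<bar>) < e / 2"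
    using add.IH(2)[of "e / 2"] add.prems by auto
  have "(LINT x|lborel. \<bar>f x + g x - (f' x + g' x)\<bar>) \<le> (LINT x|lborel. \<bar>f x - f' x\<bar> + \<bar>g x - g' x\<bar>)"
    using add.hyps f'(3) g'(3) by (intro integral_mono) auto
  also have "\<dots> < e" using add.hyps f'(3,4) g'(3,4) by simp
  finally show ?case
    using f' g' by (intro exI[of _ "\<lambda>x. f' x + g' x"] exI[of _ "B1 + B2"])
      (auto intro!: continuous_intros order_trans[OF abs_triangle_ineq] add_mono)
next
  case (lim f s)
  have "(\<lambda>i. LINT x|lborel. \<bar>f x - s i x\<bar>) \<longlonglongrightarrow> integral\<^sup>L lborel (\<lambda>x::'b. 0 :: real)"
  proof (rule integral_dominated_convergence)
    show "integrable lborel (\<lambda>x. 3 * \<bar>f x\<bar>)" using lim.hyps by auto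
    show "AE x in lborel. (\<lambda>i. \<bar>f x - s i x\<bar>) \<longlonglongrightarrow> 0"
    proof (rule AE_I2)
      fix x :: 'b assume "x \<in> space lborel"
      then have "(\<lambda>i. \<bar>f x - s i x\<bar>) \<longlonglongrightarrow> \<bar>f x - f x\<bar>"
        by (intro tendsto_intros lim.hyps)
      then show "(\<lambda>i. \<bar>f x - s i x\<bar>) \<longlonglongrightarrow> 0" by simp
    qed
    show "AE x in lborel. norm \<bar>f x - s i x\<bar> \<le> 3 * \<bar>f x\<bar>" for i
    proof (rule AE_I2)
      fix x :: 'b assume "x \<in> space lborel"
      then have "norm (s i x) \<le> 2 * norm (f x)" by (rule lim.hyps)
      then show "norm \<bar>f x - s i x\<bar> \<le> 3 * \<bar>f x\<bar>" using abs_triangle_ineq4[of "f x" "s i x"] by simp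
    qed
  qed (use lim.hyps in auto)
  then have "(\<lambda>i. LINT x|lborel. \<bar>f x - s i x\<bar>) \<longlonglongrightarrow> 0" by simp
  then have "\<forall>\<^sub>F i in sequentially. (LINT x|lborel. \<bar>f x - s i x\<bar>) < e / 2"
    using lim.prems by (intro order_tendstoD) auto
  then obtain i where i: "(LINT x|lborel. \<bar>f x - s i x\<bar>) < e / 2"
    by (auto simp: eventually_sequentially)
  obtain g B where g: "continuous_on UNIV g" "\<And>x. \<bar>g x\<bar> \<le> B" "integrable lborel g" "(LINT x|lborel. \<bar>s i x - g x\<bar>) < e / 2"
    using lim.IH[of "e / 2" i] lim.prems by auto
  have "(LINT x|lborel. \<bar>f x - g x\<bar>) \<le> (LINT x|lborel. \<bar>f x - s i x\<bar> + \<bar>s i x - g x\<bar>)"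
    using lim.hyps g(3) by (intro integral_mono) auto
  also have "\<dots> < e" using lim.hyps g(3,4) i by simp
  finally show ?case using g by blast
qed

section \<open>Density of the occupation measure\<close>

locale vector_process = chain_process M X H for M :: "'a measure" and X :: "real \<Rightarrow> 'a \<Rightarrow> real ^ 'd::finite" and H

context vector_process
begin

text \<open>The characteristic function of \<open>X s\<close> is integrable, hence its law has a bounded density; the
  density is bounded uniformly after smoothing.\<close>

lemma expectation_heat_kernel_le:
  assumes "t > 0"
  shows "\<exists>C\<ge>0. \<forall>\<epsilon>>0. \<forall>x. \<forall>s\<in>{0<..<t}.
    (\<integral>\<^sup>+w. ennreal (heat_kernel \<epsilon> (X s w - x)) \<partial>M) \<le> ennreal (C * s powr (- (H * real CARD('d))))"
proof -
  obtain c where c: "c > 0" and char: "\<And>r u L. \<lbrakk>r > 0; ascending r L; length L = 0\<rbrakk> \<Longrightarrow>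
      norm (LINT w|M. iexp (u \<bullet> X r w + increments X r L w)) \<le> exp (- c * ((norm u)\<^sup>2 * r powr (2 * H) + energy H r L))"
    using char_le[of 0] by blast
  have char0: "norm (LINT w|M. iexp (u \<bullet> X r w)) \<le> exp (- c * (norm u)\<^sup>2 * r powr (2 * H))" if "r > 0" for r u
    using char[of r "[]" u] that by (simp add: mult.assoc)
  obtain C where C: "C \<ge> 0" "\<And>\<delta>. \<lbrakk>0 < \<delta>; \<delta> \<le> t\<rbrakk> \<Longrightarrow>
    (\<integral>\<^sup>+v. ennreal ((1 + norm (v::real ^ 'd)) ^ 0 * exp (- c * (norm v)\<^sup>2 * \<delta> powr (2 * H))) \<partial>lborel)
      \<le> ennreal (C * \<delta> powr (- H * (real DIM(real ^ 'd) + real 0)))"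
    using gaussian_moment_scaling[OF c H_pos assms, where k = 0 and 'a = "real ^ 'd"] by blast
  define a where "a = (2 * pi) powr (- real CARD('d))"
  have a: "a > 0" by (simp add: a_def)
  interpret lM: pair_sigma_finite "lborel :: (real ^ 'd) measure" M ..
  show ?thesis
  proof (intro exI[of _ "a * C"] conjI allI impI ballI)
    show "a * C \<ge> 0" using a C by simp
    fix \<epsilon> :: real and x :: "real ^ 'd" and s assume e: "\<epsilon> > 0" and s: "s \<in> {0<..<t}"
    have hi: "integrable lborel (heat_multiplier \<epsilon> :: real ^ 'd \<Rightarrow> real)"
      using heat_multiplier_moment_integrable[OF e, of 0] by simp
    let ?f = "\<lambda>\<xi> w. complex_of_real (heat_multiplier \<epsilon> \<xi>) * iexp (\<xi> \<bullet> (X s w - x))"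
    have int: "integrable (lborel \<Otimes>\<^sub>M M) (\<lambda>(\<xi>, w). ?f \<xi> w)"
      by (rule integrable_pair_bounded[OF _ hi]) (simp_all add: norm_mult heat_multiplier_nonneg)
    have bnd: "heat_kernel \<epsilon> y \<le> (2 * pi * \<epsilon>) powr (- real CARD('d) / 2)" for y :: "real ^ 'd"
      using e by (simp add: heat_kernel_def)
    have int2: "integrable M (\<lambda>w. heat_kernel \<epsilon> (X s w - x))"
      by (rule integrable_const_bound[where B = "(2 * pi * \<epsilon>) powr (- real CARD('d) / 2)"])
        (use bnd in \<open>auto simp: heat_kernel_nonneg\<close>)
    have "(\<integral>\<^sup>+w. ennreal (heat_kernel \<epsilon> (X s w - x)) \<partial>M) = ennreal (LINT w|M. heat_kernel \<epsilon> (X s w - x))"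
      by (rule nn_integral_eq_integral[OF int2]) (simp add: heat_kernel_nonneg)
    also have "(LINT w|M. heat_kernel \<epsilon> (X s w - x)) = norm (LINT w|M. complex_of_real (heat_kernel \<epsilon> (X s w - x)))"
    proof -
      have "0 \<le> (LINT w|M. heat_kernel \<epsilon> (X s w - x))"
        by (intro integral_nonneg_AE) (simp add: heat_kernel_nonneg)
      then show ?thesis by (simp only: integral_complex_of_real norm_of_real abs_of_nonneg)
    qed
    also have "(LINT w|M. complex_of_real (heat_kernel \<epsilon> (X s w - x))) = (LINT w|M. LINT \<xi>|lborel. ?f \<xi> w)"
      by (simp only: heat_kernel_fourier[OF e])
    also have "ennreal (norm \<dots>) \<le> (\<integral>\<^sup>+\<xi>. ennreal (norm (LINT w|M. ?f \<xi> w)) \<partial>lborel)"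
      by (rule lM.norm_iterated_integral_le[OF int])
    also have "\<dots> \<le> (\<integral>\<^sup>+\<xi>. ennreal a * ennreal ((1 + norm (\<xi> :: real ^ 'd)) ^ 0 * exp (- c * (norm \<xi>)\<^sup>2 * s powr (2 * H))) \<partial>lborel)"
    proof (rule nn_integral_mono)
      fix \<xi> :: "real ^ 'd"
      have "?f \<xi> w = (complex_of_real (heat_multiplier \<epsilon> \<xi>) * iexp (- (\<xi> \<bullet> x))) * iexp (\<xi> \<bullet> X s w)" for w
        by (simp add: inner_diff_right exp_add[symmetric] algebra_simps)
      then have "norm (LINT w|M. ?f \<xi> w) = heat_multiplier \<epsilon> \<xi> * norm (LINT w|M. iexp (\<xi> \<bullet> X s w))"
        by (simp only: integral_mult_right_zero norm_mult norm_exp_i_times norm_of_real abs_of_nonneg[OF heat_multiplier_nonneg] mult_1_right)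
      also have "\<dots> \<le> a * exp (- c * (norm \<xi>)\<^sup>2 * s powr (2 * H))"
        using e s a by (intro mult_mono char0) (auto simp: heat_multiplier_def a_def)
      finally show "ennreal (norm (LINT w|M. ?f \<xi> w)) \<le> ennreal a * ennreal ((1 + norm \<xi>) ^ 0 * exp (- c * (norm \<xi>)\<^sup>2 * s powr (2 * H)))"
        using a by (subst ennreal_mult[symmetric]) (auto intro: ennreal_leI)
    qed
    also have "\<dots> = ennreal a * (\<integral>\<^sup>+\<xi>. ennreal ((1 + norm (\<xi> :: real ^ 'd)) ^ 0 * exp (- c * (norm \<xi>)\<^sup>2 * s powr (2 * H))) \<partial>lborel)"
      by (rule nn_integral_cmult) measurable
    also have "\<dots> \<le> ennreal a * ennreal (C * s powr (- H * (real DIM(real ^ 'd) + real 0)))"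
      using s by (intro mult_left_mono C) auto
    also have "\<dots> = ennreal (a * C * s powr (- (H * real CARD('d))))"
      using a C by (simp add: ennreal_mult[symmetric] mult.assoc)
    finally show "(\<integral>\<^sup>+w. ennreal (heat_kernel \<epsilon> (X s w - x)) \<partial>M) \<le> ennreal (a * C * s powr (- (H * real CARD('d))))" .
  qed
qed

text \<open>Indicators of open sets are lower semicontinuous, so Fatou's lemma removes the smoothing from the
  density bound. Outer regularity then extends it to all Borel sets.\<close>

lemma open_set_probability_le:
  assumes U: "open U" and B: "\<And>\<epsilon> x. \<epsilon> > 0 \<Longrightarrow> (\<integral>\<^sup>+w. ennreal (heat_kernel \<epsilon> (X s w - x)) \<partial>M) \<le> B"
  shows "(\<integral>\<^sup>+w. indicator U (X s w) \<partial>M) \<le> B * emeasure lborel U"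
proof -
  have [measurable]: "U \<in> sets borel" using U by auto
  define e where "e k = inverse (real (Suc k))" for k
  have e: "e k > 0" "e \<longlonglongrightarrow> 0" for k
    using LIMSEQ_inverse_real_of_nat by (auto simp: e_def[abs_def])
  define I where "I k w = (\<integral>\<^sup>+z. indicator U (X s w + sqrt (e k) *\<^sub>R z) * ennreal (heat_kernel 1 z) \<partial>lborel)" for k w
  have [measurable]: "I k \<in> borel_measurable M" for k unfolding I_def[abs_def] by measurable
  have "(\<integral>\<^sup>+w. indicator U (X s w) \<partial>M) \<le> (\<integral>\<^sup>+w. liminf (\<lambda>k. I k w) \<partial>M)"
  proof (rule nn_integral_mono)
    fix w
    show "indicator U (X s w) \<le> liminf (\<lambda>k. I k w)"
    proof (cases "X s w \<in> U")
      case True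
      have "1 = (\<integral>\<^sup>+z. ennreal (heat_kernel 1 (z :: real ^ 'd)) \<partial>lborel)"
        by (rule heat_kernel_nn_mass[symmetric])
      also have "\<dots> \<le> (\<integral>\<^sup>+z. liminf (\<lambda>k. indicator U (X s w + sqrt (e k) *\<^sub>R z) * ennreal (heat_kernel 1 z)) \<partial>lborel)"
      proof (rule nn_integral_mono)
        fix z :: "real ^ 'd"
        have "(\<lambda>k. X s w + sqrt (e k) *\<^sub>R z) \<longlonglongrightarrow> X s w + sqrt 0 *\<^sub>R z"
          by (intro tendsto_intros e)
        then have "\<forall>\<^sub>F k in sequentially. X s w + sqrt (e k) *\<^sub>R z \<in> U"
          using topological_tendstoD[OF _ U] True by fastforce
        then have "\<forall>\<^sub>F k in sequentially. ennreal (heat_kernel 1 z) \<le> indicator U (X s w + sqrt (e k) *\<^sub>R z) * ennreal (heat_kernel 1 z)"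
          by (rule eventually_mono) simp
        then show "ennreal (heat_kernel 1 z) \<le> liminf (\<lambda>k. indicator U (X s w + sqrt (e k) *\<^sub>R z) * ennreal (heat_kernel 1 z))"
          by (rule Liminf_bounded)
      qed
      also have "\<dots> \<le> liminf (\<lambda>k. I k w)"
        unfolding I_def by (rule nn_integral_liminf) measurable
      finally show ?thesis using True by simp
    qed simp
  qed
  also have "\<dots> \<le> liminf (\<lambda>k. \<integral>\<^sup>+w. I k w \<partial>M)"
    by (rule nn_integral_liminf) measurable
  also have "\<dots> \<le> liminf (\<lambda>k::nat. B * emeasure lborel U)"
  proof (rule Liminf_mono, intro always_eventually allI)
    fix k
    interpret lM: pair_sigma_finite "lborel :: (real ^ 'd) measure" M ..
    have "I k w = (\<integral>\<^sup>+u. indicator U u * ennreal (heat_kernel (e k) (X s w - u)) \<partial>lborel)" for w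
    proof -
      have "(\<integral>\<^sup>+u. indicator U u * ennreal (heat_kernel (e k) (X s w - u)) \<partial>lborel)
        = ennreal (\<bar>sqrt (e k)\<bar> ^ DIM(real ^ 'd)) * (\<integral>\<^sup>+z. indicator U (X s w + sqrt (e k) *\<^sub>R z) * ennreal (heat_kernel (e k) (X s w - (X s w + sqrt (e k) *\<^sub>R z))) \<partial>lborel)"
        using e(1)[of k] by (intro lborel_scale_nn_integral) auto
      also have "\<dots> = (\<integral>\<^sup>+z. ennreal (sqrt (e k) ^ CARD('d)) * (indicator U (X s w + sqrt (e k) *\<^sub>R z) * ennreal (heat_kernel (e k) (sqrt (e k) *\<^sub>R z))) \<partial>lborel)"
        using e(1)[of k] by (subst nn_integral_cmult[symmetric]) (auto intro!: nn_integral_cong simp: heat_kernel_def)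
      also have "\<dots> = I k w"
        unfolding I_def heat_kernel_scale[OF e(1), of k, symmetric]
        using e(1)[of k] by (intro nn_integral_cong) (simp add: ennreal_mult heat_kernel_nonneg mult_ac)
      finally show ?thesis ..
    qed
    then have "(\<integral>\<^sup>+w. I k w \<partial>M) = (\<integral>\<^sup>+w. (\<integral>\<^sup>+u. indicator U u * ennreal (heat_kernel (e k) (X s w - u)) \<partial>lborel) \<partial>M)"
      by simp
    also have "\<dots> = (\<integral>\<^sup>+u. (\<integral>\<^sup>+w. indicator U u * ennreal (heat_kernel (e k) (X s w - u)) \<partial>M) \<partial>lborel)"
      by (rule lM.Fubini') measurable
    also have "\<dots> = (\<integral>\<^sup>+u. indicator U u * (\<integral>\<^sup>+w. ennreal (heat_kernel (e k) (X s w - u)) \<partial>M) \<partial>lborel)"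
      by (intro nn_integral_cong nn_integral_cmult) measurable
    also have "\<dots> \<le> (\<integral>\<^sup>+u. indicator U u * B \<partial>lborel)"
      by (intro nn_integral_mono mult_left_mono B e) auto
    also have "\<dots> = B * emeasure lborel U"
      by (simp add: nn_integral_cmult_indicator mult.commute[of "indicator U _"])
    finally show "(\<integral>\<^sup>+w. I k w \<partial>M) \<le> B * emeasure lborel U" .
  qed
  also have "\<dots> = B * emeasure lborel U"
    by (simp add: Liminf_const)
  finally show ?thesis .
qed

lemma expectation_le_integral:
  assumes B: "\<And>\<epsilon> x. \<epsilon> > 0 \<Longrightarrow> (\<integral>\<^sup>+w. ennreal (heat_kernel \<epsilon> (X s w - x)) \<partial>M) \<le> ennreal b" "b \<ge> 0"
    and [measurable]: "h \<in> borel_measurable borel"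
  shows "(\<integral>\<^sup>+w. h (X s w) \<partial>M) \<le> ennreal b * (\<integral>\<^sup>+x. h x \<partial>lborel)"
proof -
  let ?D = "distr M borel (X s)" and ?L = "density lborel (\<lambda>_. ennreal b)"
  have "?D \<le> ?L"
  proof (subst le_measure, simp, intro ballI)
    fix A assume "A \<in> sets ?D"
    then have A [measurable]: "A \<in> sets borel" by simp
    have "emeasure ?D A \<le> ennreal b * emeasure lborel A"
    proof (rule ennreal_le_epsilon)
      fix e :: real assume "0 < e"
      define e' where "e' = e / (b + 1)"
      have e': "e' > 0" "b * e' \<le> e" using \<open>0 < e\<close> B(2) by (auto simp: e'_def field_simps)
      obtain U where U: "open U" "A \<subseteq> U" "emeasure lborel (U - A) < e'"
        using outer_regular_lborel[OF A e'(1)] by blast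
      have [measurable]: "U \<in> sets borel" using U by auto
      have "emeasure ?D A \<le> emeasure ?D U" using U by (intro emeasure_mono) auto
      also have "\<dots> = (\<integral>\<^sup>+x. indicator U x \<partial>?D)" by simp
      also have "\<dots> = (\<integral>\<^sup>+w. indicator U (X s w) \<partial>M)" by (subst nn_integral_distr) auto
      also have "\<dots> \<le> ennreal b * emeasure lborel U" by (rule open_set_probability_le[OF U(1) B(1)])
      also have "\<dots> \<le> ennreal b * (emeasure lborel A + ennreal e')"
      proof (rule mult_left_mono)
        have "emeasure lborel U \<le> emeasure lborel A + emeasure lborel (U - A)"
          using emeasure_subadditive[of A lborel "U - A"] U(2) by (simp add: Un_absorb1)
        also have "\<dots> \<le> emeasure lborel A + ennreal e'" using U(3) by (intro add_left_mono) simp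
        finally show "emeasure lborel U \<le> emeasure lborel A + ennreal e'" .
      qed simp
      also have "\<dots> \<le> ennreal b * emeasure lborel A + ennreal e"
        using e' B(2) by (simp add: distrib_left ennreal_mult[symmetric] add_left_mono ennreal_leI)
      finally show "emeasure ?D A \<le> ennreal b * emeasure lborel A + ennreal e" .
    qed
    then show "emeasure ?D A \<le> emeasure ?L A"
      by (simp add: emeasure_density nn_integral_cmult)
  qed
  then have "(\<integral>\<^sup>+x. h x \<partial>?D) \<le> (\<integral>\<^sup>+x. h x \<partial>?L)"
    by (intro nn_integral_mono_measure) auto
  then show ?thesis
    by (simp add: nn_integral_distr nn_integral_density nn_integral_cmult)
qed

lemma occupation_density:
  assumes "t > 0" "H * real CARD('d) < 1"
  shows "\<exists>K<\<infinity>. \<forall>h\<in>borel_measurable borel.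
    (\<integral>\<^sup>+w. (\<integral>\<^sup>+s. indicator {0<..<t} s * h (X s w) \<partial>lborel) \<partial>M) \<le> K * (\<integral>\<^sup>+x. h x \<partial>lborel)"
proof -
  obtain C where C: "C \<ge> 0" "\<And>\<epsilon> x s. \<lbrakk>\<epsilon> > 0; s \<in> {0<..<t}\<rbrakk> \<Longrightarrow>
    (\<integral>\<^sup>+w. ennreal (heat_kernel \<epsilon> (X s w - x)) \<partial>M) \<le> ennreal (C * s powr (- (H * real CARD('d))))"
    using expectation_heat_kernel_le[OF assms(1)] by blast
  define K where "K = ennreal C * (\<integral>\<^sup>+s. indicator {0<..<t} s * ennreal (s powr (- (H * real CARD('d)))) \<partial>lborel)"
  have K: "K < \<infinity>"
    using nn_integral_powr_less_top[OF assms(2,1)] by (simp add: K_def ennreal_mult_less_top)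
  interpret lR: pair_sigma_finite "lborel :: real measure" M ..
  have "(\<integral>\<^sup>+w. (\<integral>\<^sup>+s. indicator {0<..<t} s * h (X s w) \<partial>lborel) \<partial>M) \<le> K * (\<integral>\<^sup>+x. h x \<partial>lborel)"
    if [measurable]: "h \<in> borel_measurable borel" for h
  proof -
    have "(\<integral>\<^sup>+w. (\<integral>\<^sup>+s. indicator {0<..<t} s * h (X s w) \<partial>lborel) \<partial>M)
      = (\<integral>\<^sup>+s. (\<integral>\<^sup>+w. indicator {0<..<t} s * h (X s w) \<partial>M) \<partial>lborel)"
      by (rule lR.Fubini') measurable
    also have "\<dots> = (\<integral>\<^sup>+s. indicator {0<..<t} s * (\<integral>\<^sup>+w. h (X s w) \<partial>M) \<partial>lborel)"
      by (intro nn_integral_cong nn_integral_cmult) measurable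
    also have "\<dots> \<le> (\<integral>\<^sup>+s. (ennreal C * (\<integral>\<^sup>+x. h x \<partial>lborel)) * (indicator {0<..<t} s * ennreal (s powr (- (H * real CARD('d))))) \<partial>lborel)"
    proof (rule nn_integral_mono)
      fix s :: real
      show "indicator {0<..<t} s * (\<integral>\<^sup>+w. h (X s w) \<partial>M)
        \<le> (ennreal C * (\<integral>\<^sup>+x. h x \<partial>lborel)) * (indicator {0<..<t} s * ennreal (s powr (- (H * real CARD('d)))))"
      proof (cases "s \<in> {0<..<t}")
        case True
        have "(\<integral>\<^sup>+w. h (X s w) \<partial>M) \<le> ennreal (C * s powr (- (H * real CARD('d)))) * (\<integral>\<^sup>+x. h x \<partial>lborel)"
          by (rule expectation_le_integral[OF C(2)[OF _ True]]) (use C(1) in auto)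
        then show ?thesis using True C(1) by (simp add: ennreal_mult mult_ac)
      qed simp
    qed
    also have "\<dots> = K * (\<integral>\<^sup>+x. h x \<partial>lborel)"
      unfolding K_def by (subst nn_integral_cmult) (simp_all add: mult_ac)
    finally show ?thesis .
  qed
  then show ?thesis using K by (intro exI[of _ K]) auto
qed

end

section \<open>Convergence in all even moments\<close>

text \<open>Even powers suffice to control every \<open>p \<ge> 1\<close>, and they are the ones for which the moment bound
  of an occupation functional holds.\<close>

definition finite_moments :: "'a measure \<Rightarrow> ('a \<Rightarrow> real) \<Rightarrow> bool" where
  "finite_moments M Z \<longleftrightarrow> Z \<in> borel_measurable M \<and>
     (\<forall>n. even n \<longrightarrow> n \<noteq> 0 \<longrightarrow> (\<integral>\<^sup>+w. ennreal (Z w ^ n) \<partial>M) < \<infinity>)"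

definition moments_vanish :: "'a measure \<Rightarrow> ('i \<Rightarrow> 'a \<Rightarrow> real) \<Rightarrow> 'i filter \<Rightarrow> bool" where
  "moments_vanish M D F \<longleftrightarrow>
     (\<forall>n. even n \<longrightarrow> n \<noteq> 0 \<longrightarrow> ((\<lambda>i. \<integral>\<^sup>+w. ennreal (D i w ^ n) \<partial>M) \<longlongrightarrow> 0) F)"

lemma even_power_add_le:
  fixes a b :: real
  assumes "even n"
  shows "(a + b) ^ n \<le> 2 ^ n * a ^ n + 2 ^ n * b ^ n"
proof -
  have "\<bar>a + b\<bar> \<le> 2 * max \<bar>a\<bar> \<bar>b\<bar>" by linarith
  then have "\<bar>a + b\<bar> ^ n \<le> (2 * max \<bar>a\<bar> \<bar>b\<bar>) ^ n" by (rule power_mono) simp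
  also have "\<dots> \<le> 2 ^ n * (\<bar>a\<bar> ^ n + \<bar>b\<bar> ^ n)"
    by (cases "\<bar>a\<bar> \<le> \<bar>b\<bar>") (simp_all add: power_mult_distrib max_def)
  finally show ?thesis using assms by (simp add: power_even_abs distrib_left)
qed

lemma moment_add_le:
  assumes [measurable]: "f \<in> borel_measurable M" "g \<in> borel_measurable M" and "even n"
  shows "(\<integral>\<^sup>+w. ennreal ((f w + g w) ^ n) \<partial>M)
    \<le> ennreal (2 ^ n) * (\<integral>\<^sup>+w. ennreal (f w ^ n) \<partial>M) + ennreal (2 ^ n) * (\<integral>\<^sup>+w. ennreal (g w ^ n) \<partial>M)"
proof -
  have "(\<integral>\<^sup>+w. ennreal ((f w + g w) ^ n) \<partial>M) \<le> (\<integral>\<^sup>+w. ennreal (2 ^ n) * ennreal (f w ^ n) + ennreal (2 ^ n) * ennreal (g w ^ n) \<partial>M)"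
  proof (rule nn_integral_mono)
    fix w
    have "ennreal ((f w + g w) ^ n) \<le> ennreal (2 ^ n * f w ^ n + 2 ^ n * g w ^ n)"
      by (intro ennreal_leI even_power_add_le assms)
    also have "\<dots> = ennreal (2 ^ n) * ennreal (f w ^ n) + ennreal (2 ^ n) * ennreal (g w ^ n)"
      using assms(3) by (subst ennreal_plus) (auto simp: zero_le_even_power ennreal_mult)
    finally show "ennreal ((f w + g w) ^ n) \<le> ennreal (2 ^ n) * ennreal (f w ^ n) + ennreal (2 ^ n) * ennreal (g w ^ n)" .
  qed
  also have "\<dots> = ennreal (2 ^ n) * (\<integral>\<^sup>+w. ennreal (f w ^ n) \<partial>M) + ennreal (2 ^ n) * (\<integral>\<^sup>+w. ennreal (g w ^ n) \<partial>M)"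
    by (simp add: nn_integral_add nn_integral_cmult)
  finally show ?thesis .
qed

lemma moment_cmult:
  assumes [measurable]: "f \<in> borel_measurable M" and "even n"
  shows "(\<integral>\<^sup>+w. ennreal ((c * f w) ^ n) \<partial>M) = ennreal (c ^ n) * (\<integral>\<^sup>+w. ennreal (f w ^ n) \<partial>M)"
  using assms(2) by (subst nn_integral_cmult[symmetric])
    (auto simp: power_mult_distrib ennreal_mult zero_le_even_power)

lemma finite_moments_add:
  assumes "finite_moments M f" "finite_moments M g"
  shows "finite_moments M (\<lambda>w. f w + g w)"
  using assms unfolding finite_moments_def
  by (auto intro!: le_less_trans[OF moment_add_le] simp: ennreal_mult_less_top)

lemma finite_moments_cmult:
  assumes "finite_moments M f"
  shows "finite_moments M (\<lambda>w. c * f w)"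
  using assms unfolding finite_moments_def by (auto simp: moment_cmult ennreal_mult_less_top)

lemma finite_moments_sum:
  assumes "\<And>i. i \<in> I \<Longrightarrow> finite_moments M (f i)"
  shows "finite_moments M (\<lambda>w. \<Sum>i\<in>I. f i w)"
  using assms
proof (induction I rule: infinite_finite_induct)
  case (insert i I)
  then show ?case by (simp add: finite_moments_add)
qed (auto simp: finite_moments_def power_0_left)

text \<open>The first term dominates for \<open>x \<le> d\<close>, the second one for \<open>x \<ge> d\<close>. With small \<open>d\<close> this turns
  convergence in an even moment into convergence in \<open>L\<^sup>p\<close>.\<close>

lemma powr_le_even_power:
  fixes x p d :: real
  assumes "0 \<le> x" "1 \<le> p" "p \<le> real n" "0 < d" "d \<le> 1"
  shows "x powr p \<le> d + inverse d ^ n * x ^ n"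
proof (cases "x \<le> d")
  case True
  have "x powr p \<le> d powr p" using assms True by (intro powr_mono2) auto
  also have "\<dots> \<le> d powr 1" using assms by (intro powr_mono') auto
  finally have "x powr p \<le> d" using assms by simp
  moreover have "0 \<le> inverse d ^ n * x ^ n" using assms by simp
  ultimately show ?thesis by linarith
next
  case False
  define y where "y = x / d"
  have y: "y \<ge> 1" "x = d * y" using False assms by (auto simp: y_def)
  have "x powr p = d powr p * y powr p" using y assms by (simp add: powr_mult)
  also have "\<dots> \<le> 1 * y powr real n"
    using y assms by (intro mult_mono powr_mono powr_le1) auto
  also have "\<dots> = inverse d ^ n * x ^ n"
    using y(1) assms by (simp add: powr_realpow y_def power_divide field_simps)
  finally show ?thesis using assms by linarith
qed

lemma powr_moment_le:
  assumes "prob_space M" and [measurable]: "Y \<in> borel_measurable M"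
    and "1 \<le> p" "p \<le> real n" "even n" "0 < d" "d \<le> 1"
  shows "(\<integral>\<^sup>+w. ennreal (\<bar>Y w\<bar> powr p) \<partial>M) \<le> ennreal d + ennreal (inverse d ^ n) * (\<integral>\<^sup>+w. ennreal (Y w ^ n) \<partial>M)"
proof -
  interpret prob_space M by fact
  have "(\<integral>\<^sup>+w. ennreal (\<bar>Y w\<bar> powr p) \<partial>M) \<le> (\<integral>\<^sup>+w. ennreal d + ennreal (inverse d ^ n) * ennreal (Y w ^ n) \<partial>M)"
  proof (rule nn_integral_mono)
    fix w
    have "\<bar>Y w\<bar> powr p \<le> d + inverse d ^ n * Y w ^ n"
      using powr_le_even_power[OF abs_ge_zero[of "Y w"] assms(3,4,6,7)] assms(5) by (simp add: power_even_abs)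
    then have "ennreal (\<bar>Y w\<bar> powr p) \<le> ennreal (d + inverse d ^ n * Y w ^ n)"
      by (rule ennreal_leI)
    also have "\<dots> = ennreal d + ennreal (inverse d ^ n) * ennreal (Y w ^ n)"
      using assms(5,6) by (subst ennreal_plus) (auto simp: zero_le_even_power ennreal_mult)
    finally show "ennreal (\<bar>Y w\<bar> powr p) \<le> ennreal d + ennreal (inverse d ^ n) * ennreal (Y w ^ n)" .
  qed
  also have "\<dots> = ennreal d + ennreal (inverse d ^ n) * (\<integral>\<^sup>+w. ennreal (Y w ^ n) \<partial>M)"
    by (simp add: nn_integral_add nn_integral_cmult emeasure_space_1)
  finally show ?thesis .
qed

lemma powr_moment_small:
  assumes "prob_space M" "Y \<in> borel_measurable M" "1 \<le> p" "p \<le> real n" "even n" "0 < d" "d \<le> 1" "0 \<le> e"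
    and le: "(\<integral>\<^sup>+w. ennreal (Y w ^ n) \<partial>M) \<le> ennreal (d ^ n * e)"
  shows "(LINT w|M. \<bar>Y w\<bar> powr p) \<le> d + e"
proof -
  have "ennreal (LINT w|M. \<bar>Y w\<bar> powr p) \<le> ennreal (norm (LINT w|M. \<bar>Y w\<bar> powr p))"
    by (intro ennreal_leI) simp
  also have "\<dots> \<le> (\<integral>\<^sup>+w. ennreal (\<bar>Y w\<bar> powr p) \<partial>M)"
    using norm_integral_le_nn_integral[of M "\<lambda>w. \<bar>Y w\<bar> powr p"] by simp
  also have "\<dots> \<le> ennreal d + ennreal (inverse d ^ n) * (\<integral>\<^sup>+w. ennreal (Y w ^ n) \<partial>M)"
    by (rule powr_moment_le[OF assms(1-7)])
  also have "\<dots> \<le> ennreal d + ennreal (inverse d ^ n) * ennreal (d ^ n * e)"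
    by (intro add_left_mono mult_left_mono le) simp
  also have "\<dots> = ennreal (d + e)"
    using assms(6,8) by (simp add: ennreal_mult[symmetric] power_inverse ennreal_plus[symmetric] del: ennreal_plus)
  finally show ?thesis
    using assms(6,8) by (subst (asm) ennreal_le_iff) auto
qed

lemma Lp_of_finite_moments:
  assumes "prob_space M" "finite_moments M Z" "p \<ge> 1"
  shows "Z \<in> Lp_space M p"
proof -
  interpret prob_space M by fact
  have [measurable]: "Z \<in> borel_measurable M" using assms(2) by (simp add: finite_moments_def)
  define n where "n = 2 * nat \<lceil>p\<rceil>"
  have n: "even n" "p \<le> real n" "n \<noteq> 0" using assms(3) by (auto simp: n_def) linarith+
  have "(\<integral>\<^sup>+w. ennreal (\<bar>Z w\<bar> powr p) \<partial>M) \<le> ennreal 1 + ennreal (inverse 1 ^ n) * (\<integral>\<^sup>+w. ennreal (Z w ^ n) \<partial>M)"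
    by (rule powr_moment_le[OF assms(1) _ assms(3) n(2,1)]) auto
  also have "\<dots> < \<infinity>"
    using assms(2) n unfolding finite_moments_def by auto
  finally show ?thesis
    unfolding Lp_space_def by (auto intro!: integrableI_bounded)
qed

lemma Lp_converges_of_moments:
  assumes "prob_space M" "finite_moments M Z" "\<forall>\<^sub>F i in F. finite_moments M (Y i)"
    and van: "moments_vanish M (\<lambda>i w. Y i w - Z w) F" and "p \<ge> 1"
  shows "Lp_converges M p Y Z F"
  unfolding Lp_converges_def
proof (intro conjI)
  interpret prob_space M by fact
  show "Z \<in> Lp_space M p" by (rule Lp_of_finite_moments) fact+
  show "\<forall>\<^sub>F i in F. Y i \<in> Lp_space M p"
    using assms(3) by (rule eventually_mono) (rule Lp_of_finite_moments[OF assms(1) _ assms(5)])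
  define n where "n = 2 * nat \<lceil>p\<rceil>"
  have n: "even n" "p \<le> real n" "n \<noteq> 0" using assms(5) by (auto simp: n_def) linarith+
  show "((\<lambda>i. LINT w|M. \<bar>Y i w - Z w\<bar> powr p) \<longlongrightarrow> 0) F"
  proof (rule tendstoI)
    fix e :: real assume "e > 0"
    define d where "d = min 1 (e / 3)"
    have d: "0 < d" "d \<le> 1" "d \<le> e / 3" using \<open>e > 0\<close> by (auto simp: d_def)
    have "\<forall>\<^sub>F i in F. (\<integral>\<^sup>+w. ennreal ((Y i w - Z w) ^ n) \<partial>M) < ennreal (d ^ n * (e / 3))"
      using van n d \<open>e > 0\<close> unfolding moments_vanish_def
      by (intro order_tendstoD(2)[of _ 0]) auto
    with assms(3) show "\<forall>\<^sub>F i in F. dist (LINT w|M. \<bar>Y i w - Z w\<bar> powr p) 0 < e"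
    proof eventually_elim
      case (elim i)
      have [measurable]: "Y i \<in> borel_measurable M" "Z \<in> borel_measurable M"
        using elim(1) assms(2) by (auto simp: finite_moments_def)
      have "(LINT w|M. \<bar>Y i w - Z w\<bar> powr p) \<le> d + e / 3"
        using less_imp_le[OF elim(2)] \<open>e > 0\<close>
        by (intro powr_moment_small[OF assms(1) _ assms(5) n(2,1) d(1,2)]) auto
      moreover have "0 \<le> (LINT w|M. \<bar>Y i w - Z w\<bar> powr p)" by (intro integral_nonneg_AE) auto
      ultimately show ?case using d \<open>e > 0\<close> by simp
    qed
  qed
qed

lemma Lp_integral_eq_moment:
  assumes "Z \<in> Lp_space M (real n)" "even n" "n \<noteq> 0"
  shows "(\<integral>\<^sup>+w. ennreal (Z w ^ n) \<partial>M) = ennreal (LINT w|M. \<bar>Z w\<bar> powr real n)"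
proof -
  have "\<bar>Z w\<bar> powr real n = Z w ^ n" for w
    using assms(2,3) by (cases "Z w = 0") (simp_all add: powr_realpow power_even_abs)
  then show ?thesis
    using assms unfolding Lp_space_def
    by (subst nn_integral_eq_integral) (auto simp: zero_le_even_power)
qed

lemma Lp_space_diff:
  assumes "Y \<in> Lp_space M (real n)" "Z \<in> Lp_space M (real n)" "even n" "n \<noteq> 0"
  shows "(\<lambda>w. Y w - Z w) \<in> Lp_space M (real n)"
proof -
  have m [measurable]: "Y \<in> borel_measurable M" "Z \<in> borel_measurable M" using assms by (auto simp: Lp_space_def)
  have e: "\<bar>W w\<bar> powr real n = W w ^ n" for w and W :: "'a \<Rightarrow> real"
    using assms(3,4) by (cases "W w = 0") (simp_all add: powr_realpow power_even_abs)
  have "(\<integral>\<^sup>+w. ennreal ((Y w + (- 1) * Z w) ^ n) \<partial>M) < \<infinity>"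
    using Lp_integral_eq_moment[OF assms(1,3,4)] Lp_integral_eq_moment[OF assms(2,3,4)] assms(3)
    by (intro le_less_trans[OF moment_add_le]) (auto simp: ennreal_mult_less_top)
  then show ?thesis
    unfolding Lp_space_def e using assms(3) by (auto intro!: integrableI_bounded simp: zero_le_even_power)
qed

lemma moments_of_Lp_converges:
  assumes "\<And>p. p \<ge> 1 \<Longrightarrow> Lp_converges M p Y Z F"
  shows "finite_moments M Z" and "moments_vanish M (\<lambda>i w. Y i w - Z w) F"
proof -
  have Lp: "Lp_converges M (real n) Y Z F" if "n \<noteq> 0" for n
    using assms[of "real n"] that by simp
  then have Z: "Z \<in> Lp_space M (real n)" if "n \<noteq> 0" for n
    using that by (auto simp: Lp_converges_def)
  show "finite_moments M Z"
    unfolding finite_moments_def using Z[of 1] by (auto simp: Lp_integral_eq_moment[OF Z] Lp_space_def)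
  show "moments_vanish M (\<lambda>i w. Y i w - Z w) F"
    unfolding moments_vanish_def
  proof (intro allI impI)
    fix n :: nat assume n: "even n" "n \<noteq> 0"
    have "((\<lambda>i. ennreal (LINT w|M. \<bar>Y i w - Z w\<bar> powr real n)) \<longlongrightarrow> ennreal 0) F"
      using Lp[OF n(2)] by (intro tendsto_ennrealI) (auto simp: Lp_converges_def)
    moreover have "\<forall>\<^sub>F i in F. ennreal (LINT w|M. \<bar>Y i w - Z w\<bar> powr real n) = (\<integral>\<^sup>+w. ennreal ((Y i w - Z w) ^ n) \<partial>M)"
    proof -
      have "\<forall>\<^sub>F i in F. Y i \<in> Lp_space M (real n)" using Lp[OF n(2)] by (simp add: Lp_converges_def)
      then show ?thesis
        by (rule eventually_mono)
          (simp add: Lp_integral_eq_moment[OF Lp_space_diff[OF _ Z[OF n(2)] n] n])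
    qed
    ultimately show "((\<lambda>i. \<integral>\<^sup>+w. ennreal ((Y i w - Z w) ^ n) \<partial>M) \<longlongrightarrow> 0) F"
      by (auto elim: Lim_transform_eventually)
  qed
qed

lemma moment_fatou:
  fixes D :: "nat \<Rightarrow> 'a \<Rightarrow> real"
  assumes [measurable]: "\<And>k. D k \<in> borel_measurable M"
    and lim: "AE w in M. (\<lambda>k. D k w) \<longlonglongrightarrow> Z w"
    and "even n" and le: "\<forall>\<^sub>F k in sequentially. (\<integral>\<^sup>+w. ennreal (D k w ^ n) \<partial>M) \<le> B"
  shows "(\<integral>\<^sup>+w. ennreal (Z w ^ n) \<partial>M) \<le> B"
proof -
  have "(\<integral>\<^sup>+w. ennreal (Z w ^ n) \<partial>M) \<le> (\<integral>\<^sup>+w. liminf (\<lambda>k. ennreal (D k w ^ n)) \<partial>M)"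
  proof (rule nn_integral_mono_AE, use lim in eventually_elim)
    case (elim w)
    then have "(\<lambda>k. ennreal (D k w ^ n)) \<longlonglongrightarrow> ennreal (Z w ^ n)"
      by (intro tendsto_ennrealI tendsto_power)
    then show ?case by (simp add: lim_imp_Liminf)
  qed
  also have "\<dots> \<le> liminf (\<lambda>k. \<integral>\<^sup>+w. ennreal (D k w ^ n) \<partial>M)"
    by (rule nn_integral_liminf) measurable
  also have "\<dots> \<le> liminf (\<lambda>k::nat. B)"
    by (rule Liminf_mono[OF le])
  also have "\<dots> = B" by (simp add: Liminf_const)
  finally show ?thesis .
qed

text \<open>Along a sequence the family is Cauchy in \<open>L\<^sup>1\<close>, so a subsequence converges almost surely to some
  \<open>Z\<close>. Fatou's lemma then bounds the distance of \<open>Y \<epsilon>\<close> to \<open>Z\<close> in each even moment by its distance to the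
  members of the sequence.\<close>

lemma moment_cauchy_limit:
  fixes Y :: "real \<Rightarrow> 'a \<Rightarrow> real"
  assumes "prob_space M" and fin: "\<And>\<epsilon>. \<epsilon> > 0 \<Longrightarrow> finite_moments M (Y \<epsilon>)"
    and cauchy: "\<And>n \<eta>. \<lbrakk>even n; n \<noteq> 0; \<eta> > 0\<rbrakk> \<Longrightarrow> \<exists>\<delta>>0. \<forall>\<epsilon> \<epsilon>'. 0 < \<epsilon> \<and> \<epsilon> < \<delta> \<and> 0 < \<epsilon>' \<and> \<epsilon>' < \<delta> \<longrightarrow>
        (\<integral>\<^sup>+w. ennreal ((Y \<epsilon> w - Y \<epsilon>' w) ^ n) \<partial>M) \<le> ennreal \<eta>"
  shows "\<exists>Z. finite_moments M Z \<and> moments_vanish M (\<lambda>\<epsilon> w. Y \<epsilon> w - Z w) (at_right 0)"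
proof -
  interpret prob_space M by fact
  define e where "e k = inverse (real (Suc k))" for k
  have e: "e k > 0" "e \<longlonglongrightarrow> 0" for k
    using LIMSEQ_inverse_real_of_nat by (auto simp: e_def[abs_def])
  have Ym [measurable]: "Y (e k) \<in> borel_measurable M" for k using fin[OF e(1)] by (simp add: finite_moments_def)
  have int: "integrable M (Y (e k))" for k
    using Lp_of_finite_moments[OF assms(1) fin[OF e(1)], of 1 k] unfolding Lp_space_def
    by (auto intro: integrable_abs_cancel)
  have L1: "\<exists>N. \<forall>i\<ge>N. \<forall>j\<ge>N. (LINT w|M. norm (Y (e i) w - Y (e j) w)) < \<eta>" if "\<eta> > 0" for \<eta>
  proof -
    define d where "d = min 1 (\<eta> / 3)"
    have d: "0 < d" "d \<le> 1" "d \<le> \<eta> / 3" using that by (auto simp: d_def)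
    obtain \<delta> where \<delta>: "\<delta> > 0" "\<And>\<epsilon> \<epsilon>'. \<lbrakk>0 < \<epsilon>; \<epsilon> < \<delta>; 0 < \<epsilon>'; \<epsilon>' < \<delta>\<rbrakk> \<Longrightarrow>
        (\<integral>\<^sup>+w. ennreal ((Y \<epsilon> w - Y \<epsilon>' w) ^ 2) \<partial>M) \<le> ennreal (d\<^sup>2 * (\<eta> / 3))"
      using cauchy[of 2 "d\<^sup>2 * (\<eta> / 3)"] d that by auto
    obtain N where N: "\<And>k. k \<ge> N \<Longrightarrow> e k < \<delta>"
      using order_tendstoD(2)[OF e(2) \<delta>(1)] by (auto simp: eventually_sequentially)
    have "(LINT w|M. norm (Y (e i) w - Y (e j) w)) < \<eta>" if ij: "i \<ge> N" "j \<ge> N" for i j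
    proof -
      have "(LINT w|M. \<bar>Y (e i) w - Y (e j) w\<bar> powr 1) \<le> d + \<eta> / 3"
        using \<delta>(2)[of "e i" "e j"] N ij e \<open>\<eta> > 0\<close> d
        by (intro powr_moment_small[where n = 2] assms(1)) auto
      then have "(LINT w|M. norm (Y (e i) w - Y (e j) w)) \<le> d + \<eta> / 3" by simp
      then show ?thesis using d \<open>\<eta> > 0\<close> by linarith
    qed
    then show ?thesis by blast
  qed
  obtain r where r: "strict_mono r" "AE w in M. Cauchy (\<lambda>k. Y (e (r k)) w)"
    using cauchy_L1_AE_cauchy_subseq[OF int L1] by blast
  define Z where "Z w = lim (\<lambda>k. Y (e (r k)) w)" for w
  have [measurable]: "Z \<in> borel_measurable M"
    unfolding Z_def[abs_def] by (rule borel_measurable_lim_metric) simp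
  have Z: "AE w in M. (\<lambda>k. Y (e (r k)) w) \<longlonglongrightarrow> Z w"
    using r(2) by eventually_elim (simp add: Z_def Cauchy_convergent convergent_LIMSEQ_iff[symmetric])
  have er: "(\<lambda>k. e (r k)) \<longlonglongrightarrow> 0"
    using LIMSEQ_subseq_LIMSEQ[OF e(2) r(1)] by (simp add: comp_def)
  have close: "(\<integral>\<^sup>+w. ennreal ((Y \<epsilon> w - Z w) ^ n) \<partial>M) \<le> ennreal \<eta>"
    if n: "even n" and \<epsilon>: "0 < \<epsilon>" "\<epsilon> < \<delta>" and \<delta>: "\<forall>\<epsilon> \<epsilon>'. 0 < \<epsilon> \<and> \<epsilon> < \<delta> \<and> 0 < \<epsilon>' \<and> \<epsilon>' < \<delta> \<longrightarrow>
        (\<integral>\<^sup>+w. ennreal ((Y \<epsilon> w - Y \<epsilon>' w) ^ n) \<partial>M) \<le> ennreal \<eta>" for n \<epsilon> \<delta> \<eta>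
  proof (rule moment_fatou[where D = "\<lambda>k w. Y \<epsilon> w - Y (e (r k)) w"])
    have [measurable]: "Y \<epsilon> \<in> borel_measurable M" using fin[OF \<epsilon>(1)] by (simp add: finite_moments_def)
    show "(\<lambda>w. Y \<epsilon> w - Y (e (r k)) w) \<in> borel_measurable M" for k by measurable
    show "AE w in M. (\<lambda>k. Y \<epsilon> w - Y (e (r k)) w) \<longlonglongrightarrow> Y \<epsilon> w - Z w"
      using Z by eventually_elim (intro tendsto_intros)
    have "0 < \<delta>" using \<epsilon> by linarith
    from order_tendstoD(2)[OF er this]
    show "\<forall>\<^sub>F k in sequentially. (\<integral>\<^sup>+w. ennreal ((Y \<epsilon> w - Y (e (r k)) w) ^ n) \<partial>M) \<le> ennreal \<eta>"
      by eventually_elim (use \<delta> \<epsilon> e(1) in auto)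
  qed fact
  have van: "moments_vanish M (\<lambda>\<epsilon> w. Y \<epsilon> w - Z w) (at_right 0)"
    unfolding moments_vanish_def
  proof (intro allI impI)
    fix n :: nat assume n: "even n" "n \<noteq> 0"
    show "((\<lambda>\<epsilon>. \<integral>\<^sup>+w. ennreal ((Y \<epsilon> w - Z w) ^ n) \<partial>M) \<longlongrightarrow> 0) (at_right 0)"
    proof (rule order_tendstoI)
      fix a :: ennreal assume "0 < a"
      then obtain \<eta> where \<eta>: "0 < ennreal \<eta>" "ennreal \<eta> < a"
        by (metis dense ennreal_cases less_top_ennreal not_less_iff_gr_or_eq top_greatest leD)
      then have "\<eta> > 0" by (simp add: ennreal_less_zero_iff)
      from cauchy[OF n this] obtain \<delta> where \<delta>: "\<delta> > 0" "\<forall>\<epsilon> \<epsilon>'. 0 < \<epsilon> \<and> \<epsilon> < \<delta> \<and> 0 < \<epsilon>' \<and> \<epsilon>' < \<delta> \<longrightarrow>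
        (\<integral>\<^sup>+w. ennreal ((Y \<epsilon> w - Y \<epsilon>' w) ^ n) \<partial>M) \<le> ennreal \<eta>" by blast
      show "\<forall>\<^sub>F \<epsilon> in at_right 0. (\<integral>\<^sup>+w. ennreal ((Y \<epsilon> w - Z w) ^ n) \<partial>M) < a"
        unfolding eventually_at_right_field
        using close[OF n(1) _ _ \<delta>(2)] \<delta>(1) \<eta>(2) by (intro exI[of _ \<delta>]) (auto intro: le_less_trans)
    qed simp
  qed
  have "finite_moments M Z"
  proof (unfold finite_moments_def, intro conjI allI impI)
    fix n :: nat assume n: "even n" "n \<noteq> 0"
    from cauchy[OF n, of 1] obtain \<delta> where \<delta>: "\<delta> > 0" "\<forall>\<epsilon> \<epsilon>'. 0 < \<epsilon> \<and> \<epsilon> < \<delta> \<and> 0 < \<epsilon>' \<and> \<epsilon>' < \<delta> \<longrightarrow>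
        (\<integral>\<^sup>+w. ennreal ((Y \<epsilon> w - Y \<epsilon>' w) ^ n) \<partial>M) \<le> ennreal 1" by auto
    define \<epsilon> where "\<epsilon> = \<delta> / 2"
    have \<epsilon>: "0 < \<epsilon>" "\<epsilon> < \<delta>" using \<delta>(1) by (auto simp: \<epsilon>_def)
    have Y: "Y \<epsilon> \<in> borel_measurable M" "(\<integral>\<^sup>+w. ennreal (Y \<epsilon> w ^ n) \<partial>M) < \<infinity>"
      using fin[OF \<epsilon>(1)] n by (auto simp: finite_moments_def)
    note Y(1) [measurable]
    have "(\<integral>\<^sup>+w. ennreal ((Y \<epsilon> w + (- 1) * (Y \<epsilon> w - Z w)) ^ n) \<partial>M) < \<infinity>"
    proof (rule le_less_trans[OF moment_add_le[OF _ _ n(1)]])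
      have "(\<integral>\<^sup>+w. ennreal ((- 1 * (Y \<epsilon> w - Z w)) ^ n) \<partial>M) \<le> ennreal 1"
        using close[OF n(1) \<epsilon> \<delta>(2)] n(1) by (subst moment_cmult) auto
      then have "(\<integral>\<^sup>+w. ennreal ((- 1 * (Y \<epsilon> w - Z w)) ^ n) \<partial>M) < \<infinity>" by (rule le_less_trans) simp
      then show "ennreal (2 ^ n) * (\<integral>\<^sup>+w. ennreal (Y \<epsilon> w ^ n) \<partial>M) +
        ennreal (2 ^ n) * (\<integral>\<^sup>+w. ennreal ((- 1 * (Y \<epsilon> w - Z w)) ^ n) \<partial>M) < \<infinity>"
        using Y(2) by (simp add: ennreal_mult_less_top)
    qed measurable
    then show "(\<integral>\<^sup>+w. ennreal (Z w ^ n) \<partial>M) < \<infinity>" by simp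
  qed measurable
  with van show ?thesis by blast
qed

lemma Lp_lim_moments:
  fixes Y :: "real \<Rightarrow> 'a \<Rightarrow> real"
  assumes "prob_space M" and fin: "\<And>\<epsilon>. \<epsilon> > 0 \<Longrightarrow> finite_moments M (Y \<epsilon>)"
    and cauchy: "\<And>n \<eta>. \<lbrakk>even n; n \<noteq> 0; \<eta> > 0\<rbrakk> \<Longrightarrow> \<exists>\<delta>>0. \<forall>\<epsilon> \<epsilon>'. 0 < \<epsilon> \<and> \<epsilon> < \<delta> \<and> 0 < \<epsilon>' \<and> \<epsilon>' < \<delta> \<longrightarrow>
        (\<integral>\<^sup>+w. ennreal ((Y \<epsilon> w - Y \<epsilon>' w) ^ n) \<partial>M) \<le> ennreal \<eta>"
  shows "finite_moments M (Lp_lim M Y (at_right 0))"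
    and "moments_vanish M (\<lambda>\<epsilon> w. Y \<epsilon> w - Lp_lim M Y (at_right 0) w) (at_right 0)"
proof -
  obtain Z where Z: "finite_moments M Z" "moments_vanish M (\<lambda>\<epsilon> w. Y \<epsilon> w - Z w) (at_right 0)"
    using moment_cauchy_limit[OF assms] by blast
  have "\<forall>\<^sub>F \<epsilon> in at_right 0. finite_moments M (Y \<epsilon>)"
    unfolding eventually_at_right_field using fin by (intro exI[of _ 1]) auto
  then have "\<forall>p\<ge>1. Lp_converges M p Y Z (at_right 0)"
    using Lp_converges_of_moments[OF assms(1) Z(1) _ Z(2)] by blast
  then have "\<forall>p\<ge>1. Lp_converges M p Y (Lp_lim M Y (at_right 0)) (at_right 0)"
    unfolding Lp_lim_def by (rule someI[where P = "\<lambda>Z. \<forall>p\<ge>1. Lp_converges M p Y Z (at_right 0)"])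
  then show "finite_moments M (Lp_lim M Y (at_right 0))"
    and "moments_vanish M (\<lambda>\<epsilon> w. Y \<epsilon> w - Lp_lim M Y (at_right 0) w) (at_right 0)"
    using moments_of_Lp_converges[of M Y "Lp_lim M Y (at_right 0)" "at_right 0"] by blast+
qed

section \<open>Differentiation under the Fourier integral\<close>

text \<open>The Taylor estimate for the exponential bounds the increment minus its linear part by a
  multiple of the square of the step; letting the step tend to zero in the imaginary part also shows
  that the derivative is real.\<close>

lemma partial_deriv_fourier:
  fixes b :: "real ^ 'd::finite \<Rightarrow> complex" and q :: "real ^ 'd \<Rightarrow> real"
  assumes b [measurable]: "b \<in> borel_measurable borel"
    and int: "integrable lborel (\<lambda>\<xi>. (1 + norm \<xi>) ^ 2 * norm (b \<xi>))"
    and q: "\<And>z. complex_of_real (q z) = (LINT \<xi>|lborel. b \<xi> * iexp (\<xi> \<bullet> (x - z)))"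
  shows "complex_of_real (partial_deriv i q z) = (LINT \<xi>|lborel. (- \<i> * complex_of_real (\<xi> $ i)) * b \<xi> * iexp (\<xi> \<bullet> (x - z)))"
proof -
  have bnd: "integrable lborel f" if [measurable]: "f \<in> borel_measurable borel"
    and le: "\<And>\<xi>. norm (f \<xi>) \<le> (1 + norm \<xi>) ^ 2 * norm (b \<xi>)" for f :: "real ^ 'd \<Rightarrow> complex"
    by (rule Bochner_Integration.integrable_bound[OF int]) (use le in \<open>auto intro!: always_eventually\<close>)
  have sq1: "1 \<le> (1 + norm \<xi>) ^ 2" "norm \<xi> \<le> (1 + norm \<xi>) ^ 2" "(norm \<xi>)\<^sup>2 \<le> (1 + norm \<xi>) ^ 2" for \<xi> :: "real ^ 'd"
    using norm_ge_zero[of \<xi>] by (auto simp: power2_sum add_increasing add_increasing2 intro: power_mono)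
  have i0: "integrable lborel (\<lambda>\<xi>. b \<xi> * iexp (\<xi> \<bullet> (x - z')))" for z'
    using mult_right_mono[OF sq1(1) norm_ge_zero] by (intro bnd) (auto simp: norm_mult)
  have i1: "integrable lborel (\<lambda>\<xi>. (- \<i> * complex_of_real (\<xi> $ i)) * b \<xi> * iexp (\<xi> \<bullet> (x - z)))"
  proof (intro bnd)
    fix \<xi> :: "real ^ 'd"
    have "\<bar>\<xi> $ i\<bar> \<le> (1 + norm \<xi>) ^ 2" using component_le_norm_cart[of \<xi> i] sq1(2)[of \<xi>] by linarith
    then show "norm ((- \<i> * complex_of_real (\<xi> $ i)) * b \<xi> * iexp (\<xi> \<bullet> (x - z))) \<le> (1 + norm \<xi>) ^ 2 * norm (b \<xi>)"
      by (simp add: norm_mult mult_right_mono)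
  qed measurable
  define D where "D = (LINT \<xi>|lborel. (- \<i> * complex_of_real (\<xi> $ i)) * b \<xi> * iexp (\<xi> \<bullet> (x - z)))"
  define K where "K = (LINT \<xi>|lborel. (1 + norm \<xi>) ^ 2 * norm (b \<xi>))"
  define \<phi> where "\<phi> u = q (z + u *\<^sub>R axis i 1)" for u
  have quad: "norm (complex_of_real (\<phi> u) - complex_of_real (\<phi> 0) - complex_of_real u * D) \<le> K * u\<^sup>2" for u
  proof -
    let ?R = "\<lambda>\<xi>. b \<xi> * iexp (\<xi> \<bullet> (x - z)) * (iexp (- (u * \<xi> $ i)) - (\<Sum>k\<le>1. (\<i> * complex_of_real (- (u * \<xi> $ i))) ^ k / fact k))"
    have "complex_of_real (\<phi> u) - complex_of_real (\<phi> 0) - complex_of_real u * D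
      = (LINT \<xi>|lborel. b \<xi> * iexp (\<xi> \<bullet> (x - (z + u *\<^sub>R axis i 1))) - b \<xi> * iexp (\<xi> \<bullet> (x - z))
          - complex_of_real u * ((- \<i> * complex_of_real (\<xi> $ i)) * b \<xi> * iexp (\<xi> \<bullet> (x - z))))"
      unfolding \<phi>_def q D_def using i0 i1
      by (simp only: integral_mult_right_zero[symmetric] scaleR_zero_left add_0_right Bochner_Integration.integral_diff Bochner_Integration.integrable_diff integrable_mult_right)
    also have "\<dots> = (LINT \<xi>|lborel. ?R \<xi>)"
    proof (intro Bochner_Integration.integral_cong refl)
      fix \<xi> :: "real ^ 'd"
      have "\<xi> \<bullet> (x - (z + u *\<^sub>R axis i 1)) = \<xi> \<bullet> (x - z) + - (u * \<xi> $ i)"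
        by (simp add: inner_diff_right inner_add_right inner_axis)
      then have "iexp (\<xi> \<bullet> (x - (z + u *\<^sub>R axis i 1))) = iexp (\<xi> \<bullet> (x - z)) * iexp (- (u * \<xi> $ i))"
        by (simp only: of_real_add distrib_left exp_add)
      then show "b \<xi> * iexp (\<xi> \<bullet> (x - (z + u *\<^sub>R axis i 1))) - b \<xi> * iexp (\<xi> \<bullet> (x - z))
          - complex_of_real u * ((- \<i> * complex_of_real (\<xi> $ i)) * b \<xi> * iexp (\<xi> \<bullet> (x - z))) = ?R \<xi>"
        by (simp add: algebra_simps)
    qed
    finally have R: "complex_of_real (\<phi> u) - complex_of_real (\<phi> 0) - complex_of_real u * D = (LINT \<xi>|lborel. ?R \<xi>)" .
    have "norm (complex_of_real (\<phi> u) - complex_of_real (\<phi> 0) - complex_of_real u * D) \<le> (LINT \<xi>|lborel. norm (?R \<xi>))"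
      unfolding R by (rule integral_norm_bound)
    also have "\<dots> \<le> (LINT \<xi>|lborel. u\<^sup>2 * ((1 + norm \<xi>) ^ 2 * norm (b \<xi>)))"
    proof (rule Bochner_Integration.integral_mono')
      show "integrable lborel (\<lambda>\<xi>. u\<^sup>2 * ((1 + norm \<xi>) ^ 2 * norm (b \<xi>)))" using int by simp
      fix \<xi> :: "real ^ 'd"
      have "norm (iexp (- (u * \<xi> $ i)) - (\<Sum>k\<le>1. (\<i> * complex_of_real (- (u * \<xi> $ i))) ^ k / fact k)) \<le> \<bar>- (u * \<xi> $ i)\<bar> ^ Suc 1 / fact (Suc 1)"
        by (rule iexp_approx1)
      also have "\<dots> \<le> \<bar>- (u * \<xi> $ i)\<bar> ^ 2"
        using zero_le_power2[of "u * \<xi> $ i"] by (simp add: numeral_2_eq_2[symmetric] fact_numeral del: zero_le_power2)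
      also have "\<dots> = u\<^sup>2 * (\<xi> $ i)\<^sup>2" by (simp add: power_mult_distrib)
      also have "\<dots> \<le> u\<^sup>2 * (1 + norm \<xi>) ^ 2"
      proof (rule mult_left_mono)
        have "(\<xi> $ i)\<^sup>2 \<le> (norm \<xi>)\<^sup>2" using component_le_norm_cart[of \<xi> i] by (metis abs_le_square_iff abs_norm_cancel)
        then show "(\<xi> $ i)\<^sup>2 \<le> (1 + norm \<xi>) ^ 2" using sq1(3)[of \<xi>] by linarith
      qed simp
      finally have "norm (b \<xi>) * norm (iexp (- (u * \<xi> $ i)) - (\<Sum>k\<le>1. (\<i> * complex_of_real (- (u * \<xi> $ i))) ^ k / fact k))
        \<le> norm (b \<xi>) * (u\<^sup>2 * (1 + norm \<xi>) ^ 2)" by (rule mult_left_mono) simp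
      then show "norm (?R \<xi>) \<le> u\<^sup>2 * ((1 + norm \<xi>) ^ 2 * norm (b \<xi>))"
        unfolding norm_mult norm_exp_i_times by (simp only: mult_1_right mult_ac)
    qed simp
    also have "\<dots> = K * u\<^sup>2" by (simp add: K_def)
    finally show ?thesis .
  qed
  have Im0: "Im D = 0"
  proof (rule ccontr)
    assume nz: "Im D \<noteq> 0"
    have le: "\<bar>u\<bar> * \<bar>Im D\<bar> \<le> K * u\<^sup>2" for u
      using order_trans[OF abs_Im_le_cmod quad[of u]] by (simp add: abs_mult)
    have "K \<ge> 0" using order_trans[OF norm_ge_zero quad[of 1]] by simp
    define u where "u = \<bar>Im D\<bar> / (2 * (K + 1))"
    have u: "u > 0" using nz \<open>K \<ge> 0\<close> by (simp add: u_def)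
    have "u * \<bar>Im D\<bar> \<le> u * (K * u)" using le[of u] u by (simp add: power2_eq_square mult_ac)
    then have "\<bar>Im D\<bar> \<le> K * u" using u by simp
    also have "\<dots> \<le> (K + 1) * u" using u by (simp add: distrib_right)
    also have "\<dots> = \<bar>Im D\<bar> / 2" using \<open>K \<ge> 0\<close> by (simp add: u_def field_simps)
    finally show False using nz by simp
  qed
  have "(\<phi> has_real_derivative Re D) (at 0)"
    unfolding has_field_derivative_def has_derivative_iff_norm
  proof (intro conjI bounded_linear_mult_right)
    show "((\<lambda>u. norm (\<phi> u - \<phi> 0 - Re D * (u - 0)) / norm (u - 0)) \<longlongrightarrow> 0) (at 0)"
    proof (rule Lim_null_comparison)
      show "\<forall>\<^sub>F u in at 0. norm (norm (\<phi> u - \<phi> 0 - Re D * (u - 0)) / norm (u - 0)) \<le> K * \<bar>u\<bar>"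
      proof (rule eventually_at_topological[THEN iffD2], intro exI[of _ UNIV], simp, intro allI impI)
        fix u :: real assume u: "u \<noteq> 0"
        have "\<bar>\<phi> u - \<phi> 0 - Re D * u\<bar> \<le> K * u\<^sup>2"
          using order_trans[OF abs_Re_le_cmod quad[of u]] by (simp add: mult.commute)
        then show "\<bar>\<phi> u - \<phi> 0 - Re D * u\<bar> / \<bar>u\<bar> \<le> K * \<bar>u\<bar>"
          using u by (simp add: divide_le_eq mult.assoc power2_eq_square[symmetric] abs_mult[symmetric])
      qed
      show "((\<lambda>u. K * \<bar>u\<bar>) \<longlongrightarrow> 0) (at 0)"
        by (rule tendsto_eq_intros refl | simp)+
    qed
  qed
  then have "partial_deriv i q z = Re D"
    unfolding partial_deriv_def \<phi>_def[symmetric] by (rule DERIV_imp_deriv)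
  then show ?thesis
    unfolding D_def[symmetric] using Im0 by (simp add: complex_eq_iff)
qed

section \<open>Mollified Fourier multipliers\<close>

text \<open>The functions \<open>g \<epsilon>\<close> approximate the distribution with multiplier \<open>m\<close>, which need not be a
  function: for the local time it is the Dirac measure at \<open>y\<close>.\<close>

definition mollified :: "(real ^ 'd::finite \<Rightarrow> complex) \<Rightarrow> (real \<Rightarrow> real ^ 'd \<Rightarrow> real) \<Rightarrow> bool" where
  "mollified m g \<longleftrightarrow> (\<forall>\<epsilon>>0. fourier_of (\<lambda>\<xi>. complex_of_real (heat_multiplier \<epsilon> \<xi>) * m \<xi>) (g \<epsilon>))"

lemma mollified_integrable:
  fixes m :: "real ^ 'd::finite \<Rightarrow> complex"
  assumes [measurable]: "m \<in> borel_measurable borel" and m: "\<And>\<xi>. norm (m \<xi>) \<le> C * (1 + norm \<xi>) ^ k" and "\<epsilon> > 0"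
  shows "integrable lborel (\<lambda>\<xi>. (1 + norm \<xi>) ^ j * norm (complex_of_real (heat_multiplier \<epsilon> \<xi>) * m \<xi>))"
    and "integrable lborel (\<lambda>\<xi>. complex_of_real (heat_multiplier \<epsilon> \<xi>) * m \<xi>)"
proof -
  have le: "(1 + norm \<xi>) ^ j * norm (complex_of_real (heat_multiplier \<epsilon> \<xi>) * m \<xi>) \<le> C * ((1 + norm \<xi>) ^ (j + k) * heat_multiplier \<epsilon> \<xi>)" for \<xi> j
  proof -
    have "(1 + norm \<xi>) ^ j * norm (complex_of_real (heat_multiplier \<epsilon> \<xi>) * m \<xi>) = ((1 + norm \<xi>) ^ j * heat_multiplier \<epsilon> \<xi>) * norm (m \<xi>)"
      by (simp add: norm_mult heat_multiplier_nonneg)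
    also have "\<dots> \<le> ((1 + norm \<xi>) ^ j * heat_multiplier \<epsilon> \<xi>) * (C * (1 + norm \<xi>) ^ k)"
      by (intro mult_left_mono m mult_nonneg_nonneg heat_multiplier_nonneg) auto
    finally show ?thesis by (simp add: power_add mult_ac)
  qed
  have h: "integrable lborel (\<lambda>\<xi>::real ^ 'd. C * ((1 + norm \<xi>) ^ (j + k) * heat_multiplier \<epsilon> \<xi>))" for j
    by (intro integrable_mult_right heat_multiplier_moment_integrable assms)
  show i: "integrable lborel (\<lambda>\<xi>. (1 + norm \<xi>) ^ j * norm (complex_of_real (heat_multiplier \<epsilon> \<xi>) * m \<xi>))" for j
  proof (rule Bochner_Integration.integrable_bound[OF h[of j]])
    show "AE \<xi> in lborel. norm ((1 + norm \<xi>) ^ j * norm (complex_of_real (heat_multiplier \<epsilon> \<xi>) * m \<xi>))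
      \<le> norm (C * ((1 + norm \<xi>) ^ (j + k) * heat_multiplier \<epsilon> \<xi>))"
      using order_trans[OF le abs_ge_self] by (intro always_eventually allI) (simp add: abs_mult)
  qed measurable
  have "integrable lborel (\<lambda>\<xi>. norm (complex_of_real (heat_multiplier \<epsilon> \<xi>) * m \<xi>))"
    using i[of 0] by simp
  then show "integrable lborel (\<lambda>\<xi>. complex_of_real (heat_multiplier \<epsilon> \<xi>) * m \<xi>)"
    by (rule integrable_norm_cancel) measurable
qed

text \<open>The multiplier of a translation by \<open>y\<close>, which is also that of the Dirac measure at \<open>y\<close> up to
  normalisation.\<close>

definition phase :: "real ^ 'd::finite \<Rightarrow> real ^ 'd \<Rightarrow> complex" where
  "phase y \<xi> = iexp (- (\<xi> \<bullet> y))"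

lemma phase_measurable [measurable]: "phase y \<in> borel_measurable borel"
  unfolding phase_def[abs_def] by measurable

lemma norm_phase [simp]: "norm (phase y \<xi>) = 1"
  unfolding phase_def by (rule norm_exp_i_times)

lemma iexp_inner_diff: "iexp (\<xi> \<bullet> (x - y)) = phase y \<xi> * iexp (\<xi> \<bullet> x)"
  by (simp add: phase_def inner_diff_right exp_add[symmetric] algebra_simps)

lemma heat_kernel_mollified: "mollified (phase y) (\<lambda>\<epsilon> x. heat_kernel \<epsilon> (x - y))"
  unfolding mollified_def fourier_of_def
proof (intro allI impI conjI)
  fix \<epsilon> :: real assume "\<epsilon> > 0"
  then show "integrable lborel (\<lambda>\<xi>. complex_of_real (heat_multiplier \<epsilon> \<xi>) * phase y \<xi>)"
    by (intro mollified_integrable(2)[where C = 1 and k = 0]) auto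
  show "complex_of_real (heat_kernel \<epsilon> (x - y)) = (LINT \<xi>|lborel. complex_of_real (heat_multiplier \<epsilon> \<xi>) * phase y \<xi> * iexp (\<xi> \<bullet> x))" for x
    unfolding heat_kernel_fourier[OF \<open>\<epsilon> > 0\<close>] iexp_inner_diff by (simp only: mult.assoc)
qed

definition derivative_symbol :: "'d::finite \<Rightarrow> real ^ 'd \<Rightarrow> complex" where
  "derivative_symbol i \<xi> = - \<i> * complex_of_real (\<xi> $ i)"

lemma derivative_symbol_measurable [measurable]: "derivative_symbol i \<in> borel_measurable borel"
  unfolding derivative_symbol_def[abs_def] by measurable

lemma norm_derivative_symbol_le: "norm (derivative_symbol i \<xi>) \<le> 1 + norm \<xi>"
  using component_le_norm_cart[of \<xi> i] by (simp add: derivative_symbol_def norm_mult)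

lemma partial_deriv_heat_kernel:
  assumes "\<epsilon> > 0"
  shows "complex_of_real (partial_deriv i (\<lambda>z. heat_kernel \<epsilon> (x - z)) y)
    = (LINT \<xi>|lborel. (complex_of_real (heat_multiplier \<epsilon> \<xi>) * derivative_symbol i \<xi>) * iexp (\<xi> \<bullet> (x - y)))"
proof -
  have "complex_of_real (partial_deriv i (\<lambda>z. heat_kernel \<epsilon> (x - z)) y)
    = (LINT \<xi>|lborel. (- \<i> * complex_of_real (\<xi> $ i)) * complex_of_real (heat_multiplier \<epsilon> \<xi>) * iexp (\<xi> \<bullet> (x - y)))"
  proof (rule partial_deriv_fourier)
    show "integrable lborel (\<lambda>\<xi>. (1 + norm \<xi>)\<^sup>2 * norm (complex_of_real (heat_multiplier \<epsilon> \<xi>)))"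
      using mollified_integrable(1)[of "\<lambda>_. 1" 1 0 \<epsilon> 2] assms by simp
  qed (auto simp: heat_kernel_fourier[OF assms])
  then show ?thesis by (simp add: derivative_symbol_def mult_ac)
qed

lemma heat_kernel_deriv_mollified:
  "mollified (\<lambda>\<xi>. derivative_symbol i \<xi> * phase y \<xi>) (\<lambda>\<epsilon> x. partial_deriv i (\<lambda>z. heat_kernel \<epsilon> (x - z)) y)"
  unfolding mollified_def fourier_of_def
proof (intro allI impI conjI)
  fix \<epsilon> :: real assume e: "\<epsilon> > 0"
  show "integrable lborel (\<lambda>\<xi>. complex_of_real (heat_multiplier \<epsilon> \<xi>) * (derivative_symbol i \<xi> * phase y \<xi>))"
    using e norm_derivative_symbol_le by (intro mollified_integrable(2)[where C = 1 and k = 1]) (auto simp: norm_mult)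
  show "complex_of_real (partial_deriv i (\<lambda>z. heat_kernel \<epsilon> (x - z)) y)
    = (LINT \<xi>|lborel. complex_of_real (heat_multiplier \<epsilon> \<xi>) * (derivative_symbol i \<xi> * phase y \<xi>) * iexp (\<xi> \<bullet> x))" for x
    unfolding partial_deriv_heat_kernel[OF e] iexp_inner_diff by (simp only: mult.assoc)
qed

lemma heat_kernel_deriv2_mollified:
  "mollified (\<lambda>\<xi>. derivative_symbol i \<xi> * (derivative_symbol k \<xi> * phase y \<xi>))
     (\<lambda>\<epsilon> x. partial_deriv i (partial_deriv k (\<lambda>z. heat_kernel \<epsilon> (x - z))) y)"
  unfolding mollified_def fourier_of_def
proof (intro allI impI conjI)
  fix \<epsilon> :: real assume e: "\<epsilon> > 0"
  have le: "norm (derivative_symbol i \<xi> * derivative_symbol k \<xi>) \<le> (1 + norm \<xi>) ^ 2" for \<xi>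
    unfolding norm_mult power2_eq_square by (intro mult_mono norm_derivative_symbol_le) auto
  show "integrable lborel (\<lambda>\<xi>. complex_of_real (heat_multiplier \<epsilon> \<xi>) * (derivative_symbol i \<xi> * (derivative_symbol k \<xi> * phase y \<xi>)))"
    using e le by (intro mollified_integrable(2)[where C = 1 and k = 2]) (auto simp: norm_mult)
  fix x
  have "complex_of_real (partial_deriv i (partial_deriv k (\<lambda>z. heat_kernel \<epsilon> (x - z))) y)
    = (LINT \<xi>|lborel. (- \<i> * complex_of_real (\<xi> $ i)) * (complex_of_real (heat_multiplier \<epsilon> \<xi>) * derivative_symbol k \<xi>) * iexp (\<xi> \<bullet> (x - y)))"
  proof (rule partial_deriv_fourier)
    show "integrable lborel (\<lambda>\<xi>. (1 + norm \<xi>)\<^sup>2 * norm (complex_of_real (heat_multiplier \<epsilon> \<xi>) * derivative_symbol k \<xi>))"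
      by (rule mollified_integrable(1)[of "derivative_symbol k" 1 1 \<epsilon> 2])
        (use norm_derivative_symbol_le e in auto)
  qed (auto simp: partial_deriv_heat_kernel[OF e])
  then show "complex_of_real (partial_deriv i (partial_deriv k (\<lambda>z. heat_kernel \<epsilon> (x - z))) y)
    = (LINT \<xi>|lborel. complex_of_real (heat_multiplier \<epsilon> \<xi>) * (derivative_symbol i \<xi> * (derivative_symbol k \<xi> * phase y \<xi>)) * iexp (\<xi> \<bullet> x))"
    unfolding iexp_inner_diff derivative_symbol_def[of i] by (simp only: mult_ac)
qed

lemma fourier_of_cmult:
  assumes "fourier_of b g"
  shows "fourier_of (\<lambda>\<xi>. complex_of_real c * b \<xi>) (\<lambda>x. c * g x)"
  using assms unfolding fourier_of_def by (auto simp: mult.assoc)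

lemma fourier_of_add:
  fixes b b' :: "'b::euclidean_space \<Rightarrow> complex"
  assumes "fourier_of b g" "fourier_of b' g'"
  shows "fourier_of (\<lambda>\<xi>. b \<xi> + b' \<xi>) (\<lambda>x. g x + g' x)"
proof -
  have i: "integrable lborel (\<lambda>\<xi>. b \<xi> * iexp (\<xi> \<bullet> x))" if "integrable lborel b" for b :: "'b \<Rightarrow> complex" and x
    using that by (rule Bochner_Integration.integrable_bound) (use that in \<open>auto simp: norm_mult\<close>)
  show ?thesis
    using assms unfolding fourier_of_def by (auto simp: distrib_right i)
qed

lemma fourier_of_diff:
  assumes "fourier_of b g" "fourier_of b' g'"
  shows "fourier_of (\<lambda>\<xi>. b \<xi> - b' \<xi>) (\<lambda>x. g x - g' x)"
  using fourier_of_add[OF assms(1) fourier_of_cmult[OF assms(2), of "-1"]] by simp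

lemma fourier_of_sum:
  assumes "\<And>i. i \<in> I \<Longrightarrow> fourier_of (b i) (g i)"
  shows "fourier_of (\<lambda>\<xi>. \<Sum>i\<in>I. b i \<xi>) (\<lambda>x. \<Sum>i\<in>I. g i x)"
  using assms
proof (induction I rule: infinite_finite_induct)
  case (insert i I)
  then show ?case by (simp add: fourier_of_add)
qed (simp_all add: fourier_of_def)

context vector_process
begin

lemma occupation_integrable:
  assumes "fourier_of b g" "w \<in> space M"
  shows "set_integrable lborel {0..t} (\<lambda>s. g (X s w))"
proof (rule borel_integrable_atLeastAtMost')
  show "continuous_on {0..t} (\<lambda>s. g (X s w))"
    by (rule continuous_on_compose2[OF fourier_of_continuous[OF assms(1)]])
      (auto intro: continuous_on_subset[OF X_continuous[OF assms(2)]])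
qed

lemma occupation_finite_moments:
  assumes "fourier_of b g" "t \<ge> 0"
  shows "finite_moments M (occupation X g t)"
  unfolding finite_moments_def
proof (intro conjI allI impI)
  have [measurable]: "g \<in> borel_measurable borel" by (rule fourier_of_measurable[OF assms(1)])
  show "occupation X g t \<in> borel_measurable M" by measurable
  fix n :: nat assume n: "even n" "n \<noteq> 0"
  have "(\<integral>\<^sup>+w. ennreal (occupation X g t w ^ n) \<partial>M) \<le> (\<integral>\<^sup>+w. ennreal (((LINT \<xi>|lborel. norm (b \<xi>)) * t) ^ n) \<partial>M)"
  proof (intro nn_integral_mono ennreal_leI)
    fix w
    have "\<bar>occupation X g t w\<bar> \<le> (LINT \<xi>|lborel. norm (b \<xi>)) * t"
      by (rule occupation_bounded[OF fourier_of_bounded[OF assms(1)] assms(2)])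
    then have "\<bar>occupation X g t w\<bar> ^ n \<le> ((LINT \<xi>|lborel. norm (b \<xi>)) * t) ^ n"
      by (rule power_mono) simp
    then show "occupation X g t w ^ n \<le> ((LINT \<xi>|lborel. norm (b \<xi>)) * t) ^ n"
      using n(1) by (simp add: power_even_abs)
  qed
  also have "\<dots> < \<infinity>" by (simp add: emeasure_space_1)
  finally show "(\<integral>\<^sup>+w. ennreal (occupation X g t w ^ n) \<partial>M) < \<infinity>" .
qed

text \<open>Two smoothed multipliers with \<open>\<epsilon>, \<epsilon>' < \<delta>\<close> differ by at most a multiple of
  \<open>(1 - exp (- \<delta> * (norm \<xi>)\<^sup>2 / 2)) * (1 + norm \<xi>) ^ \<beta>\<close>, which decreases to zero with \<open>\<delta>\<close>. So the
  smoothed functionals are Cauchy in every even moment.\<close>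

lemma mollified_limit:
  assumes g: "mollified m g" and [measurable]: "m \<in> borel_measurable borel"
    and m: "\<And>\<xi>. norm (m \<xi>) \<le> C * (1 + norm \<xi>) ^ \<beta>"
    and t: "t > 0" and small: "H * (real CARD('d) + 2 * real \<beta>) < 1"
  defines "Y \<equiv> \<lambda>\<epsilon>. occupation X (g \<epsilon>) t"
  shows "finite_moments M (Lp_lim M Y (at_right 0))"
    and "moments_vanish M (\<lambda>\<epsilon> w. Y \<epsilon> w - Lp_lim M Y (at_right 0) w) (at_right 0)"
proof -
  have fo: "fourier_of (\<lambda>\<xi>. complex_of_real (heat_multiplier \<epsilon> \<xi>) * m \<xi>) (g \<epsilon>)" if "\<epsilon> > 0" for \<epsilon>
    using g that by (simp add: mollified_def)
  have fin: "finite_moments M (Y \<epsilon>)" if "\<epsilon> > 0" for \<epsilon>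
    unfolding Y_def using occupation_finite_moments[OF fo[OF that]] t by simp
  define a where "a = (2 * pi) powr (- real CARD('d))"
  have a: "a > 0" by (simp add: a_def)
  define C' where "C' = a * \<bar>C\<bar> + 1"
  have C': "C' \<ge> 1" using a by (simp add: C'_def)
  have cauchy: "\<exists>\<delta>>0. \<forall>\<epsilon> \<epsilon>'. 0 < \<epsilon> \<and> \<epsilon> < \<delta> \<and> 0 < \<epsilon>' \<and> \<epsilon>' < \<delta> \<longrightarrow>
        (\<integral>\<^sup>+w. ennreal ((Y \<epsilon> w - Y \<epsilon>' w) ^ n) \<partial>M) \<le> ennreal \<eta>"
    if n: "even n" "n \<noteq> 0" and "\<eta> > 0" for n \<eta>
  proof -
    obtain W where W: "moment_weight t n (\<lambda>\<xi>. C' * (1 + norm \<xi>) ^ \<beta>) W"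
      using moment_weight_exists[OF n t _ C', of \<beta>] small by auto
    let ?dom = "\<lambda>\<delta> \<xi>. (1 - exp (- \<delta> * (norm \<xi>)\<^sup>2 / 2)) * (C' * (1 + norm (\<xi> :: real ^ 'd)) ^ \<beta>)"
    define e where "e k = inverse (real (Suc k))" for k
    have e: "e k > 0" "e \<longlonglongrightarrow> 0" for k
      using LIMSEQ_inverse_real_of_nat by (auto simp: e_def[abs_def])
    have dom_le: "?dom (e k) \<xi> \<le> C' * (1 + norm \<xi>) ^ \<beta>" for k \<xi>
      using C' mult_right_mono[of "1 - exp (- e k * (norm \<xi>)\<^sup>2 / 2)" 1 "C' * (1 + norm \<xi>) ^ \<beta>"] by simp
    have "(\<lambda>k. \<integral>\<^sup>+\<xi>. ennreal (?dom (e k) \<xi>) * W \<xi> \<partial>lborel) \<longlonglongrightarrow> 0"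
    proof (rule moment_weight_tendsto[OF W _ _ _ dom_le])
      show "0 < C' * (1 + norm \<xi>) ^ \<beta>" for \<xi> :: "real ^ 'd"
        using C' by (intro mult_pos_pos zero_less_power add_pos_nonneg) auto
      fix \<xi> :: "real ^ 'd"
      have "(\<lambda>k. ?dom (e k) \<xi>) \<longlonglongrightarrow> (1 - exp (- 0 * (norm \<xi>)\<^sup>2 / 2)) * (C' * (1 + norm \<xi>) ^ \<beta>)"
        by (intro tendsto_intros e) simp
      then show "(\<lambda>k. ?dom (e k) \<xi>) \<longlonglongrightarrow> 0" by simp
    qed measurable
    then have "\<forall>\<^sub>F k in sequentially. (\<integral>\<^sup>+\<xi>. ennreal (?dom (e k) \<xi>) * W \<xi> \<partial>lborel) < ennreal \<eta>"
      using \<open>\<eta> > 0\<close> by (intro order_tendstoD(2)[of _ 0]) auto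
    then obtain k where k: "(\<integral>\<^sup>+\<xi>. ennreal (?dom (e k) \<xi>) * W \<xi> \<partial>lborel) < ennreal \<eta>"
      by (auto simp: eventually_sequentially)
    show ?thesis
    proof (intro exI[of _ "e k"] conjI allI impI e(1))
      fix \<epsilon> \<epsilon>' assume ee: "0 < \<epsilon> \<and> \<epsilon> < e k \<and> 0 < \<epsilon>' \<and> \<epsilon>' < e k"
      let ?b = "\<lambda>\<xi>. complex_of_real (heat_multiplier \<epsilon> \<xi>) * m \<xi> - complex_of_real (heat_multiplier \<epsilon>' \<xi>) * m \<xi>"
      have fo2: "fourier_of ?b (\<lambda>x. g \<epsilon> x - g \<epsilon>' x)"
        using ee by (intro fourier_of_diff fo) auto
      have bdom: "norm (?b \<xi>) \<le> ?dom (e k) \<xi>" for \<xi>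
      proof -
        define q where "q = (norm \<xi>)\<^sup>2 / 2"
        have q: "q \<ge> 0" by (simp add: q_def)
        have mono: "exp (- e k * q) \<le> exp (- \<epsilon> * q)" "exp (- e k * q) \<le> exp (- \<epsilon>' * q)" "exp (- \<epsilon> * q) \<le> 1" "exp (- \<epsilon>' * q) \<le> 1"
          using ee q by (auto intro!: mult_right_mono mult_nonneg_nonneg)
        have hm: "heat_multiplier \<epsilon> \<xi> = a * exp (- \<epsilon> * q)" for \<epsilon>
          by (simp add: heat_multiplier_def q_def a_def)
        have "norm (?b \<xi>) = \<bar>heat_multiplier \<epsilon> \<xi> - heat_multiplier \<epsilon>' \<xi>\<bar> * norm (m \<xi>)"
          by (simp add: left_diff_distrib[symmetric] norm_mult of_real_diff[symmetric] del: of_real_diff)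
        also have "\<dots> = \<bar>exp (- \<epsilon> * q) - exp (- \<epsilon>' * q)\<bar> * (a * norm (m \<xi>))"
          unfolding hm right_diff_distrib[symmetric] using a by (simp add: abs_mult)
        also have "\<dots> \<le> (1 - exp (- e k * q)) * (C' * (1 + norm \<xi>) ^ \<beta>)"
        proof (rule mult_mono)
          show "\<bar>exp (- \<epsilon> * q) - exp (- \<epsilon>' * q)\<bar> \<le> 1 - exp (- e k * q)" using mono by linarith
          have "a * norm (m \<xi>) \<le> a * (\<bar>C\<bar> * (1 + norm \<xi>) ^ \<beta>)"
            using a order_trans[OF m[of \<xi>] mult_right_mono[OF abs_ge_self]] by (intro mult_left_mono) auto
          also have "\<dots> \<le> C' * (1 + norm \<xi>) ^ \<beta>"
            unfolding mult.assoc[symmetric] C'_def by (intro mult_right_mono) auto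
          finally show "a * norm (m \<xi>) \<le> C' * (1 + norm \<xi>) ^ \<beta>" .
        qed (use mono a in auto)
        also have "\<dots> = ?dom (e k) \<xi>" by (simp add: q_def)
        finally show ?thesis .
      qed
      have "(\<integral>\<^sup>+w. ennreal ((Y \<epsilon> w - Y \<epsilon>' w) ^ n) \<partial>M) = (\<integral>\<^sup>+w. ennreal (occupation X (\<lambda>x. g \<epsilon> x - g \<epsilon>' x) t w ^ n) \<partial>M)"
      proof (rule nn_integral_cong)
        fix w assume w: "w \<in> space M"
        have "Y \<epsilon> w - Y \<epsilon>' w = occupation X (\<lambda>x. g \<epsilon> x - g \<epsilon>' x) t w"
          unfolding Y_def occupation_def using ee
          by (intro set_integral_diff(2)[symmetric] occupation_integrable[OF fo w]) auto
        then show "ennreal ((Y \<epsilon> w - Y \<epsilon>' w) ^ n) = ennreal (occupation X (\<lambda>x. g \<epsilon> x - g \<epsilon>' x) t w ^ n)" by simp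
      qed
      also have "\<dots> \<le> (\<integral>\<^sup>+\<xi>. ennreal (norm (?b \<xi>)) * W \<xi> \<partial>lborel)"
        by (rule moment_weightD[OF W fo2]) (rule order_trans[OF bdom dom_le])
      also have "\<dots> \<le> (\<integral>\<^sup>+\<xi>. ennreal (?dom (e k) \<xi>) * W \<xi> \<partial>lborel)"
        by (intro nn_integral_mono mult_right_mono ennreal_leI bdom) auto
      also have "\<dots> \<le> ennreal \<eta>" using k by simp
      finally show "(\<integral>\<^sup>+w. ennreal ((Y \<epsilon> w - Y \<epsilon>' w) ^ n) \<partial>M) \<le> ennreal \<eta>" .
    qed
  qed
  show "finite_moments M (Lp_lim M Y (at_right 0))"
    and "moments_vanish M (\<lambda>\<epsilon> w. Y \<epsilon> w - Lp_lim M Y (at_right 0) w) (at_right 0)"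
    using Lp_lim_moments[OF prob_space_axioms fin cauchy] by blast+
qed

end

section \<open>Smoothing along the path\<close>

lemma nn_L1_AE_subseq:
  fixes u :: "nat \<Rightarrow> 'a \<Rightarrow> real"
  assumes [measurable]: "\<And>k. u k \<in> borel_measurable M"
    and lim: "(\<lambda>k. \<integral>\<^sup>+w. ennreal \<bar>u k w\<bar> \<partial>M) \<longlonglongrightarrow> 0"
  shows "\<exists>r. strict_mono r \<and> (AE w in M. (\<lambda>k. u (r k) w) \<longlonglongrightarrow> 0)"
proof -
  have "\<forall>\<^sub>F k in sequentially. (\<integral>\<^sup>+w. ennreal \<bar>u k w\<bar> \<partial>M) < 1"
    by (rule order_tendstoD(2)[OF lim]) simp
  then obtain N where N: "\<And>k. k \<ge> N \<Longrightarrow> (\<integral>\<^sup>+w. ennreal \<bar>u k w\<bar> \<partial>M) < 1"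
    by (auto simp: eventually_sequentially)
  have int: "integrable M (u (k + N))" for k
    using N[of "k + N"] by (intro integrableI_bounded) (auto intro: less_trans)
  have "(\<lambda>k. LINT w|M. norm (u (k + N) w)) \<longlonglongrightarrow> 0"
  proof -
    have "(\<lambda>k. enn2real (\<integral>\<^sup>+w. ennreal \<bar>u (k + N) w\<bar> \<partial>M)) \<longlonglongrightarrow> enn2real 0"
      by (intro tendsto_enn2real) (use LIMSEQ_ignore_initial_segment[OF lim, of N] in simp_all)
    then show ?thesis by (simp add: integral_eq_nn_integral)
  qed
  from tendsto_L1_AE_subseq[OF int this] obtain r where r: "strict_mono r" "AE w in M. (\<lambda>k. u (r k + N) w) \<longlonglongrightarrow> 0"
    by blast
  then show ?thesis
    by (intro exI[of _ "\<lambda>k. r k + N"]) (auto simp: strict_mono_def)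
qed

lemma moments_vanish_AE_subseq:
  assumes "\<And>k. D (e k) \<in> borel_measurable M" and "moments_vanish M D F" and "filterlim e F sequentially"
  shows "\<exists>r. strict_mono r \<and> (AE w in M. (\<lambda>k. D (e (r k)) w) \<longlonglongrightarrow> 0)"
proof -
  note [measurable] = assms(1)
  have "((\<lambda>i. \<integral>\<^sup>+w. ennreal (D i w ^ 2) \<partial>M) \<longlongrightarrow> 0) F"
    using assms(2) by (simp add: moments_vanish_def)
  from filterlim_compose[OF this assms(3)]
  have "(\<lambda>k. \<integral>\<^sup>+w. ennreal \<bar>(D (e k) w)\<^sup>2\<bar> \<partial>M) \<longlonglongrightarrow> 0" by simp
  from nn_L1_AE_subseq[OF _ this] obtain r where r: "strict_mono r" "AE w in M. (\<lambda>k. (D (e (r k)) w)\<^sup>2) \<longlonglongrightarrow> 0"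
    by auto
  from r(2) have "AE w in M. (\<lambda>k. D (e (r k)) w) \<longlonglongrightarrow> 0"
    by eventually_elim simp
  with r(1) show ?thesis by blast
qed

context vector_process
begin

definition occupation_norm :: "real \<Rightarrow> (real ^ 'd \<Rightarrow> real) \<Rightarrow> ennreal" where
  "occupation_norm t h = (\<integral>\<^sup>+w. (\<integral>\<^sup>+s. indicator {0<..<t} s * ennreal \<bar>h (X s w)\<bar> \<partial>lborel) \<partial>M)"

lemma nn_integral_closed_interval:
  fixes t :: real and \<phi> :: "real \<Rightarrow> real"
  shows
  "(\<integral>\<^sup>+s. ennreal (norm (indicator {0..t} s *\<^sub>R \<phi> s)) \<partial>lborel) = (\<integral>\<^sup>+s. indicator {0<..<t} s * ennreal \<bar>\<phi> s\<bar> \<partial>lborel)"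
proof (rule nn_integral_cong_AE)
  have "AE s in lborel. s \<noteq> 0 \<and> s \<noteq> (t :: real)"
    by (intro AE_conjI AE_lborel_singleton)
  then show "AE s in lborel. ennreal (norm (indicator {0..t} s *\<^sub>R \<phi> s)) = indicator {0<..<t} s * ennreal \<bar>\<phi> s\<bar>"
    by eventually_elim (auto simp: indicator_def)
qed

lemma occupation_norm_finite_AE:
  assumes [measurable]: "h \<in> borel_measurable borel" and "occupation_norm t h < \<infinity>"
  shows "AE w in M. set_integrable lborel {0..t} (\<lambda>s. h (X s w))"
proof -
  interpret lR: pair_sigma_finite "lborel :: real measure" M ..
  have "AE w in M. (\<integral>\<^sup>+s. indicator {0<..<t} s * ennreal \<bar>h (X s w)\<bar> \<partial>lborel) \<noteq> \<infinity>"
    using assms(2) unfolding occupation_norm_def by (intro nn_integral_PInf_AE) auto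
  then show ?thesis
  proof (rule AE_mp, intro AE_I2 impI)
    fix w assume w: "w \<in> space M" and fin: "(\<integral>\<^sup>+s. indicator {0<..<t} s * ennreal \<bar>h (X s w)\<bar> \<partial>lborel) \<noteq> \<infinity>"
    have [measurable]: "(\<lambda>s. X s w) \<in> borel_measurable borel"
      by (rule borel_measurable_continuous_onI[OF X_continuous[OF w]])
    show "set_integrable lborel {0..t} (\<lambda>s. h (X s w))"
      unfolding set_integrable_def
    proof (rule integrableI_bounded)
      show "(\<integral>\<^sup>+s. ennreal (norm (indicator {0..t} s *\<^sub>R h (X s w))) \<partial>lborel) < \<infinity>"
        unfolding nn_integral_closed_interval using fin by (simp add: less_top)
    qed measurable
  qed
qed

lemma occupation_diff_le:
  assumes [measurable]: "h1 \<in> borel_measurable borel" "h2 \<in> borel_measurable borel"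
    and "occupation_norm t h1 < \<infinity>" "occupation_norm t h2 < \<infinity>"
  shows "(\<integral>\<^sup>+w. ennreal \<bar>occupation X h1 t w - occupation X h2 t w\<bar> \<partial>M) \<le> occupation_norm t (\<lambda>x. h1 x - h2 x)"
  unfolding occupation_norm_def
proof (rule nn_integral_mono_AE)
  show "AE w in M. ennreal \<bar>occupation X h1 t w - occupation X h2 t w\<bar>
     \<le> (\<integral>\<^sup>+s. indicator {0<..<t} s * ennreal \<bar>h1 (X s w) - h2 (X s w)\<bar> \<partial>lborel)"
    using occupation_norm_finite_AE[OF assms(1,3)] occupation_norm_finite_AE[OF assms(2,4)]
  proof eventually_elim
    case (elim w)
    have "occupation X h1 t w - occupation X h2 t w = (LINT s|lborel. indicator {0..t} s *\<^sub>R (h1 (X s w) - h2 (X s w)))"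
      unfolding occupation_def set_integral_diff(2)[OF elim, symmetric] by (simp add: set_lebesgue_integral_def)
    then have "ennreal \<bar>occupation X h1 t w - occupation X h2 t w\<bar>
      \<le> (\<integral>\<^sup>+s. ennreal (norm (indicator {0..t} s *\<^sub>R (h1 (X s w) - h2 (X s w)))) \<partial>lborel)"
      using norm_integral_le_nn_integral[of lborel "\<lambda>s. indicator {0..t} s *\<^sub>R (h1 (X s w) - h2 (X s w))"] by simp
    then show ?case unfolding nn_integral_closed_interval .
  qed
qed

lemma occupation_norm_triangle:
  assumes [measurable]: "h1 \<in> borel_measurable borel" "h2 \<in> borel_measurable borel"
  shows "occupation_norm t (\<lambda>x. h1 x + h2 x) \<le> occupation_norm t h1 + occupation_norm t h2"
proof -
  interpret lR: pair_sigma_finite "lborel :: real measure" M ..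
  have "occupation_norm t (\<lambda>x. h1 x + h2 x)
    \<le> (\<integral>\<^sup>+w. (\<integral>\<^sup>+s. indicator {0<..<t} s * ennreal \<bar>h1 (X s w)\<bar> \<partial>lborel) + (\<integral>\<^sup>+s. indicator {0<..<t} s * ennreal \<bar>h2 (X s w)\<bar> \<partial>lborel) \<partial>M)"
    unfolding occupation_norm_def
  proof (rule nn_integral_mono)
    fix w assume w: "w \<in> space M"
    have [measurable]: "(\<lambda>s. X s w) \<in> borel_measurable borel"
      by (rule borel_measurable_continuous_onI[OF X_continuous[OF w]])
    have "(\<integral>\<^sup>+s. indicator {0<..<t} s * ennreal \<bar>h1 (X s w) + h2 (X s w)\<bar> \<partial>lborel)
      \<le> (\<integral>\<^sup>+s. indicator {0<..<t} s * ennreal \<bar>h1 (X s w)\<bar> + indicator {0<..<t} s * ennreal \<bar>h2 (X s w)\<bar> \<partial>lborel)"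
      by (intro nn_integral_mono) (auto simp: indicator_def ennreal_plus[symmetric] simp del: ennreal_plus intro!: ennreal_leI)
    also have "\<dots> = (\<integral>\<^sup>+s. indicator {0<..<t} s * ennreal \<bar>h1 (X s w)\<bar> \<partial>lborel) + (\<integral>\<^sup>+s. indicator {0<..<t} s * ennreal \<bar>h2 (X s w)\<bar> \<partial>lborel)"
      by (rule nn_integral_add) measurable
    finally show "(\<integral>\<^sup>+s. indicator {0<..<t} s * ennreal \<bar>h1 (X s w) + h2 (X s w)\<bar> \<partial>lborel) \<le> \<dots>" .
  qed
  also have "\<dots> = occupation_norm t h1 + occupation_norm t h2"
    unfolding occupation_norm_def by (rule nn_integral_add) measurable
  finally show ?thesis .
qed

lemma occupation_norm_smoothing_continuous:
  assumes g: "continuous_on UNIV g" and B: "\<And>x. \<bar>g x\<bar> \<le> B" and e: "\<And>n. e n \<ge> 0" "e \<longlonglongrightarrow> 0" and "t > 0"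
  shows "(\<lambda>n. occupation_norm t (\<lambda>x. smoothing g (e n) x - g x)) \<longlonglongrightarrow> 0"
proof -
  have [measurable]: "g \<in> borel_measurable borel" by (rule borel_measurable_continuous_onI[OF g])
  interpret lR: pair_sigma_finite "lborel :: real measure" M ..
  let ?u = "\<lambda>n p. indicator {0<..<t} (fst p) * ennreal \<bar>smoothing g (e n) (X (fst p) (snd p)) - g (X (fst p) (snd p))\<bar>"
  have eq: "occupation_norm t (\<lambda>x. smoothing g (e n) x - g x) = (\<integral>\<^sup>+p. ?u n p \<partial>(lborel \<Otimes>\<^sub>M M))" for n
  proof -
    have "(\<integral>\<^sup>+p. ?u n p \<partial>(lborel \<Otimes>\<^sub>M M)) = (\<integral>\<^sup>+s. \<integral>\<^sup>+w. ?u n (s, w) \<partial>M \<partial>lborel)"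
      by (rule nn_integral_fst[symmetric]) measurable
    also have "\<dots> = (\<integral>\<^sup>+w. \<integral>\<^sup>+s. ?u n (s, w) \<partial>lborel \<partial>M)"
      by (rule lR.Fubini'[symmetric]) measurable
    finally show ?thesis by (simp add: occupation_norm_def)
  qed
  have "(\<lambda>n. \<integral>\<^sup>+p. ?u n p \<partial>(lborel \<Otimes>\<^sub>M M)) \<longlonglongrightarrow> (\<integral>\<^sup>+p. 0 \<partial>(lborel \<Otimes>\<^sub>M M :: (real \<times> 'a) measure))"
  proof (rule nn_integral_dominated_convergence[where w = "\<lambda>p. ennreal (2 * B) * indicator {0<..<t} (fst p)"])
    show "(\<integral>\<^sup>+p. ennreal (2 * B) * indicator {0<..<t} (fst p) \<partial>(lborel \<Otimes>\<^sub>M M)) < \<infinity>"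
    proof -
      have "(\<integral>\<^sup>+p. ennreal (2 * B) * indicator {0<..<t} (fst p) \<partial>(lborel \<Otimes>\<^sub>M M))
        = (\<integral>\<^sup>+s. \<integral>\<^sup>+w. ennreal (2 * B) * indicator {0<..<t} s \<partial>M \<partial>lborel)"
        by (subst nn_integral_fst[symmetric]) auto
      also have "\<dots> = ennreal (2 * B) * ennreal t"
        using \<open>t > 0\<close> by (simp add: emeasure_space_1 nn_integral_cmult_indicator)
      also have "\<dots> < \<infinity>" by (simp add: ennreal_mult_less_top)
      finally show ?thesis .
    qed
    show "AE p in lborel \<Otimes>\<^sub>M M. ?u n p \<le> ennreal (2 * B) * indicator {0<..<t} (fst p)" for n
    proof (intro always_eventually allI)
      fix p :: "real \<times> 'a"
      have "\<bar>smoothing g (e n) (X (fst p) (snd p)) - g (X (fst p) (snd p))\<bar> \<le> 2 * B"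
        using smoothing_tendsto(2)[OF g B e, of "e n" "X (fst p) (snd p)"] B[of "X (fst p) (snd p)"] by linarith
      then show "?u n p \<le> ennreal (2 * B) * indicator {0<..<t} (fst p)"
        by (auto simp: indicator_def intro: ennreal_leI)
    qed
    show "AE p in lborel \<Otimes>\<^sub>M M. (\<lambda>n. ?u n p) \<longlonglongrightarrow> 0"
    proof (intro always_eventually allI)
      fix p :: "real \<times> 'a"
      have "(\<lambda>n. \<bar>smoothing g (e n) (X (fst p) (snd p)) - g (X (fst p) (snd p))\<bar>) \<longlonglongrightarrow> \<bar>g (X (fst p) (snd p)) - g (X (fst p) (snd p))\<bar>"
        by (intro tendsto_intros smoothing_tendsto(1)[OF g B e])
      then have "(\<lambda>n. ennreal \<bar>smoothing g (e n) (X (fst p) (snd p)) - g (X (fst p) (snd p))\<bar>) \<longlonglongrightarrow> ennreal 0"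
        by (intro tendsto_ennrealI) simp
      then show "(\<lambda>n. ?u n p) \<longlonglongrightarrow> 0"
        by (cases "fst p \<in> {0<..<t}") (auto simp: indicator_def)
    qed
  qed measurable
  then show ?thesis unfolding eq by simp
qed

text \<open>By the bound on the density of the occupation measure, approximation of the integrand in
  \<open>L\<^sup>1\<close> of Lebesgue measure carries over to the occupation functional.\<close>

lemma occupation_smoothing_converges:
  assumes F: "integrable lborel F" and t: "t > 0" and small: "H * real CARD('d) < 1"
    and e: "\<And>n. e n > 0" "e \<longlonglongrightarrow> 0"
  shows "(\<lambda>n. \<integral>\<^sup>+w. ennreal \<bar>occupation X (smoothing F (e n)) t w - occupation X F t w\<bar> \<partial>M) \<longlonglongrightarrow> 0"
proof -
  have [measurable]: "F \<in> borel_measurable borel" using F by auto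
  obtain K where K: "K < \<infinity>" "\<And>h. h \<in> borel_measurable borel \<Longrightarrow>
    (\<integral>\<^sup>+w. (\<integral>\<^sup>+s. indicator {0<..<t} s * h (X s w) \<partial>lborel) \<partial>M) \<le> K * (\<integral>\<^sup>+x. h x \<partial>lborel)"
    using occupation_density[OF t small] by blast
  have oK: "occupation_norm t h \<le> K * (\<integral>\<^sup>+x. ennreal \<bar>h x\<bar> \<partial>lborel)" if [measurable]: "h \<in> borel_measurable borel" for h
    unfolding occupation_norm_def by (rule K(2)) measurable
  have L1: "(\<integral>\<^sup>+x. ennreal \<bar>F x\<bar> \<partial>lborel) < \<infinity>" using F by (simp add: integrable_iff_bounded)
  have fin: "occupation_norm t F < \<infinity>" "occupation_norm t (smoothing F (e n)) < \<infinity>" for n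
  proof -
    show "occupation_norm t F < \<infinity>" using K(1) L1 by (intro le_less_trans[OF oK]) (auto simp: ennreal_mult_less_top)
    have "(\<integral>\<^sup>+x. ennreal \<bar>smoothing F (e n) x\<bar> \<partial>lborel) < \<infinity>"
      using L1 by (intro le_less_trans[OF smoothing_L1_le]) auto
    then show "occupation_norm t (smoothing F (e n)) < \<infinity>"
      using K(1) by (intro le_less_trans[OF oK]) (auto simp: ennreal_mult_less_top)
  qed
  show ?thesis
  proof (rule order_tendstoI)
    fix a :: ennreal assume "0 < a"
    obtain \<eta> where \<eta>: "\<eta> > 0" "ennreal \<eta> \<le> a"
    proof (cases a)
      case (real r)
      then show ?thesis using that[of r] \<open>0 < a\<close> by (simp add: ennreal_less_zero_iff)
    qed (use that[of 1] in simp)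
    obtain k where k: "K = ennreal k" "k \<ge> 0" using K(1) by (cases K) auto
    define d where "d = \<eta> / (4 * (k + 1))"
    have d: "d > 0" "k * d \<le> \<eta> / 4" using \<eta> k by (auto simp: d_def field_simps)
    obtain g B where g: "continuous_on UNIV g" "\<And>x. \<bar>g x\<bar> \<le> B" "integrable lborel g" "(LINT x|lborel. \<bar>F x - g x\<bar>) < d"
      using integrable_approx_continuous[OF F d(1)] by blast
    have [measurable]: "g \<in> borel_measurable borel" using g(3) by auto
    define R where "R = (\<lambda>x. F x - g x)"
    have [measurable]: "R \<in> borel_measurable borel" unfolding R_def by measurable
    have R: "(\<integral>\<^sup>+x. ennreal \<bar>R x\<bar> \<partial>lborel) \<le> ennreal d"
      unfolding R_def using F g(3,4) by (subst nn_integral_eq_integral) (auto intro: ennreal_leI)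
    have R1: "occupation_norm t (\<lambda>x. - R x) \<le> ennreal (\<eta> / 4)"
    proof -
      have "occupation_norm t (\<lambda>x. - R x) \<le> K * (\<integral>\<^sup>+x. ennreal \<bar>- R x\<bar> \<partial>lborel)" by (rule oK) measurable
      also have "\<dots> \<le> ennreal k * ennreal d" unfolding k(1) using R by (intro mult_left_mono) auto
      also have "\<dots> \<le> ennreal (\<eta> / 4)" using d k by (subst ennreal_mult[symmetric]) (auto intro: ennreal_leI)
      finally show ?thesis .
    qed
    have R2: "occupation_norm t (smoothing R (e n)) \<le> ennreal (\<eta> / 4)" for n
    proof -
      have "occupation_norm t (smoothing R (e n)) \<le> K * (\<integral>\<^sup>+x. ennreal \<bar>smoothing R (e n) x\<bar> \<partial>lborel)" by (rule oK) measurable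
      also have "\<dots> \<le> ennreal k * ennreal d"
        unfolding k(1) by (intro mult_left_mono order_trans[OF smoothing_L1_le R]) auto
      also have "\<dots> \<le> ennreal (\<eta> / 4)" using d k by (subst ennreal_mult[symmetric]) (auto intro: ennreal_leI)
      finally show ?thesis .
    qed
    have "\<forall>\<^sub>F n in sequentially. occupation_norm t (\<lambda>x. smoothing g (e n) x - g x) < ennreal (\<eta> / 4)"
      using \<eta>(1) less_imp_le[OF e(1)]
      by (intro order_tendstoD(2)[OF occupation_norm_smoothing_continuous[OF g(1,2) _ e(2) t]]) auto
    then show "\<forall>\<^sub>F n in sequentially. (\<integral>\<^sup>+w. ennreal \<bar>occupation X (smoothing F (e n)) t w - occupation X F t w\<bar> \<partial>M) < a"
    proof eventually_elim
      case (elim n)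
      have split: "smoothing F (e n) x - F x = (smoothing R (e n) x + (smoothing g (e n) x - g x)) + - R x" for x
      proof -
        have "smoothing R (e n) x = smoothing F (e n) x - smoothing g (e n) x"
          unfolding smoothing_def R_def left_diff_distrib
          by (intro Bochner_Integration.integral_diff smoothing_integrand_integrable F g e)
        then show ?thesis by (simp add: R_def)
      qed
      have "(\<integral>\<^sup>+w. ennreal \<bar>occupation X (smoothing F (e n)) t w - occupation X F t w\<bar> \<partial>M)
        \<le> occupation_norm t (\<lambda>x. smoothing F (e n) x - F x)"
        by (intro occupation_diff_le fin) measurable
      also have "\<dots> \<le> occupation_norm t (\<lambda>x. smoothing R (e n) x + (smoothing g (e n) x - g x)) + occupation_norm t (\<lambda>x. - R x)"
        unfolding split by (rule occupation_norm_triangle) measurable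
      also have "\<dots> \<le> (occupation_norm t (smoothing R (e n)) + occupation_norm t (\<lambda>x. smoothing g (e n) x - g x)) + occupation_norm t (\<lambda>x. - R x)"
        by (intro add_right_mono occupation_norm_triangle) measurable
      also have "\<dots> \<le> (ennreal (\<eta> / 4) + ennreal (\<eta> / 4)) + ennreal (\<eta> / 4)"
        using elim by (intro add_mono R1 R2) auto
      also have "\<dots> < ennreal \<eta>"
        using \<eta>(1) by (simp add: ennreal_plus[symmetric] ennreal_less_iff del: ennreal_plus)
      also have "\<dots> \<le> a" by (rule \<eta>(2))
      finally show ?case .
    qed
  qed simp
qed

end

section \<open>The Fourier transform of a rescaled function\<close>

text \<open>Rescaling \<open>f\<close> by \<open>r\<close> around \<open>y\<close> dilates its Fourier transform and multiplies it by the phase.\<close>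

lemma smoothing_mollified:
  fixes f :: "real ^ 'd::finite \<Rightarrow> real"
  assumes f: "integrable lborel f" and r: "r > 0"
  shows "mollified (\<lambda>\<xi>. (LINT z|lborel. complex_of_real (f z) * iexp (- (r * (\<xi> \<bullet> z)))) * phase y \<xi>)
    (\<lambda>\<epsilon>. smoothing (\<lambda>x. (1 / r) ^ CARD('d) * f ((1 / r) *\<^sub>R (x - y))) \<epsilon>)"
  unfolding mollified_def fourier_of_def
proof (intro allI impI conjI)
  have [measurable]: "f \<in> borel_measurable borel" using f by auto
  fix \<epsilon> :: real assume e: "\<epsilon> > 0"
  let ?h = "\<lambda>\<xi>. LINT z|lborel. complex_of_real (f z) * iexp (- (r * (\<xi> \<bullet> z)))"
  have h: "norm (?h \<xi>) \<le> (LINT z|lborel. \<bar>f z\<bar>)" for \<xi>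
  proof -
    have "norm (?h \<xi>) \<le> (LINT z|lborel. norm (complex_of_real (f z) * iexp (- (r * (\<xi> \<bullet> z)))))"
      by (rule integral_norm_bound)
    also have "\<dots> = (LINT z|lborel. \<bar>f z\<bar>)"
      by (simp only: norm_mult norm_exp_i_times norm_of_real mult_1_right)
    finally show ?thesis .
  qed
  show "integrable lborel (\<lambda>\<xi>. complex_of_real (heat_multiplier \<epsilon> \<xi>) * (?h \<xi> * phase y \<xi>))"
    by (rule mollified_integrable(2)[where C = "LINT z|lborel. \<bar>f z\<bar>" and k = 0]) (use h e in \<open>simp_all add: norm_mult\<close>)
  fix x :: "real ^ 'd"
  let ?F = "\<lambda>x. (1 / r) ^ CARD('d) * f ((1 / r) *\<^sub>R (x - y))"
  have "smoothing ?F \<epsilon> x = (LINT u|lborel. ?F u * heat_kernel \<epsilon> (x - u))"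
  proof -
    have "(LINT u|lborel. ?F u * heat_kernel \<epsilon> (x - u))
      = (\<bar>sqrt \<epsilon>\<bar> ^ DIM(real ^ 'd)) *\<^sub>R (LINT v|lborel. ?F (x + sqrt \<epsilon> *\<^sub>R v) * heat_kernel \<epsilon> (x - (x + sqrt \<epsilon> *\<^sub>R v)))"
      using e by (intro lborel_scale_integral) auto
    also have "\<dots> = (LINT v|lborel. (sqrt \<epsilon> ^ CARD('d)) *\<^sub>R (?F (x + sqrt \<epsilon> *\<^sub>R v) * heat_kernel \<epsilon> (sqrt \<epsilon> *\<^sub>R v)))"
      using e by (simp add: heat_kernel_def)
    also have "\<dots> = smoothing ?F \<epsilon> x"
      unfolding smoothing_def heat_kernel_scale[OF e, symmetric] by (simp add: mult_ac)
    finally show ?thesis ..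
  qed
  also have "(LINT u|lborel. ?F u * heat_kernel \<epsilon> (x - u))
     = (\<bar>r\<bar> ^ DIM(real ^ 'd)) *\<^sub>R (LINT z|lborel. ?F (y + r *\<^sub>R z) * heat_kernel \<epsilon> (x - (y + r *\<^sub>R z)))"
    using r by (intro lborel_scale_integral) auto
  also have "\<dots> = (LINT z|lborel. f z * heat_kernel \<epsilon> (x - (y + r *\<^sub>R z)))"
  proof -
    have "(\<bar>r\<bar> ^ DIM(real ^ 'd)) *\<^sub>R (?F (y + r *\<^sub>R z) * heat_kernel \<epsilon> (x - (y + r *\<^sub>R z))) = f z * heat_kernel \<epsilon> (x - (y + r *\<^sub>R z))" for z
      using r by (simp add: power_one_over)
    then show ?thesis by (simp only: integral_scaleR_right[symmetric])
  qed
  finally have sm: "smoothing ?F \<epsilon> x = (LINT z|lborel. f z * heat_kernel \<epsilon> (x - (y + r *\<^sub>R z)))" .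
  let ?G = "\<lambda>z \<xi>. complex_of_real (f z) * (complex_of_real (heat_multiplier \<epsilon> \<xi>) * iexp (\<xi> \<bullet> (x - (y + r *\<^sub>R z))))"
  have hm: "integrable lborel (heat_multiplier \<epsilon> :: real ^ 'd \<Rightarrow> real)"
    using heat_multiplier_moment_integrable[OF e, of 0] by simp
  have int: "integrable (lborel \<Otimes>\<^sub>M lborel) (\<lambda>(z, \<xi>). ?G z \<xi>)"
  proof (rule integrableI_bounded)
    have "(\<integral>\<^sup>+p. ennreal (norm (case p of (z, \<xi>) \<Rightarrow> ?G z \<xi>)) \<partial>(lborel \<Otimes>\<^sub>M lborel))
      = (\<integral>\<^sup>+p. ennreal \<bar>f (fst p)\<bar> * ennreal (heat_multiplier \<epsilon> (snd p :: real ^ 'd)) \<partial>(lborel \<Otimes>\<^sub>M lborel))"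
      by (intro nn_integral_cong)
        (simp only: case_prod_unfold norm_mult norm_exp_i_times norm_of_real mult_1_right abs_of_nonneg[OF heat_multiplier_nonneg] ennreal_mult[OF abs_ge_zero heat_multiplier_nonneg])
    also have "\<dots> = (\<integral>\<^sup>+z. \<integral>\<^sup>+\<xi>. ennreal \<bar>f z\<bar> * ennreal (heat_multiplier \<epsilon> (\<xi> :: real ^ 'd)) \<partial>lborel \<partial>lborel)"
      by (subst lborel.nn_integral_fst[symmetric]) auto
    also have "\<dots> = (\<integral>\<^sup>+z. ennreal \<bar>f z\<bar> \<partial>lborel) * (\<integral>\<^sup>+\<xi>. ennreal (heat_multiplier \<epsilon> (\<xi> :: real ^ 'd)) \<partial>lborel)"
      by (simp add: nn_integral_cmult nn_integral_multc)
    also have "\<dots> < \<infinity>"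
      using f hm by (simp add: integrable_iff_bounded ennreal_mult_less_top heat_multiplier_nonneg)
    finally show "(\<integral>\<^sup>+p. ennreal (norm (case p of (z, \<xi>) \<Rightarrow> ?G z \<xi>)) \<partial>(lborel \<Otimes>\<^sub>M lborel)) < \<infinity>" .
  qed measurable
  have "complex_of_real (smoothing ?F \<epsilon> x) = (LINT z|lborel. complex_of_real (f z) * complex_of_real (heat_kernel \<epsilon> (x - (y + r *\<^sub>R z))))"
    unfolding sm by (simp only: integral_complex_of_real[symmetric] of_real_mult)
  also have "\<dots> = (LINT z|lborel. LINT \<xi>|lborel. ?G z \<xi>)"
    unfolding heat_kernel_fourier[OF e] by (simp only: integral_mult_right_zero)
  also have "\<dots> = (LINT \<xi>|lborel. LINT z|lborel. ?G z \<xi>)"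
    by (rule lborel_pair.Fubini_integral[OF int, symmetric])
  also have "\<dots> = (LINT \<xi>|lborel. complex_of_real (heat_multiplier \<epsilon> \<xi>) * (?h \<xi> * phase y \<xi>) * iexp (\<xi> \<bullet> x))"
  proof (intro Bochner_Integration.integral_cong refl)
    fix \<xi> :: "real ^ 'd"
    have G: "?G z \<xi> = (complex_of_real (heat_multiplier \<epsilon> \<xi>) * (phase y \<xi> * iexp (\<xi> \<bullet> x))) * (complex_of_real (f z) * iexp (- (r * (\<xi> \<bullet> z))))" for z
      by (simp add: phase_def inner_diff_right inner_add_right exp_add[symmetric] exp_diff[symmetric] algebra_simps)
    show "(LINT z|lborel. ?G z \<xi>) = complex_of_real (heat_multiplier \<epsilon> \<xi>) * (?h \<xi> * phase y \<xi>) * iexp (\<xi> \<bullet> x)"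
      unfolding G integral_mult_right_zero by (simp only: mult_ac)
  qed
  finally show "complex_of_real (smoothing ?F \<epsilon> x) = (LINT \<xi>|lborel. complex_of_real (heat_multiplier \<epsilon> \<xi>) * (?h \<xi> * phase y \<xi>) * iexp (\<xi> \<bullet> x))" .
qed

section \<open>The Taylor remainder as a Fourier multiplier\<close>

definition taylor_remainder :: "nat \<Rightarrow> real \<Rightarrow> complex" where
  "taylor_remainder \<beta> v = iexp v - (\<Sum>k\<le>\<beta>. (\<i> * complex_of_real v) ^ k / fact k)"

lemma taylor_remainder_measurable [measurable]: "taylor_remainder \<beta> \<in> borel_measurable borel"
  unfolding taylor_remainder_def[abs_def] by measurable

lemma norm_taylor_remainder_le:
  "norm (taylor_remainder \<beta> v) \<le> 2 * \<bar>v\<bar> ^ \<beta>" "norm (taylor_remainder \<beta> v) \<le> \<bar>v\<bar> ^ Suc \<beta>"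
proof -
  have "norm (taylor_remainder \<beta> v) \<le> 2 * \<bar>v\<bar> ^ \<beta> / fact \<beta>"
    unfolding taylor_remainder_def by (rule iexp_approx2)
  also have "\<dots> \<le> 2 * \<bar>v\<bar> ^ \<beta> / 1" by (intro divide_left_mono) auto
  finally show "norm (taylor_remainder \<beta> v) \<le> 2 * \<bar>v\<bar> ^ \<beta>" by simp
  have "norm (taylor_remainder \<beta> v) \<le> \<bar>v\<bar> ^ Suc \<beta> / fact (Suc \<beta>)"
    unfolding taylor_remainder_def by (rule iexp_approx1)
  also have "\<dots> \<le> \<bar>v\<bar> ^ Suc \<beta> / 1" using fact_ge_1[of "Suc \<beta>", where 'a = real] by (intro divide_left_mono) auto
  finally show "norm (taylor_remainder \<beta> v) \<le> \<bar>v\<bar> ^ Suc \<beta>" by simp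
qed

text \<open>The multiplier of the error term: the Taylor remainder of the Fourier transform of \<open>f\<close> at
  the frequency \<open>r *\<^sub>R \<xi>\<close>, divided by \<open>r ^ \<beta>\<close>.\<close>

definition error_symbol :: "(real ^ 'd::finite \<Rightarrow> real) \<Rightarrow> nat \<Rightarrow> real \<Rightarrow> real ^ 'd \<Rightarrow> complex" where
  "error_symbol f \<beta> r \<xi> = complex_of_real ((1 / r) ^ \<beta>) * (LINT z|lborel. complex_of_real (f z) * taylor_remainder \<beta> (- (r * (\<xi> \<bullet> z))))"

lemma error_integrand_le:
  fixes z :: "real ^ 'd::finite"
  assumes "r > 0"
  shows "norm (complex_of_real ((1 / r) ^ \<beta>) * (complex_of_real (f z) * taylor_remainder \<beta> (- (r * (\<xi> \<bullet> z)))))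
    \<le> 2 * norm \<xi> ^ \<beta> * (\<bar>f z\<bar> * norm z ^ \<beta>)"
proof -
  have "norm (taylor_remainder \<beta> (- (r * (\<xi> \<bullet> z)))) \<le> 2 * \<bar>- (r * (\<xi> \<bullet> z))\<bar> ^ \<beta>"
    by (rule norm_taylor_remainder_le)
  also have "\<dots> \<le> 2 * (r * (norm \<xi> * norm z)) ^ \<beta>"
    using assms Cauchy_Schwarz_ineq2[of \<xi> z] by (intro mult_left_mono power_mono) (auto simp: abs_mult)
  finally have "(1 / r) ^ \<beta> * (\<bar>f z\<bar> * norm (taylor_remainder \<beta> (- (r * (\<xi> \<bullet> z)))))
    \<le> (1 / r) ^ \<beta> * (\<bar>f z\<bar> * (2 * (r * (norm \<xi> * norm z)) ^ \<beta>))"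
    using assms by (intro mult_left_mono) auto
  also have "\<dots> = 2 * norm \<xi> ^ \<beta> * (\<bar>f z\<bar> * norm z ^ \<beta>)"
    using assms by (simp add: power_mult_distrib power_one_over)
  finally show ?thesis
    using assms by (simp add: norm_mult norm_power norm_divide power_one_over)
qed

context
  fixes f :: "real ^ 'd::finite \<Rightarrow> real" and \<beta> :: nat
  assumes f: "integrable lborel f" and fm: "integrable lborel (\<lambda>z. \<bar>f z\<bar> * norm z ^ \<beta>)"
begin

lemma f_measurable [measurable]: "f \<in> borel_measurable borel"
  using f by auto

lemma error_integrand_integrable:
  assumes "r > 0"
  shows "integrable lborel (\<lambda>z. complex_of_real ((1 / r) ^ \<beta>) * (complex_of_real (f z) * taylor_remainder \<beta> (- (r * (\<xi> \<bullet> z)))))"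
proof (rule Bochner_Integration.integrable_bound)
  show "integrable lborel (\<lambda>z. 2 * norm \<xi> ^ \<beta> * (\<bar>f z\<bar> * norm z ^ \<beta>))" using fm by simp
  show "AE z in lborel. norm (complex_of_real ((1 / r) ^ \<beta>) * (complex_of_real (f z) * taylor_remainder \<beta> (- (r * (\<xi> \<bullet> z)))))
    \<le> norm (2 * norm \<xi> ^ \<beta> * (\<bar>f z\<bar> * norm z ^ \<beta>))"
    using order_trans[OF error_integrand_le[OF assms] abs_ge_self] by (intro always_eventually allI) (simp only: real_norm_def)
qed measurable

lemma error_symbol_measurable [measurable]: "error_symbol f \<beta> r \<in> borel_measurable borel"
  unfolding error_symbol_def[abs_def] by measurable

lemma error_symbol_le:
  assumes "r > 0"
  shows "norm (error_symbol f \<beta> r \<xi>) \<le> 2 * (LINT z|lborel. \<bar>f z\<bar> * norm z ^ \<beta>) * (1 + norm \<xi>) ^ \<beta>"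
proof -
  let ?A = "LINT z|lborel. \<bar>f z\<bar> * norm z ^ \<beta>"
  have A: "?A \<ge> 0" by (intro integral_nonneg_AE) auto
  have "norm (error_symbol f \<beta> r \<xi>) \<le> (LINT z|lborel. norm (complex_of_real ((1 / r) ^ \<beta>) * (complex_of_real (f z) * taylor_remainder \<beta> (- (r * (\<xi> \<bullet> z))))))"
    unfolding error_symbol_def integral_mult_right_zero[symmetric] by (rule integral_norm_bound)
  also have "\<dots> \<le> (LINT z|lborel. 2 * norm \<xi> ^ \<beta> * (\<bar>f z\<bar> * norm z ^ \<beta>))"
    using fm by (intro integral_mono integrable_norm error_integrand_integrable[OF assms] error_integrand_le[OF assms]) auto
  also have "\<dots> = 2 * ?A * norm \<xi> ^ \<beta>" by simp
  also have "\<dots> \<le> 2 * ?A * (1 + norm \<xi>) ^ \<beta>"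
    using A by (intro mult_left_mono power_mono) auto
  finally show ?thesis .
qed

lemma error_symbol_tendsto:
  assumes r: "\<And>n. r n > 0" "r \<longlonglongrightarrow> 0"
  shows "(\<lambda>n. error_symbol f \<beta> (r n) \<xi>) \<longlonglongrightarrow> 0"
proof -
  let ?u = "\<lambda>n z. complex_of_real ((1 / r n) ^ \<beta>) * (complex_of_real (f z) * taylor_remainder \<beta> (- (r n * (\<xi> \<bullet> z))))"
  have "(\<lambda>n. LINT z|lborel. ?u n z) \<longlonglongrightarrow> integral\<^sup>L lborel (\<lambda>z :: real ^ 'd. 0 :: complex)"
  proof (rule integral_dominated_convergence)
    show "integrable lborel (\<lambda>z. 2 * norm \<xi> ^ \<beta> * (\<bar>f z\<bar> * norm z ^ \<beta>))" using fm by simp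
    show "AE z in lborel. norm (?u n z) \<le> 2 * norm \<xi> ^ \<beta> * (\<bar>f z\<bar> * norm z ^ \<beta>)" for n
      by (intro always_eventually allI error_integrand_le r)
    show "AE z in lborel. (\<lambda>n. ?u n z) \<longlonglongrightarrow> 0"
    proof (intro always_eventually allI)
      fix z :: "real ^ 'd"
      have le: "norm (?u n z) \<le> r n * (\<bar>f z\<bar> * \<bar>\<xi> \<bullet> z\<bar> ^ Suc \<beta>)" for n
      proof -
        have "norm (?u n z) = (1 / r n) ^ \<beta> * (\<bar>f z\<bar> * norm (taylor_remainder \<beta> (- (r n * (\<xi> \<bullet> z)))))"
          using r(1)[of n] by (simp add: norm_mult norm_power norm_divide power_one_over)
        also have "\<dots> \<le> (1 / r n) ^ \<beta> * (\<bar>f z\<bar> * \<bar>- (r n * (\<xi> \<bullet> z))\<bar> ^ Suc \<beta>)"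
          using r(1)[of n] by (intro mult_left_mono norm_taylor_remainder_le) auto
        also have "\<bar>- (r n * (\<xi> \<bullet> z))\<bar> ^ Suc \<beta> = r n ^ Suc \<beta> * \<bar>\<xi> \<bullet> z\<bar> ^ Suc \<beta>"
          using r(1)[of n] by (simp add: abs_mult power_mult_distrib mult_ac)
        also have "(1 / r n) ^ \<beta> * (\<bar>f z\<bar> * (r n ^ Suc \<beta> * \<bar>\<xi> \<bullet> z\<bar> ^ Suc \<beta>)) = ((1 / r n) ^ \<beta> * r n ^ Suc \<beta>) * (\<bar>f z\<bar> * \<bar>\<xi> \<bullet> z\<bar> ^ Suc \<beta>)"
          by (simp only: mult_ac)
        also have "(1 / r n) ^ \<beta> * r n ^ Suc \<beta> = r n"
          using r(1)[of n] by (simp add: power_one_over)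
        finally show ?thesis .
      qed
      show "(\<lambda>n. ?u n z) \<longlonglongrightarrow> 0"
      proof (rule Lim_null_comparison[OF always_eventually])
        show "\<forall>n. norm (?u n z) \<le> r n * (\<bar>f z\<bar> * \<bar>\<xi> \<bullet> z\<bar> ^ Suc \<beta>)" using le by blast
        show "(\<lambda>n. r n * (\<bar>f z\<bar> * \<bar>\<xi> \<bullet> z\<bar> ^ Suc \<beta>)) \<longlonglongrightarrow> 0"
          using tendsto_mult_right[OF r(2), of "\<bar>f z\<bar> * \<bar>\<xi> \<bullet> z\<bar> ^ Suc \<beta>"] by simp
      qed
    qed
  qed measurable
  then show ?thesis unfolding error_symbol_def by (simp only: integral_mult_right_zero integral_zero)
qed

text \<open>The hypothesis names \<open>\<tau>\<close> the part of positive degree of the Taylor polynomial, divided by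
  \<open>r ^ \<beta>\<close>; that this quotient is the same for all scales is where the vanishing of the lower moments
  of \<open>f\<close> enters.\<close>

lemma error_symbol_eq:
  assumes r: "r > 0"
    and taylor: "(LINT z|lborel. complex_of_real (f z) * (\<Sum>k\<le>\<beta>. (\<i> * complex_of_real (- (r * (\<xi> \<bullet> z)))) ^ k / fact k))
      = complex_of_real (LINT z|lborel. f z) + complex_of_real (r ^ \<beta>) * \<tau>"
  shows "error_symbol f \<beta> r \<xi> = complex_of_real ((1 / r) ^ \<beta>) *
    ((LINT z|lborel. complex_of_real (f z) * iexp (- (r * (\<xi> \<bullet> z)))) - complex_of_real (LINT z|lborel. f z)) - \<tau>"
proof -
  let ?S = "\<lambda>z. \<Sum>k\<le>\<beta>. (\<i> * complex_of_real (- (r * (\<xi> \<bullet> z)))) ^ k / fact k"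
  let ?c = "complex_of_real ((1 / r) ^ \<beta>)"
  have c: "?c \<noteq> 0" "?c * complex_of_real (r ^ \<beta>) = 1"
    using r by (simp_all add: power_one_over flip: of_real_mult of_real_power)
  have i1: "integrable lborel (\<lambda>z. complex_of_real (f z) * iexp (- (r * (\<xi> \<bullet> z))))"
  proof (rule Bochner_Integration.integrable_bound[OF f])
    show "AE z in lborel. norm (complex_of_real (f z) * iexp (- (r * (\<xi> \<bullet> z)))) \<le> norm (f z)"
      by (intro always_eventually allI) (simp only: norm_mult norm_exp_i_times norm_of_real mult_1_right real_norm_def order_refl)
  qed measurable
  have i2: "integrable lborel (\<lambda>z. complex_of_real (f z) * taylor_remainder \<beta> (- (r * (\<xi> \<bullet> z))))"
  proof -
    have cancel: "complex_of_real (r ^ \<beta>) * (?c * x) = x" for x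
      using c(2) by (metis mult.assoc mult.commute mult_1)
    then show ?thesis
      using integrable_mult_right[OF error_integrand_integrable[OF r, of \<xi>], of "complex_of_real (r ^ \<beta>)"]
      by (simp only: cancel)
  qed
  have "integrable lborel (\<lambda>z. complex_of_real (f z) * iexp (- (r * (\<xi> \<bullet> z))) - complex_of_real (f z) * taylor_remainder \<beta> (- (r * (\<xi> \<bullet> z))))"
    by (intro Bochner_Integration.integrable_diff i1 i2)
  then have i3: "integrable lborel (\<lambda>z. complex_of_real (f z) * ?S z)"
    unfolding right_diff_distrib[symmetric] taylor_remainder_def by (simp only: diff_diff_eq2 add_diff_cancel_left')
  have "(LINT z|lborel. complex_of_real (f z) * taylor_remainder \<beta> (- (r * (\<xi> \<bullet> z))))
    = (LINT z|lborel. complex_of_real (f z) * iexp (- (r * (\<xi> \<bullet> z)))) - (LINT z|lborel. complex_of_real (f z) * ?S z)"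
    unfolding taylor_remainder_def right_diff_distrib by (rule Bochner_Integration.integral_diff[OF i1 i3])
  then show ?thesis
    unfolding error_symbol_def taylor using c(2) by (simp add: right_diff_distrib distrib_left mult.assoc[symmetric])
qed

end

text \<open>For fixed \<open>r\<close> the smoothed error is the occupation functional with multiplier \<open>error_symbol\<close>
  times the phase and the heat multiplier. Its moments are bounded uniformly in \<open>\<epsilon>\<close>, and along a suitable sequence
  it converges almost surely to the error, so Fatou's lemma gives a bound in which only
  \<open>error_symbol\<close> depends on \<open>r\<close>.\<close>

lemma (in vector_process) rescaled_occupation_expansion:
  fixes f :: "real ^ 'd \<Rightarrow> real" and r :: "nat \<Rightarrow> real" and \<tau> :: "real ^ 'd \<Rightarrow> complex"
  assumes f: "integrable lborel f" and fm: "integrable lborel (\<lambda>z. \<bar>f z\<bar> * norm z ^ \<beta>)"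
    and t: "t > 0" and small: "H * (real CARD('d) + 2 * real \<beta>) < 1"
    and taylor: "\<And>r \<xi>. r > 0 \<Longrightarrow> (LINT z|lborel. complex_of_real (f z) * (\<Sum>k\<le>\<beta>. (\<i> * complex_of_real (- (r * (\<xi> \<bullet> z)))) ^ k / fact k))
      = complex_of_real (LINT z|lborel. f z) + complex_of_real (r ^ \<beta>) * \<tau> \<xi>"
    and T: "mollified (\<lambda>\<xi>. \<tau> \<xi> * phase y \<xi>) T"
    and L: "finite_moments M L" "moments_vanish M (\<lambda>\<epsilon> w. occupation X (\<lambda>x. heat_kernel \<epsilon> (x - y)) t w - L w) (at_right 0)"
    and Tl: "finite_moments M Tl" "moments_vanish M (\<lambda>\<epsilon> w. occupation X (T \<epsilon>) t w - Tl w) (at_right 0)"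
    and r: "\<And>n. r n > 0" "r \<longlonglongrightarrow> 0"
  defines "D \<equiv> \<lambda>n w. (1 / r n) ^ \<beta> * ((1 / r n) ^ CARD('d) * occupation X (\<lambda>x. f ((1 / r n) *\<^sub>R (x - y))) t w
      - L w * (LINT x|lborel. f x)) - Tl w"
  shows "\<And>n. finite_moments M (D n)" and "moments_vanish M D sequentially"
proof -
  have [measurable]: "f \<in> borel_measurable borel" using f by auto
  have [measurable]: "L \<in> borel_measurable M" "Tl \<in> borel_measurable M"
    using L(1) Tl(1) by (auto simp: finite_moments_def)
  have D_meas [measurable]: "D n \<in> borel_measurable M" for n unfolding D_def by measurable
  define A where "A = 2 * (LINT z|lborel. \<bar>f z\<bar> * norm z ^ \<beta>)"
  have A: "A \<ge> 0" unfolding A_def by (intro mult_nonneg_nonneg integral_nonneg_AE) auto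
  define a where "a = (2 * pi) powr (- real CARD('d))"
  have a: "a > 0" by (simp add: a_def)
  define C where "C = a * A + 1"
  have C: "C \<ge> 1" using a A by (simp add: C_def)
  define m where "m n \<xi> = error_symbol f \<beta> (r n) \<xi>" for n \<xi>
  have [measurable]: "m n \<in> borel_measurable borel" for n
    unfolding m_def[abs_def] by (rule error_symbol_measurable[OF f fm])
  have m_le: "a * norm (m n \<xi>) \<le> C * (1 + norm \<xi>) ^ \<beta>" for n \<xi>
  proof -
    have "a * norm (m n \<xi>) \<le> a * (A * (1 + norm \<xi>) ^ \<beta>)"
      unfolding m_def A_def using a by (intro mult_left_mono error_symbol_le[OF f fm r(1)]) auto
    also have "\<dots> \<le> C * (1 + norm \<xi>) ^ \<beta>"
      unfolding mult.assoc[symmetric] C_def by (intro mult_right_mono) auto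
    finally show ?thesis .
  qed
  define e where "e k = inverse (real (Suc k))" for k
  have e: "e k > 0" "e \<longlonglongrightarrow> 0" for k
    using LIMSEQ_inverse_real_of_nat by (auto simp: e_def[abs_def])
  have hm_le: "heat_multiplier \<epsilon> \<xi> \<le> a" if "\<epsilon> > 0" for \<epsilon> and \<xi> :: "real ^ 'd"
    using that by (simp add: heat_multiplier_def a_def)
  \<comment> \<open>The bound holds uniformly in the mollification parameter and survives its removal.\<close>
  have moment: "\<exists>W. moment_weight t N (\<lambda>\<xi>. C * (1 + norm \<xi>) ^ \<beta>) W \<and>
      (\<forall>n. (\<integral>\<^sup>+w. ennreal (D n w ^ N) \<partial>M) \<le> (\<integral>\<^sup>+\<xi>. ennreal (a * norm (m n \<xi>)) * W \<xi> \<partial>lborel))"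
    if N: "even N" "N \<noteq> 0" for N
  proof -
    obtain W where W: "moment_weight t N (\<lambda>\<xi>. C * (1 + norm \<xi>) ^ \<beta>) W"
      using moment_weight_exists[OF N t _ C, of \<beta>] small by auto
    have "(\<integral>\<^sup>+w. ennreal (D n w ^ N) \<partial>M) \<le> (\<integral>\<^sup>+\<xi>. ennreal (a * norm (m n \<xi>)) * W \<xi> \<partial>lborel)" for n
    proof -
      define q where "q = r n"
      have q: "q > 0" by (simp add: q_def r)
      let ?If = "LINT x|lborel. f x"
      define F where "F = (\<lambda>x. (1 / q) ^ CARD('d) * f ((1 / q) *\<^sub>R (x - y)))"
      have F: "integrable lborel F"
      proof -
        have "integrable lborel (\<lambda>x. f ((- (1 / q)) *\<^sub>R y + (1 / q) *\<^sub>R x))"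
          using q by (intro lborel_scale_integrable f) auto
        then show ?thesis unfolding F_def by (intro integrable_mult_right) (simp add: scaleR_diff_right)
      qed
      have [measurable]: "F \<in> borel_measurable borel" using F by auto
      have occF: "occupation X F t w = (1 / q) ^ CARD('d) * occupation X (\<lambda>x. f ((1 / q) *\<^sub>R (x - y))) t w" for w
        unfolding occupation_def F_def by (rule set_integral_mult_right)
      define p where "p \<epsilon> x = heat_kernel \<epsilon> (x - y)" for \<epsilon> x
      have [measurable]: "p \<epsilon> \<in> borel_measurable borel" for \<epsilon> unfolding p_def[abs_def] by measurable
      have fo1: "fourier_of (\<lambda>\<xi>. complex_of_real (heat_multiplier \<epsilon> \<xi>) *
          ((LINT z|lborel. complex_of_real (f z) * iexp (- (q * (\<xi> \<bullet> z)))) * phase y \<xi>)) (smoothing F \<epsilon>)" if "\<epsilon> > 0" for \<epsilon>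
        using smoothing_mollified[OF f q, of y] that unfolding mollified_def F_def by blast
      have fo2: "fourier_of (\<lambda>\<xi>. complex_of_real (heat_multiplier \<epsilon> \<xi>) * phase y \<xi>) (p \<epsilon>)" if "\<epsilon> > 0" for \<epsilon>
        using heat_kernel_mollified[of y] that unfolding mollified_def p_def by blast
      have fo3: "fourier_of (\<lambda>\<xi>. complex_of_real (heat_multiplier \<epsilon> \<xi>) * (\<tau> \<xi> * phase y \<xi>)) (T \<epsilon>)" if "\<epsilon> > 0" for \<epsilon>
        using T that unfolding mollified_def by blast
      define g where "g \<epsilon> x = (1 / q) ^ \<beta> * (smoothing F \<epsilon> x - ?If * p \<epsilon> x) - T \<epsilon> x" for \<epsilon> x
      let ?b = "\<lambda>\<epsilon> \<xi>. complex_of_real (heat_multiplier \<epsilon> \<xi>) * (m n \<xi> * phase y \<xi>)"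
      have fog: "fourier_of (?b \<epsilon>) (g \<epsilon>)" if \<epsilon>: "\<epsilon> > 0" for \<epsilon>
      proof -
        have alg: "h * ((c * (P - I) - \<tau>0) * ph) = c * (h * (P * ph) - I * (h * ph)) - h * (\<tau>0 * ph)" for h c P I \<tau>0 ph :: complex
          by (simp add: algebra_simps)
        have m_eq: "m n \<xi> = complex_of_real ((1 / q) ^ \<beta>) *
          ((LINT z|lborel. complex_of_real (f z) * iexp (- (q * (\<xi> \<bullet> z)))) - complex_of_real ?If) - \<tau> \<xi>" for \<xi>
          unfolding m_def q_def[symmetric] by (rule error_symbol_eq[OF f fm q taylor[OF q]])
        have eq: "?b \<epsilon> \<xi> = complex_of_real ((1 / q) ^ \<beta>) * (complex_of_real (heat_multiplier \<epsilon> \<xi>) *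
          ((LINT z|lborel. complex_of_real (f z) * iexp (- (q * (\<xi> \<bullet> z)))) * phase y \<xi>)
          - complex_of_real ?If * (complex_of_real (heat_multiplier \<epsilon> \<xi>) * phase y \<xi>))
          - complex_of_real (heat_multiplier \<epsilon> \<xi>) * (\<tau> \<xi> * phase y \<xi>)" for \<xi>
          unfolding m_eq by (rule alg)
        show ?thesis
          unfolding eq g_def[abs_def] by (intro fourier_of_diff fourier_of_cmult fo1 fo2 fo3 \<epsilon>)
      qed
      have bound: "(\<integral>\<^sup>+w. ennreal (occupation X (g \<epsilon>) t w ^ N) \<partial>M) \<le> (\<integral>\<^sup>+\<xi>. ennreal (a * norm (m n \<xi>)) * W \<xi> \<partial>lborel)"
        if \<epsilon>: "\<epsilon> > 0" for \<epsilon>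
      proof -
        have bm: "norm (?b \<epsilon> \<xi>) \<le> a * norm (m n \<xi>)" for \<xi>
          using hm_le[OF \<epsilon>, of \<xi>] by (simp add: norm_mult heat_multiplier_nonneg mult_right_mono)
        have "(\<integral>\<^sup>+w. ennreal (occupation X (g \<epsilon>) t w ^ N) \<partial>M) \<le> (\<integral>\<^sup>+\<xi>. ennreal (norm (?b \<epsilon> \<xi>)) * W \<xi> \<partial>lborel)"
          by (rule moment_weightD[OF W fog[OF \<epsilon>]]) (rule order_trans[OF bm m_le])
        also have "\<dots> \<le> (\<integral>\<^sup>+\<xi>. ennreal (a * norm (m n \<xi>)) * W \<xi> \<partial>lborel)"
          by (intro nn_integral_mono mult_right_mono ennreal_leI bm) auto
        finally show ?thesis .
      qed
      have small0: "H * real CARD('d) < 1"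
      proof -
        have "H * real CARD('d) \<le> H * (real CARD('d) + 2 * real \<beta>)" using H_pos by (intro mult_left_mono) auto
        with small show ?thesis by linarith
      qed
      have Tm [measurable]: "T (e k) \<in> borel_measurable borel" for k
        by (rule fourier_of_measurable[OF fo3[OF e(1)]])
      have er: "filterlim (\<lambda>k. e (s k)) (at_right 0) sequentially" if "strict_mono s" for s
      proof -
        have "(\<lambda>k. e (s k)) \<longlonglongrightarrow> 0" using LIMSEQ_subseq_LIMSEQ[OF e(2) that] by (simp add: comp_def)
        then show ?thesis using e(1) by (auto simp: filterlim_at intro!: always_eventually) (metis less_irrefl)
      qed
      obtain s1 where s1: "strict_mono s1" "AE w in M. (\<lambda>k. occupation X (smoothing F (e (s1 k))) t w - occupation X F t w) \<longlonglongrightarrow> 0"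
        using nn_L1_AE_subseq[OF _ occupation_smoothing_converges[OF F t small0 e]] by auto
      obtain s2 where s2: "strict_mono s2" "AE w in M. (\<lambda>k. occupation X (p (e (s1 (s2 k)))) t w - L w) \<longlonglongrightarrow> 0"
        using moments_vanish_AE_subseq[where D = "\<lambda>\<epsilon> w. occupation X (p \<epsilon>) t w - L w" and e = "\<lambda>k. e (s1 k)",
            OF _ L(2)[folded p_def] er[OF s1(1)]] by auto
      have s12: "strict_mono (\<lambda>k. s1 (s2 k))" using strict_mono_o[OF s1(1) s2(1)] by (simp add: comp_def)
      obtain s3 where s3: "strict_mono s3" "AE w in M. (\<lambda>k. occupation X (T (e (s1 (s2 (s3 k))))) t w - Tl w) \<longlonglongrightarrow> 0"
        using moments_vanish_AE_subseq[where D = "\<lambda>\<epsilon> w. occupation X (T \<epsilon>) t w - Tl w" and e = "\<lambda>k. e (s1 (s2 k))",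
            OF _ Tl(2) er[OF s12]] by auto
      have s23: "strict_mono (\<lambda>k. s2 (s3 k))" using strict_mono_o[OF s2(1) s3(1)] by (simp add: comp_def)
      define s where "s k = e (s1 (s2 (s3 k)))" for k
      have s0: "s k > 0" for k by (simp add: s_def e)
      have [measurable]: "T (s k) \<in> borel_measurable borel" for k by (simp add: s_def)
      have "AE w in M. (\<lambda>k. occupation X (g (s k)) t w) \<longlonglongrightarrow> D n w"
        using s1(2) s2(2) s3(2) AE_space
      proof eventually_elim
        case (elim w)
        have l1: "(\<lambda>k. occupation X (smoothing F (s k)) t w) \<longlonglongrightarrow> occupation X F t w"
          unfolding s_def
          by (rule LIM_zero_cancel[OF filterlim_compose[OF elim(1) filterlim_subseq[OF s23]]])
        have l2: "(\<lambda>k. occupation X (p (s k)) t w) \<longlonglongrightarrow> L w"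
          unfolding s_def
          by (rule LIM_zero_cancel[OF filterlim_compose[OF elim(2) filterlim_subseq[OF s3(1)]]])
        have l3: "(\<lambda>k. occupation X (T (s k)) t w) \<longlonglongrightarrow> Tl w"
          unfolding s_def by (rule LIM_zero_cancel[OF elim(3)])
        have "occupation X (g (s k)) t w = (1 / q) ^ \<beta> * (occupation X (smoothing F (s k)) t w - ?If * occupation X (p (s k)) t w) - occupation X (T (s k)) t w" for k
        proof -
          note int = occupation_integrable[OF fo1[OF s0] elim(4), of t k] occupation_integrable[OF fo2[OF s0] elim(4), of t k]
            occupation_integrable[OF fo3[OF s0] elim(4), of t k]
          show ?thesis
            unfolding occupation_def g_def using int
            by (simp add: set_integral_diff set_integral_mult_right)
        qed
        moreover have "(\<lambda>k. (1 / q) ^ \<beta> * (occupation X (smoothing F (s k)) t w - ?If * occupation X (p (s k)) t w) - occupation X (T (s k)) t w)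
          \<longlonglongrightarrow> (1 / q) ^ \<beta> * (occupation X F t w - ?If * L w) - Tl w"
          by (intro tendsto_intros l1 l2 l3)
        moreover have "(1 / q) ^ \<beta> * (occupation X F t w - ?If * L w) - Tl w = D n w"
          unfolding D_def occF q_def by (simp only: mult.commute[of "L w"])
        ultimately show ?case by simp
      qed
      then show ?thesis
      proof (rule moment_fatou[rotated, OF _ N(1) always_eventually[OF allI[OF bound[OF s0]]]])
        have [measurable]: "g (s k) \<in> borel_measurable borel" for k by (rule fourier_of_measurable[OF fog[OF s0]])
        show "occupation X (g (s k)) t \<in> borel_measurable M" for k by measurable
      qed
    qed
    then show ?thesis using W by blast
  qed
  show "finite_moments M (D n)" for n
    unfolding finite_moments_def
  proof (intro conjI allI impI D_meas)
    fix N :: nat assume N: "even N" "N \<noteq> 0"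
    obtain W where W: "moment_weight t N (\<lambda>\<xi>. C * (1 + norm \<xi>) ^ \<beta>) W"
      and le: "(\<integral>\<^sup>+w. ennreal (D n w ^ N) \<partial>M) \<le> (\<integral>\<^sup>+\<xi>. ennreal (a * norm (m n \<xi>)) * W \<xi> \<partial>lborel)"
      using moment[OF N] by blast
    note le
    also have "(\<integral>\<^sup>+\<xi>. ennreal (a * norm (m n \<xi>)) * W \<xi> \<partial>lborel) \<le> (\<integral>\<^sup>+\<xi>. ennreal (C * (1 + norm \<xi>) ^ \<beta>) * W \<xi> \<partial>lborel)"
      by (intro nn_integral_mono mult_right_mono ennreal_leI m_le) simp
    also have "\<dots> < \<infinity>" using W by (simp add: moment_weight_def)
    finally show "(\<integral>\<^sup>+w. ennreal (D n w ^ N) \<partial>M) < \<infinity>" .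
  qed
  show "moments_vanish M D sequentially"
    unfolding moments_vanish_def
  proof (intro allI impI)
    fix N :: nat assume N: "even N" "N \<noteq> 0"
    obtain W where W: "moment_weight t N (\<lambda>\<xi>. C * (1 + norm \<xi>) ^ \<beta>) W"
      and le: "\<And>n. (\<integral>\<^sup>+w. ennreal (D n w ^ N) \<partial>M) \<le> (\<integral>\<^sup>+\<xi>. ennreal (a * norm (m n \<xi>)) * W \<xi> \<partial>lborel)"
      using moment[OF N] by blast
    have lim: "(\<lambda>n. \<integral>\<^sup>+\<xi>. ennreal (a * norm (m n \<xi>)) * W \<xi> \<partial>lborel) \<longlonglongrightarrow> 0"
    proof (rule moment_weight_tendsto[OF W _ _ _ m_le])
      show "0 < C * (1 + norm \<xi>) ^ \<beta>" for \<xi> :: "real ^ 'd"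
        using C by (intro mult_pos_pos zero_less_power add_pos_nonneg) auto
      fix \<xi> :: "real ^ 'd"
      have "(\<lambda>n. a * norm (m n \<xi>)) \<longlonglongrightarrow> a * norm (0 :: complex)"
        unfolding m_def by (intro tendsto_intros error_symbol_tendsto[OF f fm r])
      then show "(\<lambda>n. a * norm (m n \<xi>)) \<longlonglongrightarrow> 0" by simp
    qed measurable
    show "(\<lambda>n. \<integral>\<^sup>+w. ennreal (D n w ^ N) \<partial>M) \<longlonglongrightarrow> 0"
      by (rule tendsto_sandwich[OF _ _ tendsto_const lim]) (auto intro!: always_eventually le)
  qed
qed

section \<open>Processes in the class $G^{H,d}_L$\<close>

lemma centered_gaussian_facts:
  assumes "prob_space M" "centered_gaussian M Z"
  shows "square_integrable M Z" and "(LINT w|M. Z w) = 0"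
    and "norm (LINT w|M. iexp (Z w)) = exp (- (LINT w|M. (Z w)\<^sup>2) / 2)"
proof -
  interpret prob_space M by fact
  have [measurable]: "Z \<in> borel_measurable M" using assms(2) by (simp add: centered_gaussian_def)
  have "square_integrable M Z \<and> (LINT w|M. Z w) = 0 \<and> norm (LINT w|M. iexp (Z w)) = exp (- (LINT w|M. (Z w)\<^sup>2) / 2)"
  proof (cases "AE w in M. Z w = 0")
    case True
    have 1: "(LINT w|M. Z w) = (LINT w|M. 0)" by (rule integral_cong_AE) (use True in auto)
    have 2: "(LINT w|M. (Z w)\<^sup>2) = (LINT w|M. 0)" by (rule integral_cong_AE) (use True in auto)
    have 3: "(LINT w|M. iexp (Z w)) = (LINT w|M. 1)" by (rule integral_cong_AE) (use True in auto)
    have 4: "integrable M (\<lambda>w. (Z w)\<^sup>2)"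
      by (rule integrable_cong_AE_imp[of _ "\<lambda>_. 0"]) (use True in auto)
    show ?thesis unfolding 1 2 3 using 4 by (simp add: prob_space square_integrable_def)
  next
    case False
    then obtain \<sigma> where s: "\<sigma> > 0" and D: "distributed M lborel Z (normal_density 0 \<sigma>)"
      using assms(2) by (auto simp: centered_gaussian_def)
    have m: "(LINT w|M. Z w) = 0" by (rule normal_distributed_expectation[OF s D])
    have v: "(LINT w|M. (Z w)\<^sup>2) = \<sigma>\<^sup>2"
      using normal_distributed_variance[OF s D] by (simp add: m)
    have i: "integrable M (\<lambda>w. (Z w)\<^sup>2)"
      using integrable_normal_moment[OF s, of 0 2] distributed_integrable[OF D, of "\<lambda>x. x\<^sup>2"] by simp
    have D1: "distributed M lborel (\<lambda>w. Z w / \<sigma>) std_normal_density"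
      using D normal_standard_normal_convert[OF s, of Z 0] by simp
    have "(LINT w|M. iexp (Z w)) = (LINT w|M. iexp (\<sigma> * (Z w / \<sigma>)))"
      using s by simp
    also have "\<dots> = (LINT x|distr M lborel (\<lambda>w. Z w / \<sigma>). iexp (\<sigma> * x))"
      by (subst integral_distr) auto
    also have "distr M lborel (\<lambda>w. Z w / \<sigma>) = std_normal_distribution"
      using distributed_distr_eq_density[OF D1] by simp
    also have "(LINT x|std_normal_distribution. iexp (\<sigma> * x)) = complex_of_real (exp (- \<sigma>\<^sup>2 / 2))"
      using fun_cong[OF char_std_normal_distribution, of \<sigma>] by (simp add: char_def)
    finally have c: "norm (LINT w|M. iexp (Z w)) = exp (- \<sigma>\<^sup>2 / 2)" by simp
    show ?thesis unfolding v using m i c by (simp add: square_integrable_def)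
  qed
  then show "square_integrable M Z" "(LINT w|M. Z w) = 0"
    "norm (LINT w|M. iexp (Z w)) = exp (- (LINT w|M. (Z w)\<^sup>2) / 2)" by auto
qed

context
  fixes M :: "'a measure" and X :: "real \<Rightarrow> 'a \<Rightarrow> real ^ 'd::finite" and H :: real
  assumes M: "prob_space M" and X: "X \<in> G_class M H" and H: "H > 0"
begin

interpretation prob_space M by (rule M)

lemma X_measurable_at: "s \<ge> 0 \<Longrightarrow> X s \<in> borel_measurable M"
  using X by (simp add: G_class_def centered_gaussian_process_def)

lemma gaussian_combination:
  "finite T \<Longrightarrow> T \<subseteq> {0..} \<Longrightarrow> centered_gaussian M (\<lambda>w. \<Sum>s\<in>T. c s \<bullet> X s w)"
  using X by (simp add: G_class_def centered_gaussian_process_def)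

lemma component_inner: "component X i s w = axis i 1 \<bullet> X s w"
  by (simp add: component_def inner_axis' )

lemma component_gaussian:
  assumes "s \<ge> 0"
  shows "centered_gaussian M (component X i s)"
  using gaussian_combination[of "{s}" "\<lambda>_. axis i 1"] assms by (simp add: component_inner[abs_def])

lemma component_square_integrable: "s > 0 \<Longrightarrow> square_integrable M (component X i s)"
  by (rule centered_gaussian_facts(1)[OF M component_gaussian]) simp

lemma component_mean: "s > 0 \<Longrightarrow> (LINT w|M. component X i s w) = 0"
  by (rule centered_gaussian_facts(2)[OF M component_gaussian]) simp

lemma sample_path_measurable:
  assumes "\<And>s. s \<ge> 0 \<Longrightarrow> Y s \<in> borel_measurable M"
  shows "sample_path Y \<in> M \<rightarrow>\<^sub>M PiM {0..} (\<lambda>_. borel)"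
  unfolding sample_path_def[abs_def] by (rule measurable_restrict) (use assms in auto)

lemma component_second_moment:
  assumes "s > 0"
  shows "(LINT w|M. (component X i s w)\<^sup>2) = s powr (2 * H) * (LINT w|M. (component X i 1 w)\<^sup>2)"
proof -
  have law: "process_law M (\<lambda>t. X (s * t)) = process_law M (\<lambda>t w. (s powr H) *\<^sub>R X t w)"
    using X assms by (simp add: G_class_def self_similar_def)
  have m1: "sample_path (\<lambda>t. X (s * t)) \<in> M \<rightarrow>\<^sub>M PiM {0..} (\<lambda>_. borel)"
    using assms by (intro sample_path_measurable X_measurable_at) auto
  have m2: "sample_path (\<lambda>t w. (s powr H) *\<^sub>R X t w) \<in> M \<rightarrow>\<^sub>M PiM {0..} (\<lambda>_. borel)"
    using X_measurable_at by (intro sample_path_measurable borel_measurable_scaleR) auto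
  have ev: "(\<lambda>x. (axis i 1 \<bullet> x (1 :: real))\<^sup>2) \<in> borel_measurable (PiM {0..} (\<lambda>_. borel :: (real ^ 'd) measure))"
  proof -
    have [measurable]: "(\<lambda>x. x (1 :: real)) \<in> PiM {0..} (\<lambda>_. borel :: (real ^ 'd) measure) \<rightarrow>\<^sub>M borel"
      by (rule measurable_component_singleton) simp
    show ?thesis by measurable
  qed
  have "(LINT w|M. (component X i s w)\<^sup>2) = (LINT x|process_law M (\<lambda>t. X (s * t)). (axis i 1 \<bullet> x 1)\<^sup>2)"
    unfolding process_law_def by (subst integral_distr[OF m1 ev]) (simp add: sample_path_def component_inner)
  also have "\<dots> = (LINT w|M. ((s powr H) * component X i 1 w)\<^sup>2)"
    unfolding law unfolding process_law_def
    by (subst integral_distr[OF m2 ev]) (simp add: sample_path_def component_inner)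
  also have "\<dots> = s powr (2 * H) * (LINT w|M. (component X i 1 w)\<^sup>2)"
  proof -
    have "(s powr H)\<^sup>2 = s powr (2 * H)" by (simp add: power2_eq_square powr_add[symmetric])
    then show ?thesis by (simp add: power_mult_distrib)
  qed
  finally show ?thesis .
qed

text \<open>Assumption (A) bounds increments that are short compared with the time at which they start. A long
  increment is comparable with both of its end points, whose variances are known from
  self-similarity.\<close>

lemma component_increment_le:
  "\<exists>C\<ge>0. \<forall>s t. 0 < s \<and> s < t \<longrightarrow> (LINT w|M. (component X i t w - component X i s w)\<^sup>2) \<le> C * (t - s) powr (2 * H)"
proof -
  define Y where "Y = component X i"
  have "assumption_A M H Y" using X by (simp add: G_class_def Y_def)
  then obtain \<eta> \<sigma> \<phi> where "\<eta> \<ge> 1" "\<sigma> > 0" and \<phi>0: "\<And>x. x \<in> {0..1/\<eta>} \<Longrightarrow> 0 \<le> \<phi> x" and mono: "mono_on {0..1/\<eta>} \<phi>"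
    and up: "\<And>t h. \<lbrakk>t > 0; h \<in> {0..t/\<eta>}\<rbrakk> \<Longrightarrow> variance (\<lambda>w. Y (t + h) w - Y t w) \<le> h powr (2 * H) * (\<sigma> + \<phi> (h / t))"
    unfolding assumption_A_def by blast
  define v where "v = (LINT w|M. (Y 1 w)\<^sup>2)"
  have v: "v \<ge> 0" unfolding v_def by (intro integral_nonneg_AE) auto
  have sm: "(LINT w|M. (Y s w)\<^sup>2) = s powr (2 * H) * v" if "s > 0" for s
    unfolding v_def Y_def by (rule component_second_moment[OF that])
  define C where "C = (\<sigma> + \<phi> (1 / \<eta>)) + 4 * v * (\<eta> + 1) powr (2 * H)"
  have C1: "\<sigma> + \<phi> (1 / \<eta>) \<ge> 0" using \<phi>0[of "1 / \<eta>"] \<open>\<sigma> > 0\<close> \<open>\<eta> \<ge> 1\<close> by simp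
  show ?thesis
  proof (intro exI[of _ C] conjI allI impI)
    show "C \<ge> 0" unfolding C_def using C1 v by simp
    fix s t :: real assume st: "0 < s \<and> s < t"
    define h where "h = t - s"
    have h: "h > 0" "t = s + h" using st by (auto simp: h_def)
    have sq: "square_integrable M (Y t)" "square_integrable M (Y s)"
      unfolding Y_def using st by (auto intro: component_square_integrable)
    have int: "integrable M W" if "square_integrable M W" for W
      using square_integrable_mult[OF that, of "\<lambda>_. 1"] by (simp add: square_integrable_def)
    show "(LINT w|M. (component X i t w - component X i s w)\<^sup>2) \<le> C * (t - s) powr (2 * H)"
    proof (cases "h \<le> s / \<eta>")
      case True
      have "(LINT w|M. Y t w - Y s w) = 0"
        using int[OF sq(1)] int[OF sq(2)] st component_mean[of t i] component_mean[of s i] by (simp add: Y_def)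
      then have "(LINT w|M. (Y t w - Y s w)\<^sup>2) = variance (\<lambda>w. Y t w - Y s w)" by simp
      also have "\<dots> \<le> h powr (2 * H) * (\<sigma> + \<phi> (h / s))"
        unfolding h(2) using True st h by (intro up) auto
      also have "\<dots> \<le> h powr (2 * H) * (\<sigma> + \<phi> (1 / \<eta>))"
      proof -
        have "h / s \<le> 1 / \<eta>" using True st \<open>\<eta> \<ge> 1\<close> by (simp add: field_simps)
        then have "\<phi> (h / s) \<le> \<phi> (1 / \<eta>)"
          using h st \<open>\<eta> \<ge> 1\<close> by (intro mono_onD[OF mono]) auto
        then show ?thesis by (intro mult_left_mono) auto
      qed
      also have "\<dots> \<le> h powr (2 * H) * C" unfolding C_def using v by (intro mult_left_mono) auto
      finally show ?thesis by (simp add: Y_def h_def mult.commute)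
    next
      case False
      have sh: "s \<le> \<eta> * h" using False \<open>\<eta> \<ge> 1\<close> by (simp add: field_simps)
      have t_le: "t \<le> (\<eta> + 1) * h" "s \<le> (\<eta> + 1) * h" using sh h by (auto simp: distrib_right)
      have "(LINT w|M. (Y t w - Y s w)\<^sup>2) = (LINT w|M. (Y t w + (- 1) * Y s w)\<^sup>2)" by simp
      also have "\<dots> \<le> 2 * (LINT w|M. (Y t w)\<^sup>2) + 2 * (LINT w|M. ((- 1) * Y s w)\<^sup>2)"
        by (intro second_moment_add_le square_integrable_cmult sq)
      also have "\<dots> = 2 * (t powr (2 * H) * v) + 2 * (s powr (2 * H) * v)"
        using st by (simp add: sm)
      also have "\<dots> \<le> 2 * (((\<eta> + 1) * h) powr (2 * H) * v) + 2 * (((\<eta> + 1) * h) powr (2 * H) * v)"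
        using t_le st H v by (intro add_mono mult_left_mono mult_right_mono powr_mono2) auto
      also have "\<dots> = 4 * v * (\<eta> + 1) powr (2 * H) * h powr (2 * H)"
        using \<open>\<eta> \<ge> 1\<close> h by (simp add: powr_mult)
      also have "\<dots> \<le> C * h powr (2 * H)" unfolding C_def using C1 by (intro mult_right_mono) auto
      finally show ?thesis by (simp add: Y_def h_def)
    qed
  qed
qed

text \<open>The variance at time \<open>1\<close> is positive by nondeterminism, applied to a trivial combination of the
  past.\<close>

lemma component_chain_variance:
  "\<exists>c>0. \<forall>r>0. \<forall>u L. ascending r L \<and> length L = n \<longrightarrow>
     (LINT w|M. (u * component X i r w + increments (component X i) r L w)\<^sup>2) \<ge> c * (u\<^sup>2 * r powr (2 * H) + energy H r L)"
proof -
  have "strongly_locally_nondeterministic M H (component X i)" using X by (simp add: G_class_def)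
  from strongly_locally_nondeterministic_combination[OF M component_square_integrable this H]
  obtain \<kappa> where \<kappa>: "\<kappa> > 0" "\<And>q t Z u. \<lbrakk>past_combination (component X i) q Z; 0 < q; q < t\<rbrakk> \<Longrightarrow>
    (LINT w|M. (Z w + u * component X i t w)\<^sup>2) \<ge> \<kappa> * u\<^sup>2 * (t - q) powr (2 * H)" by blast
  obtain C where C: "C \<ge> 0" "\<And>s t. \<lbrakk>0 < s; s < t\<rbrakk> \<Longrightarrow> (LINT w|M. (component X i t w - component X i s w)\<^sup>2) \<le> C * (t - s) powr (2 * H)"
    using component_increment_le[of i] by blast
  define v where "v = (LINT w|M. (component X i 1 w)\<^sup>2)"
  have "v > 0"
  proof -
    have "past_combination (component X i) (1/2) (\<lambda>w. 0 * component X i (1/2) w)"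
      by (rule past_combination_single) simp
    from \<kappa>(2)[OF this, of 1 1] have "\<kappa> * (1/2) powr (2 * H) \<le> v" by (simp add: v_def)
    moreover have "\<kappa> * (1/2) powr (2 * H) > 0" using \<kappa> by simp
    ultimately show ?thesis by linarith
  qed
  show ?thesis
  proof (rule variance_ge_energy[where M = M and Y = "component X i" and H = H and \<kappa> = \<kappa> and C = C and v = v])
    show "(LINT w|M. (component X i s w)\<^sup>2) \<ge> v * s powr (2 * H)" if "s > 0" for s
      using component_second_moment[OF that, of i] by (simp add: v_def mult.commute)
  qed (fact component_square_integrable \<kappa> C \<open>v > 0\<close>)+
qed

lemma components_uncorrelated:
  assumes "i \<noteq> j" "s > 0" "t > 0"
  shows "(LINT w|M. component X i s w * component X j t w) = 0"
proof -
  define \<theta> where "\<theta> k = (if k = i then s else t)" for k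
  have \<theta>0: "\<theta> k \<ge> 0" for k using assms by (simp add: \<theta>_def)
  have "indep_vars (\<lambda>_. PiM {0..} (\<lambda>_. borel)) (\<lambda>i. sample_path (component X i)) UNIV"
    using X by (simp add: G_class_def iid_components_def)
  then have "indep_vars (\<lambda>_. borel) (\<lambda>k w. sample_path (component X k) w (\<theta> k)) UNIV"
    by (rule indep_vars_compose2[where Y = "\<lambda>k x. x (\<theta> k)"])
      (rule measurable_component_singleton, use assms in \<open>simp add: \<theta>_def\<close>)
  then have "indep_vars (\<lambda>_. borel) (\<lambda>k w. component X k (\<theta> k) w) UNIV"
    using \<theta>0 by (simp add: sample_path_def)
  then have ind: "indep_vars (\<lambda>_. borel) (\<lambda>k w. component X k (\<theta> k) w) {i, j}"
    by (rule indep_vars_subset) simp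
  have int: "integrable M (component X k (\<theta> k))" for k
    using square_integrable_mult[OF component_square_integrable[of "\<theta> k" k], of "\<lambda>_. 1"] assms
    by (simp add: square_integrable_def \<theta>_def)
  have "(LINT w|M. (\<Prod>k\<in>{i, j}. component X k (\<theta> k) w)) = (\<Prod>k\<in>{i, j}. LINT w|M. component X k (\<theta> k) w)"
    by (rule indep_vars_lebesgue_integral[OF _ ind int]) simp
  then show ?thesis
    using assms by (simp add: \<theta>_def component_mean)
qed

lemma increments_components:
  fixes L :: "(real \<times> (real ^ 'd)) list"
  shows "increments X r L w = (\<Sum>i\<in>UNIV. increments (component X i) r (map (\<lambda>(s, v). (s, v $ i)) L) w)"
proof (induction L arbitrary: r)
  case (Cons x L)
  obtain s v where "x = (s, v)" by force
  then show ?case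
    by (simp add: Cons sum.distrib inner_vec_def component_def)
qed simp

lemma energy_components:
  fixes L :: "(real \<times> (real ^ 'd)) list"
  shows "energy H r L = (\<Sum>i\<in>UNIV. energy H r (map (\<lambda>(s, v). (s, v $ i)) L))"
proof (induction L arbitrary: r)
  case (Cons x L)
  obtain s v where "x = (s, v)" by force
  then show ?case
    by (simp add: Cons sum.distrib sum_distrib_right norm_vec_def L2_set_def sum_nonneg)
qed simp

lemma ascending_map: "ascending r (map (\<lambda>(s, v). (s, v $ i)) L) \<longleftrightarrow> ascending r L"
  by (induction r L rule: ascending.induct) auto

text \<open>By independence the variances of the components add up, so the scalar bound gives one for
  vector-valued chains.\<close>

lemma vector_chain_char_le:
  "\<exists>c>0. \<forall>r>0. \<forall>u L. ascending r L \<and> length L = n \<longrightarrow>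
     norm (LINT w|M. iexp (u \<bullet> X r w + increments X r L w)) \<le> exp (- c * ((norm u)\<^sup>2 * r powr (2 * H) + energy H r L))"
proof -
  have "\<forall>i. \<exists>c>0. \<forall>r>0. \<forall>u L. ascending r L \<and> length L = n \<longrightarrow>
     (LINT w|M. (u * component X i r w + increments (component X i) r L w)\<^sup>2) \<ge> c * (u\<^sup>2 * r powr (2 * H) + energy H r L)"
    using component_chain_variance by blast
  from choice[OF this] obtain cc where cc: "\<And>i. cc i > 0" "\<And>i r u L. \<lbrakk>r > 0; ascending r L; length L = n\<rbrakk> \<Longrightarrow>
     (LINT w|M. (u * component X i r w + increments (component X i) r L w)\<^sup>2) \<ge> cc i * (u\<^sup>2 * r powr (2 * H) + energy H r L)"
    by blast
  define c where "c = Min (range cc)"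
  have c: "c > 0" "c \<le> cc i" for i using cc(1) by (auto simp: c_def)
  show ?thesis
  proof (intro exI[of _ "c / 2"] conjI allI impI)
    show "c / 2 > 0" using c by simp
    fix r :: real and u :: "real ^ 'd" and L :: "(real \<times> (real ^ 'd)) list"
    assume r: "0 < r" and L: "ascending r L \<and> length L = n"
    let ?L = "\<lambda>i. map (\<lambda>(s, v). (s, v $ i)) L"
    define Z where "Z i w = u $ i * component X i r w + increments (component X i) r (?L i) w" for i w
    have Z: "u \<bullet> X r w + increments X r L w = (\<Sum>i\<in>UNIV. Z i w)" for w
      by (simp add: Z_def sum.distrib increments_components inner_vec_def component_def)
    define q where "q = last_time r L"
    have lt: "last_time r (?L i) = q" for i
      unfolding q_def by (induction r L rule: ascending.induct) auto
    have ex: "\<exists>T a. finite T \<and> T \<subseteq> {0<..q} \<and> Z i = (\<lambda>w. \<Sum>s\<in>T. a s * component X i s w)" for i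
    proof -
      have "past_combination (component X i) q (Z i)"
        using past_combination_increments[OF r, of "?L i" "component X i" "u $ i"] L
        unfolding lt Z_def[abs_def] ascending_map by simp
      then show ?thesis unfolding past_combination_def by (elim exE conjE) (intro exI conjI)
    qed
    from choice[OF allI[OF ex]] obtain T where Tex: "\<forall>i. \<exists>a. finite (T i) \<and> T i \<subseteq> {0<..q} \<and> Z i = (\<lambda>w. \<Sum>s\<in>T i. a s * component X i s w)" ..
    from choice[OF Tex] obtain a where Ta: "\<forall>i. finite (T i) \<and> T i \<subseteq> {0<..q} \<and> Z i = (\<lambda>w. \<Sum>s\<in>T i. a i s * component X i s w)" ..
    note T = conjunct1[OF spec[OF Ta]] conjunct1[OF conjunct2[OF spec[OF Ta]]]
      and Za = conjunct2[OF conjunct2[OF spec[OF Ta]]]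
    have sqZ: "square_integrable M (Z i)" for i
      unfolding Za using T(2)[of i]
      by (intro square_integrable_sum square_integrable_cmult component_square_integrable T) auto
    have orth: "(LINT w|M. Z i w * Z j w) = 0" if "i \<noteq> j" for i j
    proof -
      have i1: "integrable M (\<lambda>w. component X i s w * component X j t w)" if "s \<in> T i" "t \<in> T j" for s t
        using that T(2)[of i] T(2)[of j] by (intro square_integrable_mult component_square_integrable) auto
      have "(LINT w|M. Z i w * Z j w) = (LINT w|M. (\<Sum>s\<in>T i. \<Sum>t\<in>T j. (a i s * a j t) * (component X i s w * component X j t w)))"
        unfolding Za sum_product by (intro Bochner_Integration.integral_cong refl sum.cong) (simp only: mult_ac)
      also have "\<dots> = (\<Sum>s\<in>T i. \<Sum>t\<in>T j. (a i s * a j t) * (LINT w|M. component X i s w * component X j t w))"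
        using i1 by (simp add: Bochner_Integration.integral_sum Bochner_Integration.integrable_sum)
      also have "\<dots> = 0"
        using T(2) that by (intro sum.neutral ballI) (auto simp: components_uncorrelated subset_iff)
      finally show ?thesis .
    qed
    have var: "(LINT w|M. (\<Sum>i\<in>UNIV. Z i w)\<^sup>2) = (\<Sum>i\<in>UNIV. LINT w|M. (Z i w)\<^sup>2)"
    proof -
      have "(LINT w|M. (\<Sum>i\<in>UNIV. Z i w)\<^sup>2) = (LINT w|M. (\<Sum>i\<in>UNIV. \<Sum>j\<in>UNIV. Z i w * Z j w))"
        by (simp add: power2_eq_square sum_product)
      also have "\<dots> = (\<Sum>i\<in>UNIV. \<Sum>j\<in>UNIV. LINT w|M. Z i w * Z j w)"
        using square_integrable_mult[OF sqZ sqZ]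
        by (simp add: Bochner_Integration.integral_sum Bochner_Integration.integrable_sum)
      also have "\<dots> = (\<Sum>i\<in>UNIV. \<Sum>j\<in>UNIV. if j = i then LINT w|M. (Z i w)\<^sup>2 else 0)"
        by (intro sum.cong refl) (auto simp: orth power2_eq_square)
      also have "\<dots> = (\<Sum>i\<in>UNIV. LINT w|M. (Z i w)\<^sup>2)"
        by simp
      finally show ?thesis .
    qed
    have ge: "(LINT w|M. (Z i w)\<^sup>2) \<ge> c * ((u $ i)\<^sup>2 * r powr (2 * H) + energy H r (?L i))" for i
    proof -
      have "c * ((u $ i)\<^sup>2 * r powr (2 * H) + energy H r (?L i)) \<le> cc i * ((u $ i)\<^sup>2 * r powr (2 * H) + energy H r (?L i))"
        by (intro mult_right_mono c add_nonneg_nonneg energy_nonneg) auto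
      also have "\<dots> \<le> (LINT w|M. (Z i w)\<^sup>2)"
        unfolding Z_def using r L by (intro cc) (auto simp: ascending_map)
      finally show ?thesis .
    qed
    have nu: "(norm u)\<^sup>2 = (\<Sum>i\<in>UNIV. (u $ i)\<^sup>2)"
      by (simp add: norm_vec_def L2_set_def sum_nonneg)
    have "c * ((norm u)\<^sup>2 * r powr (2 * H) + energy H r L) = (\<Sum>i\<in>UNIV. c * ((u $ i)\<^sup>2 * r powr (2 * H) + energy H r (?L i)))"
      unfolding nu energy_components sum_distrib_right sum.distrib[symmetric] sum_distrib_left ..
    also have "\<dots> \<le> (LINT w|M. (\<Sum>i\<in>UNIV. Z i w)\<^sup>2)"
      unfolding var by (intro sum_mono ge)
    finally have v: "c * ((norm u)\<^sup>2 * r powr (2 * H) + energy H r L) \<le> (LINT w|M. (\<Sum>i\<in>UNIV. Z i w)\<^sup>2)" .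
    define S where "S = (\<Union>i. T i)"
    define d where "d s = (\<chi> i. if s \<in> T i then a i s else 0)" for s
    have S: "finite S" "S \<subseteq> {0..}" using T by (auto simp: S_def subset_iff intro: less_imp_le)
    have "(\<Sum>i\<in>UNIV. Z i w) = (\<Sum>s\<in>S. d s \<bullet> X s w)" for w
    proof -
      have "Z i w = (\<Sum>s\<in>S. (if s \<in> T i then a i s else 0) * component X i s w)" for i
        unfolding Za using S(1) by (intro sum.mono_neutral_cong_left) (auto simp: S_def)
      then have "(\<Sum>i\<in>UNIV. Z i w) = (\<Sum>i\<in>UNIV. \<Sum>s\<in>S. (if s \<in> T i then a i s else 0) * component X i s w)" by simp
      also have "\<dots> = (\<Sum>s\<in>S. \<Sum>i\<in>UNIV. (if s \<in> T i then a i s else 0) * component X i s w)"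
        by (rule sum.swap)
      also have "\<dots> = (\<Sum>s\<in>S. d s \<bullet> X s w)"
        by (simp add: inner_vec_def d_def component_def)
      finally show ?thesis .
    qed
    then have G: "centered_gaussian M (\<lambda>w. \<Sum>i\<in>UNIV. Z i w)"
      using gaussian_combination[OF S, of d] by simp
    have "norm (LINT w|M. iexp (u \<bullet> X r w + increments X r L w)) = exp (- (LINT w|M. (\<Sum>i\<in>UNIV. Z i w)\<^sup>2) / 2)"
      unfolding Z by (rule centered_gaussian_facts(3)[OF M G])
    also have "\<dots> \<le> exp (- (c / 2) * ((norm u)\<^sup>2 * r powr (2 * H) + energy H r L))"
      using v by simp
    finally show "norm (LINT w|M. iexp (u \<bullet> X r w + increments X r L w)) \<le> exp (- (c / 2) * ((norm u)\<^sup>2 * r powr (2 * H) + energy H r L))" .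
  qed
qed

lemma increments_cong:
  assumes "\<And>s. s \<ge> r \<Longrightarrow> Y s w = Y' s w" "ascending r L"
  shows "increments Y r L w = increments Y' r L w"
  using assms by (induction Y r L w rule: increments.induct) auto

text \<open>Freezing the path at negative times makes it continuous and measurable on the whole line.\<close>

lemma stopped_at_zero_vector_process: "vector_process M (\<lambda>s. X (max 0 s)) H"
proof (unfold vector_process_def, unfold_locales)
  show "X (max 0 s) \<in> borel_measurable M" for s by (rule X_measurable_at) simp
  show "continuous_on UNIV (\<lambda>s. X (max 0 s) w)" if "w \<in> space M" for w
  proof (rule continuous_on_compose2[of "{0..}" "\<lambda>s. X s w"])
    show "continuous_on {0..} (\<lambda>s. X s w)" using X that by (simp add: G_class_def)
  qed (auto intro!: continuous_intros)
  show "H > 0" by (rule H)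
  fix n
  obtain c where c: "c > 0" "\<And>r u L. \<lbrakk>r > 0; ascending r L; length L = n\<rbrakk> \<Longrightarrow>
    norm (LINT w|M. iexp (u \<bullet> X r w + increments X r L w)) \<le> exp (- c * ((norm u)\<^sup>2 * r powr (2 * H) + energy H r L))"
    using vector_chain_char_le[of n] by blast
  show "\<exists>c>0. \<forall>r>0. \<forall>u L. ascending r L \<and> length L = n \<longrightarrow>
      norm (LINT w|M. iexp (u \<bullet> X (max 0 r) w + increments (\<lambda>s. X (max 0 s)) r L w))
        \<le> exp (- c * ((norm u)\<^sup>2 * r powr (2 * H) + energy H r L))"
  proof (intro exI[of _ c] conjI allI impI c(1))
    fix r :: real and u :: "real ^ 'd" and L :: "(real \<times> (real ^ 'd)) list"
    assume r: "0 < r" and L: "ascending r L \<and> length L = n"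
    have "increments (\<lambda>s. X (max 0 s)) r L w = increments X r L w" for w
      using r L by (intro increments_cong) auto
    then show "norm (LINT w|M. iexp (u \<bullet> X (max 0 r) w + increments (\<lambda>s. X (max 0 s)) r L w))
        \<le> exp (- c * ((norm u)\<^sup>2 * r powr (2 * H) + energy H r L))"
      using c(2)[OF r, of L u] L r by simp
  qed
qed

end

section \<open>Convergence in $L^p$\<close>

lemma moments_vanish_add:
  assumes "moments_vanish M D F" "moments_vanish M E F"
    and "\<forall>\<^sub>F i in F. D i \<in> borel_measurable M \<and> E i \<in> borel_measurable M"
  shows "moments_vanish M (\<lambda>i w. D i w + E i w) F"
  unfolding moments_vanish_def
proof (intro allI impI)
  fix n :: nat assume n: "even n" "n \<noteq> 0"
  have "((\<lambda>i. ennreal (2 ^ n) * (\<integral>\<^sup>+w. ennreal (D i w ^ n) \<partial>M) + ennreal (2 ^ n) * (\<integral>\<^sup>+w. ennreal (E i w ^ n) \<partial>M))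
    \<longlongrightarrow> ennreal (2 ^ n) * 0 + ennreal (2 ^ n) * 0) F"
    using assms(1,2) n unfolding moments_vanish_def
    by (intro tendsto_add tendsto_mult_ennreal tendsto_const) auto
  then have lim: "((\<lambda>i. ennreal (2 ^ n) * (\<integral>\<^sup>+w. ennreal (D i w ^ n) \<partial>M) + ennreal (2 ^ n) * (\<integral>\<^sup>+w. ennreal (E i w ^ n) \<partial>M)) \<longlongrightarrow> 0) F"
    by simp
  show "((\<lambda>i. \<integral>\<^sup>+w. ennreal ((D i w + E i w) ^ n) \<partial>M) \<longlongrightarrow> 0) F"
  proof (rule tendsto_sandwich[OF _ _ tendsto_const lim])
    show "\<forall>\<^sub>F i in F. (\<integral>\<^sup>+w. ennreal ((D i w + E i w) ^ n) \<partial>M)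
      \<le> ennreal (2 ^ n) * (\<integral>\<^sup>+w. ennreal (D i w ^ n) \<partial>M) + ennreal (2 ^ n) * (\<integral>\<^sup>+w. ennreal (E i w ^ n) \<partial>M)"
      using assms(3) by eventually_elim (intro moment_add_le n(1), auto)
  qed simp
qed

lemma moments_vanish_cmult:
  assumes "moments_vanish M D F" and "\<forall>\<^sub>F i in F. D i \<in> borel_measurable M"
  shows "moments_vanish M (\<lambda>i w. c * D i w) F"
  unfolding moments_vanish_def
proof (intro allI impI)
  fix n :: nat assume n: "even n" "n \<noteq> 0"
  have "((\<lambda>i. ennreal (c ^ n) * (\<integral>\<^sup>+w. ennreal (D i w ^ n) \<partial>M)) \<longlongrightarrow> ennreal (c ^ n) * 0) F"
    using assms(1) n unfolding moments_vanish_def by (intro tendsto_mult_ennreal tendsto_const) auto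
  moreover have "\<forall>\<^sub>F i in F. ennreal (c ^ n) * (\<integral>\<^sup>+w. ennreal (D i w ^ n) \<partial>M) = (\<integral>\<^sup>+w. ennreal ((c * D i w) ^ n) \<partial>M)"
    using assms(2) by eventually_elim (simp add: moment_cmult n)
  ultimately show "((\<lambda>i. \<integral>\<^sup>+w. ennreal ((c * D i w) ^ n) \<partial>M) \<longlongrightarrow> 0) F"
    by (auto elim: Lim_transform_eventually)
qed

lemma moments_vanish_sum:
  assumes "finite J" "\<And>j. j \<in> J \<Longrightarrow> moments_vanish M (D j) F"
    and "\<And>j. j \<in> J \<Longrightarrow> \<forall>\<^sub>F i in F. D j i \<in> borel_measurable M"
  shows "moments_vanish M (\<lambda>i w. \<Sum>j\<in>J. c j * D j i w) F"
  using assms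
proof (induction J rule: finite_induct)
  case empty
  then show ?case by (simp add: moments_vanish_def zero_power)
next
  case (insert j J)
  have "\<forall>\<^sub>F i in F. \<forall>k\<in>J. D k i \<in> borel_measurable M"
    using insert by (intro eventually_ball_finite) auto
  then have m: "\<forall>\<^sub>F i in F. (\<lambda>w. c j * D j i w) \<in> borel_measurable M \<and> (\<lambda>w. \<Sum>k\<in>J. c k * D k i w) \<in> borel_measurable M"
    using insert.prems(2)[of j, simplified] by eventually_elim (auto intro!: borel_measurable_sum)
  show ?case
    using insert by (simp add: moments_vanish_add[OF moments_vanish_cmult insert.IH m])
qed

lemma Lp_converges_cong:
  assumes "Lp_converges M p Y Z F" "\<forall>\<^sub>F i in F. Y i = Y' i" "Z = Z'"
  shows "Lp_converges M p Y' Z' F"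
  unfolding Lp_converges_def
proof (intro conjI)
  show "Z' \<in> Lp_space M p" using assms by (simp add: Lp_converges_def)
  have "\<forall>\<^sub>F i in F. Y i \<in> Lp_space M p" using assms by (simp add: Lp_converges_def)
  with assms(2) show "\<forall>\<^sub>F i in F. Y' i \<in> Lp_space M p" by eventually_elim simp
  have "((\<lambda>i. LINT w|M. \<bar>Y i w - Z w\<bar> powr p) \<longlongrightarrow> 0) F" using assms by (simp add: Lp_converges_def)
  moreover have "\<forall>\<^sub>F i in F. (LINT w|M. \<bar>Y i w - Z w\<bar> powr p) = (LINT w|M. \<bar>Y' i w - Z' w\<bar> powr p)"
    using assms(2) by eventually_elim (simp add: assms(3))
  ultimately show "((\<lambda>i. LINT w|M. \<bar>Y' i w - Z' w\<bar> powr p) \<longlongrightarrow> 0) F"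
    by (rule Lim_transform_eventually)
qed

text \<open>In the applications \<open>j\<close> runs over the partial derivatives of order \<open>\<beta>\<close>, and \<open>a j\<close> is the
  corresponding moment of \<open>f\<close> divided by \<open>fact \<beta>\<close>. The limit in the expansion is a combination of
  separately chosen limits, one for each derivative.\<close>

lemma (in vector_process) rescaled_occupation_Lp_converges:
  fixes f :: "real ^ 'd \<Rightarrow> real" and \<sigma> :: "'j::finite \<Rightarrow> real ^ 'd \<Rightarrow> complex"
  assumes f: "integrable lborel f" and fm: "integrable lborel (\<lambda>z. \<bar>f z\<bar> * norm z ^ \<beta>)"
    and t: "t > 0" and small: "H * (real CARD('d) + 2 * real \<beta>) < 1"
    and \<sigma>_meas [measurable]: "\<And>j. \<sigma> j \<in> borel_measurable borel"
    and \<sigma>_le: "\<And>j \<xi>. norm (\<sigma> j \<xi>) \<le> (1 + norm \<xi>) ^ \<beta>"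
    and taylor: "\<And>r \<xi>. r > 0 \<Longrightarrow> (LINT z|lborel. complex_of_real (f z) * (\<Sum>k\<le>\<beta>. (\<i> * complex_of_real (- (r * (\<xi> \<bullet> z)))) ^ k / fact k))
      = complex_of_real (LINT z|lborel. f z) + complex_of_real (r ^ \<beta>) * (\<Sum>j\<in>UNIV. complex_of_real (a j) * \<sigma> j \<xi>)"
    and g: "\<And>j. mollified (\<lambda>\<xi>. \<sigma> j \<xi> * phase y \<xi>) (g j)"
    and "p \<ge> 1"
  shows "Lp_converges M p
    (\<lambda>n w. real n powr (H * real \<beta>) *
       (real n powr (H * real CARD('d)) * occupation X (\<lambda>x. f ((real n powr H) *\<^sub>R (x - y))) t w
        - Lp_lim M (\<lambda>\<epsilon>. occupation X (\<lambda>x. heat_kernel \<epsilon> (x - y)) t) (at_right 0) w * (LINT x|lborel. f x)))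
    (\<lambda>w. \<Sum>j\<in>UNIV. a j * Lp_lim M (\<lambda>\<epsilon>. occupation X (g j \<epsilon>) t) (at_right 0) w) sequentially"
proof -
  define L where "L = Lp_lim M (\<lambda>\<epsilon>. occupation X (\<lambda>x. heat_kernel \<epsilon> (x - y)) t) (at_right 0)"
  define \<Lambda> where "\<Lambda> j = Lp_lim M (\<lambda>\<epsilon>. occupation X (g j \<epsilon>) t) (at_right 0)" for j
  define Tl where "Tl w = (\<Sum>j\<in>UNIV. a j * \<Lambda> j w)" for w
  define T where "T \<epsilon> x = (\<Sum>j\<in>UNIV. a j * g j \<epsilon> x)" for \<epsilon> x
  have one: "1 \<le> (1 + norm \<xi>) ^ \<beta>" for \<xi> :: "real ^ 'd" by simp
  have L: "finite_moments M L" "moments_vanish M (\<lambda>\<epsilon> w. occupation X (\<lambda>x. heat_kernel \<epsilon> (x - y)) t w - L w) (at_right 0)"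
    unfolding L_def
    by (rule mollified_limit[OF heat_kernel_mollified phase_measurable _ t small, where C = 1]; use one in simp)+
  have \<Lambda>: "finite_moments M (\<Lambda> j)" "moments_vanish M (\<lambda>\<epsilon> w. occupation X (g j \<epsilon>) t w - \<Lambda> j w) (at_right 0)" for j
    unfolding \<Lambda>_def
    by (rule mollified_limit[OF g[of j] _ _ t small, where C = 1]; use \<sigma>_le in \<open>simp add: norm_mult\<close>)+
  have fo: "fourier_of (\<lambda>\<xi>. complex_of_real (heat_multiplier \<epsilon> \<xi>) * (\<sigma> j \<xi> * phase y \<xi>)) (g j \<epsilon>)" if "\<epsilon> > 0" for \<epsilon> j
    using g[of j] that by (simp add: mollified_def)
  have pos: "\<forall>\<^sub>F \<epsilon> in at_right (0::real). \<epsilon> > 0" by (simp add: eventually_at_right_less)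
  have Tm: "mollified (\<lambda>\<xi>. (\<Sum>j\<in>UNIV. complex_of_real (a j) * \<sigma> j \<xi>) * phase y \<xi>) T"
    unfolding mollified_def
  proof (intro allI impI)
    fix \<epsilon> :: real assume \<epsilon>: "\<epsilon> > 0"
    have eq: "complex_of_real (heat_multiplier \<epsilon> \<xi>) * ((\<Sum>j\<in>UNIV. complex_of_real (a j) * \<sigma> j \<xi>) * phase y \<xi>)
      = (\<Sum>j\<in>UNIV. complex_of_real (a j) * (complex_of_real (heat_multiplier \<epsilon> \<xi>) * (\<sigma> j \<xi> * phase y \<xi>)))" for \<xi>
      unfolding sum_distrib_left sum_distrib_right by (intro sum.cong refl) (simp only: mult_ac)
    show "fourier_of (\<lambda>\<xi>. complex_of_real (heat_multiplier \<epsilon> \<xi>) * ((\<Sum>j\<in>UNIV. complex_of_real (a j) * \<sigma> j \<xi>) * phase y \<xi>)) (T \<epsilon>)"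
      unfolding eq T_def[abs_def] by (intro fourier_of_sum fourier_of_cmult fo \<epsilon>)
  qed
  have Tl: "finite_moments M Tl"
    unfolding Tl_def[abs_def] by (intro finite_moments_sum finite_moments_cmult \<Lambda>)
  have TlT: "moments_vanish M (\<lambda>\<epsilon> w. occupation X (T \<epsilon>) t w - Tl w) (at_right 0)"
  proof -
    have "moments_vanish M (\<lambda>\<epsilon> w. \<Sum>j\<in>UNIV. a j * (occupation X (g j \<epsilon>) t w - \<Lambda> j w)) (at_right 0)"
    proof (rule moments_vanish_sum)
      show "\<forall>\<^sub>F \<epsilon> in at_right 0. (\<lambda>w. occupation X (g j \<epsilon>) t w - \<Lambda> j w) \<in> borel_measurable M" for j
        using pos
      proof eventually_elim
        case (elim \<epsilon>)
        have [measurable]: "g j \<epsilon> \<in> borel_measurable borel" by (rule fourier_of_measurable[OF fo[OF elim]])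
        have [measurable]: "\<Lambda> j \<in> borel_measurable M" using \<Lambda>(1) by (simp add: finite_moments_def)
        show ?case by measurable
      qed
    qed (simp_all add: \<Lambda>)
    moreover have "\<forall>\<^sub>F \<epsilon> in at_right 0. \<forall>w\<in>space M. (\<Sum>j\<in>UNIV. a j * (occupation X (g j \<epsilon>) t w - \<Lambda> j w)) = occupation X (T \<epsilon>) t w - Tl w"
      using pos
    proof eventually_elim
      case (elim \<epsilon>)
      show ?case
      proof
        fix w assume w: "w \<in> space M"
        have "occupation X (T \<epsilon>) t w = (\<Sum>j\<in>UNIV. a j * occupation X (g j \<epsilon>) t w)"
        proof -
          have "occupation X (T \<epsilon>) t w = (\<Sum>j\<in>UNIV. LINT s:{0..t}|lborel. a j * g j \<epsilon> (X s w))"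
            unfolding occupation_def T_def set_lebesgue_integral_def scaleR_sum_right
          proof (rule Bochner_Integration.integral_sum)
            have "set_integrable lborel {0..t} (\<lambda>s. a j * g j \<epsilon> (X s w))" for j
              using occupation_integrable[OF fo[OF elim] w, of t j] by (intro set_integrable_mult_right) auto
            then show "integrable lborel (\<lambda>s. indicator {0..t} s *\<^sub>R (a j * g j \<epsilon> (X s w)))" for j
              by (simp only: set_integrable_def)
          qed
          then show ?thesis by (simp only: occupation_def set_integral_mult_right)
        qed
        then show "(\<Sum>j\<in>UNIV. a j * (occupation X (g j \<epsilon>) t w - \<Lambda> j w)) = occupation X (T \<epsilon>) t w - Tl w"
          by (simp add: Tl_def right_diff_distrib sum_subtractf)
      qed
    qed
    ultimately show ?thesis
      unfolding moments_vanish_def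
    proof (intro allI impI)
      fix n :: nat
      assume v: "\<forall>n. even n \<longrightarrow> n \<noteq> 0 \<longrightarrow> ((\<lambda>\<epsilon>. \<integral>\<^sup>+w. ennreal ((\<Sum>j\<in>UNIV. a j * (occupation X (g j \<epsilon>) t w - \<Lambda> j w)) ^ n) \<partial>M) \<longlongrightarrow> 0) (at_right 0)"
        and ev: "\<forall>\<^sub>F \<epsilon> in at_right 0. \<forall>w\<in>space M. (\<Sum>j\<in>UNIV. a j * (occupation X (g j \<epsilon>) t w - \<Lambda> j w)) = occupation X (T \<epsilon>) t w - Tl w"
        and n: "even n" "n \<noteq> 0"
      from ev have "\<forall>\<^sub>F \<epsilon> in at_right 0. (\<integral>\<^sup>+w. ennreal ((\<Sum>j\<in>UNIV. a j * (occupation X (g j \<epsilon>) t w - \<Lambda> j w)) ^ n) \<partial>M)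
        = (\<integral>\<^sup>+w. ennreal ((occupation X (T \<epsilon>) t w - Tl w) ^ n) \<partial>M)"
        by eventually_elim (intro nn_integral_cong, simp)
      moreover from v n have "((\<lambda>\<epsilon>. \<integral>\<^sup>+w. ennreal ((\<Sum>j\<in>UNIV. a j * (occupation X (g j \<epsilon>) t w - \<Lambda> j w)) ^ n) \<partial>M) \<longlongrightarrow> 0) (at_right 0)"
        by blast
      ultimately show "((\<lambda>\<epsilon>. \<integral>\<^sup>+w. ennreal ((occupation X (T \<epsilon>) t w - Tl w) ^ n) \<partial>M) \<longlongrightarrow> 0) (at_right 0)"
        by (auto elim: Lim_transform_eventually)
    qed
  qed
  \<comment> \<open>The index \<open>0\<close> is replaced by \<open>1\<close> to keep the scale positive.\<close>
  define r where "r n = real (max 1 n) powr (- H)" for n :: nat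
  have r: "r n > 0" "1 / r n = real (max 1 n) powr H" for n
    by (simp_all add: r_def powr_minus_divide)
  have r0: "r \<longlonglongrightarrow> 0"
  proof -
    have "(\<lambda>n. real n powr (- H)) \<longlonglongrightarrow> 0"
      using H_pos by (intro tendsto_neg_powr filterlim_real_sequentially) simp
    moreover have "\<forall>\<^sub>F n in sequentially. real n powr (- H) = r n"
      using eventually_ge_at_top[of 1] by eventually_elim (simp add: r_def max_def)
    ultimately show ?thesis by (rule Lim_transform_eventually)
  qed
  define D where "D n w = (1 / r n) ^ \<beta> * ((1 / r n) ^ CARD('d) * occupation X (\<lambda>x. f ((1 / r n) *\<^sub>R (x - y))) t w
      - L w * (LINT x|lborel. f x)) - Tl w" for n w
  have D: "finite_moments M (D n)" "moments_vanish M D sequentially" for n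
    using rescaled_occupation_expansion[OF f fm t small taylor Tm L Tl TlT r(1) r0]
    unfolding D_def[abs_def] by blast+
  have "Lp_converges M p (\<lambda>n w. D n w + Tl w) Tl sequentially"
    using D(2) by (intro Lp_converges_of_moments prob_space_axioms Tl always_eventually allI finite_moments_add D(1) \<open>p \<ge> 1\<close>) simp
  then show ?thesis
  proof (rule Lp_converges_cong)
    show "\<forall>\<^sub>F n in sequentially. (\<lambda>w. D n w + Tl w) = (\<lambda>w. real n powr (H * real \<beta>) *
       (real n powr (H * real CARD('d)) * occupation X (\<lambda>x. f ((real n powr H) *\<^sub>R (x - y))) t w
        - Lp_lim M (\<lambda>\<epsilon>. occupation X (\<lambda>x. heat_kernel \<epsilon> (x - y)) t) (at_right 0) w * (LINT x|lborel. f x)))"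
      using eventually_ge_at_top[of 1]
    proof eventually_elim
      case (elim n)
      have n: "1 / r n = real n powr H" using elim by (simp add: r(2) max_def)
      have pw: "(real n powr H) ^ k = real n powr (H * real k)" for k
      proof -
        have "(real n powr H) ^ k = (real n powr H) powr real k" using elim by (intro powr_realpow[symmetric]) simp
        then show ?thesis by (simp add: powr_powr)
      qed
      show ?case unfolding D_def n pw L_def by simp
    qed
  qed (simp add: Tl_def[abs_def] \<Lambda>_def)
qed

section \<open>The theorem\<close>

text \<open>Near the origin \<open>f\<close> is controlled by its square, elsewhere by its moment.\<close>

lemma Theta_integrable:
  fixes f :: "real ^ 'd::finite \<Rightarrow> real"
  assumes "f \<in> Lp_space lborel 2" "integrable lborel (\<lambda>x. \<bar>f x\<bar> * norm x ^ \<beta>)"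
  shows "integrable lborel f"
proof (rule Bochner_Integration.integrable_bound)
  show [measurable]: "f \<in> borel_measurable lborel" using assms(1) by (simp add: Lp_space_def)
  have "emeasure lborel (cball (0 :: real ^ 'd) 1) < \<infinity>" by (rule emeasure_bounded_finite) simp
  then show "integrable lborel (\<lambda>x. \<bar>f x\<bar> powr 2 + indicat_real (cball 0 1) x + \<bar>f x\<bar> * norm x ^ \<beta>)"
    using assms by (intro Bochner_Integration.integrable_add integrable_real_indicator) (auto simp: Lp_space_def)
  show "AE x in lborel. norm (f x) \<le> norm (\<bar>f x\<bar> powr 2 + indicat_real (cball 0 1) x + \<bar>f x\<bar> * norm x ^ \<beta>)"
  proof (intro always_eventually allI)
    fix x :: "real ^ 'd"
    have "\<bar>f x\<bar> \<le> \<bar>f x\<bar> powr 2 + indicat_real (cball 0 1) x + \<bar>f x\<bar> * norm x ^ \<beta>"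
    proof (cases "norm x \<le> 1")
      case True
      have "2 * \<bar>f x\<bar> \<le> (\<bar>f x\<bar>)\<^sup>2 + 1" using sum_squares_bound[of "\<bar>f x\<bar>" 1] by simp
      then have "\<bar>f x\<bar> \<le> \<bar>f x\<bar> powr 2 + 1" by (simp add: powr_numeral)
      moreover have "0 \<le> \<bar>f x\<bar> * norm x ^ \<beta>" by simp
      moreover have "indicat_real (cball 0 1) x = 1" using True by simp
      ultimately show ?thesis by linarith
    next
      case False
      then have "\<bar>f x\<bar> * 1 \<le> \<bar>f x\<bar> * norm x ^ \<beta>" by (intro mult_left_mono one_le_power) auto
      moreover have "0 \<le> \<bar>f x\<bar> powr 2" "indicat_real (cball 0 1) x = 0" using False by simp_all
      ultimately show ?thesis by linarith
    qed
    then show "norm (f x) \<le> norm (\<bar>f x\<bar> powr 2 + indicat_real (cball 0 1) x + \<bar>f x\<bar> * norm x ^ \<beta>)" by simp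
  qed
qed

lemma moment_integrable:
  fixes f h :: "real ^ 'd::finite \<Rightarrow> real"
  assumes "integrable lborel f" "integrable lborel (\<lambda>x. \<bar>f x\<bar> * norm x ^ \<beta>)"
    and [measurable]: "h \<in> borel_measurable borel" and h: "\<And>x. \<bar>h x\<bar> \<le> norm x ^ k" and "k \<le> \<beta>"
  shows "integrable lborel (\<lambda>x. h x * f x)"
proof (rule Bochner_Integration.integrable_bound)
  have [measurable]: "f \<in> borel_measurable borel" using assms(1) by auto
  show "integrable lborel (\<lambda>x. \<bar>f x\<bar> + \<bar>f x\<bar> * norm x ^ \<beta>)" using assms(1,2) by auto
  show "AE x in lborel. norm (h x * f x) \<le> norm (\<bar>f x\<bar> + \<bar>f x\<bar> * norm x ^ \<beta>)"
  proof (intro always_eventually allI)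
    fix x :: "real ^ 'd"
    have "norm x ^ k \<le> 1 + norm x ^ \<beta>"
    proof (cases "norm x \<le> 1")
      case True
      then have "norm x ^ k \<le> 1" by (intro power_le_one) auto
      then show ?thesis by (simp add: add_increasing2)
    next
      case False
      then show ?thesis using power_increasing[OF \<open>k \<le> \<beta>\<close>, of "norm x"] by linarith
    qed
    with h[of x] have "\<bar>h x\<bar> \<le> 1 + norm x ^ \<beta>" by (rule order_trans)
    then have "\<bar>h x\<bar> * \<bar>f x\<bar> \<le> (1 + norm x ^ \<beta>) * \<bar>f x\<bar>" by (rule mult_right_mono) simp
    then show "norm (h x * f x) \<le> norm (\<bar>f x\<bar> + \<bar>f x\<bar> * norm x ^ \<beta>)" by (simp add: abs_mult algebra_simps)
  qed
  show "(\<lambda>x. h x * f x) \<in> borel_measurable lborel" by measurable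
qed

lemma taylor_first_order:
  fixes f :: "real ^ 'd::finite \<Rightarrow> real"
  assumes f: "integrable lborel f" and fm: "integrable lborel (\<lambda>x. \<bar>f x\<bar> * norm x ^ 1)"
  shows "(LINT z|lborel. complex_of_real (f z) * (\<Sum>k\<le>1. (\<i> * complex_of_real (- (r * (\<xi> \<bullet> z)))) ^ k / fact k))
    = complex_of_real (LINT z|lborel. f z) + complex_of_real (r ^ 1) * (\<Sum>i\<in>UNIV. complex_of_real (LINT x|lborel. x $ i * f x) * derivative_symbol i \<xi>)"
proof -
  have mi: "integrable lborel (\<lambda>x. x $ i * f x)" for i
    by (rule moment_integrable[OF f fm, where k = 1]) (auto simp: component_le_norm_cart)
  have "(LINT z|lborel. complex_of_real (f z) * (\<Sum>k\<le>1. (\<i> * complex_of_real (- (r * (\<xi> \<bullet> z)))) ^ k / fact k))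
    = (LINT z|lborel. complex_of_real (f z) + (\<Sum>i\<in>UNIV. (complex_of_real r * derivative_symbol i \<xi>) * complex_of_real (z $ i * f z)))"
    by (intro Bochner_Integration.integral_cong refl)
      (simp add: inner_vec_def derivative_symbol_def sum_distrib_left sum_distrib_right sum_negf algebra_simps)
  also have "\<dots> = complex_of_real (LINT z|lborel. f z) + (\<Sum>i\<in>UNIV. (complex_of_real r * derivative_symbol i \<xi>) * complex_of_real (LINT z|lborel. z $ i * f z))"
    using f mi by (simp add: Bochner_Integration.integral_sum Bochner_Integration.integrable_sum del: of_real_mult)
  also have "\<dots> = complex_of_real (LINT z|lborel. f z) + complex_of_real (r ^ 1) * (\<Sum>i\<in>UNIV. complex_of_real (LINT x|lborel. x $ i * f x) * derivative_symbol i \<xi>)"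
    by (simp add: sum_distrib_left mult_ac)
  finally show ?thesis .
qed

text \<open>The linear term vanishes because the first moments of \<open>f\<close> do.\<close>

lemma taylor_second_order:
  fixes f :: "real ^ 'd::finite \<Rightarrow> real"
  assumes f: "integrable lborel f" and fm: "integrable lborel (\<lambda>x. \<bar>f x\<bar> * norm x ^ 2)"
    and mean: "(LINT x|lborel. f x *\<^sub>R x) = 0"
  shows "(LINT z|lborel. complex_of_real (f z) * (\<Sum>k\<le>2. (\<i> * complex_of_real (- (r * (\<xi> \<bullet> z)))) ^ k / fact k))
    = complex_of_real (LINT z|lborel. f z) + complex_of_real (r ^ 2) *
      (\<Sum>(i, k)\<in>UNIV. complex_of_real (1 / 2 * (LINT x|lborel. (x $ i * x $ k) * f x)) * (derivative_symbol i \<xi> * derivative_symbol k \<xi>))"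
proof -
  have mi: "integrable lborel (\<lambda>x. x $ i * f x)" for i
    by (rule moment_integrable[OF f fm, where k = 1]) (auto simp: component_le_norm_cart)
  have mik: "integrable lborel (\<lambda>x. (x $ i * x $ k) * f x)" for i k
    by (rule moment_integrable[OF f fm, where k = 2])
      (auto simp: abs_mult power2_eq_square intro!: mult_mono component_le_norm_cart)
  have m0: "(LINT x|lborel. x $ i * f x) = 0" for i
  proof -
    have i: "integrable lborel (\<lambda>x. f x *\<^sub>R x)"
    proof (rule Bochner_Integration.integrable_bound)
      show "integrable lborel (\<lambda>x. norm x * \<bar>f x\<bar>)"
        by (rule moment_integrable[where k = 1 and \<beta> = 2]) (use f fm in auto)
      show "(\<lambda>x. f x *\<^sub>R x) \<in> borel_measurable lborel" using f by (intro borel_measurable_scaleR) auto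
    qed simp
    have "(LINT x|lborel. (f x *\<^sub>R x) \<bullet> axis i 1) = (LINT x|lborel. f x *\<^sub>R x) \<bullet> axis i 1"
      by (rule integral_inner_left) (rule i)
    then show ?thesis by (simp add: mean inner_axis mult.commute)
  qed
  have sq: "(\<i> * complex_of_real (- (r * v)))\<^sup>2 / 2 = complex_of_real (r\<^sup>2) * (complex_of_real (1 / 2) * (- complex_of_real (v\<^sup>2)))" for v
    by (simp add: power_mult_distrib)
  have vsq: "- complex_of_real ((\<xi> \<bullet> z)\<^sup>2) = (\<Sum>(i, k)\<in>UNIV. (derivative_symbol i \<xi> * derivative_symbol k \<xi>) * complex_of_real (z $ i * z $ k))" for z
  proof -
    have "- complex_of_real ((\<xi> \<bullet> z)\<^sup>2) = - (\<Sum>i\<in>UNIV. \<Sum>k\<in>UNIV. complex_of_real ((\<xi> $ i * z $ i) * (\<xi> $ k * z $ k)))"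
      by (simp add: inner_vec_def power2_eq_square sum_product)
    also have "\<dots> = (\<Sum>i\<in>UNIV. \<Sum>k\<in>UNIV. (derivative_symbol i \<xi> * derivative_symbol k \<xi>) * complex_of_real (z $ i * z $ k))"
    proof -
      have "(- \<i> * a) * (- \<i> * b) = - (a * b)" for a b :: complex
        by (simp add: mult.assoc mult.left_commute[of a "\<i>"])
      then show ?thesis
        unfolding sum_negf[symmetric] derivative_symbol_def by (intro sum.cong refl) (simp add: mult_ac)
    qed
    finally show ?thesis by (simp add: sum.cartesian_product UNIV_Times_UNIV[symmetric] del: UNIV_Times_UNIV)
  qed
  let ?c = "\<lambda>j :: 'd \<times> 'd. complex_of_real (r\<^sup>2) * (complex_of_real (1 / 2) * (derivative_symbol (fst j) \<xi> * derivative_symbol (snd j) \<xi>))"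
  have "(LINT z|lborel. complex_of_real (f z) * (\<Sum>k\<le>2. (\<i> * complex_of_real (- (r * (\<xi> \<bullet> z)))) ^ k / fact k))
    = (LINT z|lborel. complex_of_real (f z) + (\<Sum>i\<in>UNIV. (- \<i> * complex_of_real (r * \<xi> $ i)) * complex_of_real (z $ i * f z))
        + (\<Sum>j\<in>UNIV. ?c j * complex_of_real ((z $ fst j * z $ snd j) * f z)))"
  proof (intro Bochner_Integration.integral_cong refl)
    fix z :: "real ^ 'd"
    let ?v = "\<i> * complex_of_real (- (r * (\<xi> \<bullet> z)))"
    have s: "(\<Sum>k\<le>2. ?v ^ k / fact k) = 1 + ?v + ?v\<^sup>2 / 2"
      by (simp add: numeral_2_eq_2 atMost_Suc)
    have l: "?v = (\<Sum>i\<in>UNIV. (- \<i> * complex_of_real (r * \<xi> $ i)) * complex_of_real (z $ i))"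
      by (simp add: inner_vec_def sum_distrib_left sum_negf mult_ac)
    have q: "?v\<^sup>2 / 2 = (\<Sum>j\<in>UNIV. ?c j * complex_of_real (z $ fst j * z $ snd j))"
      unfolding sq vsq sum_distrib_left by (intro sum.cong refl) (simp add: case_prod_unfold mult_ac)
    show "complex_of_real (f z) * (\<Sum>k\<le>2. ?v ^ k / fact k)
      = complex_of_real (f z) + (\<Sum>i\<in>UNIV. (- \<i> * complex_of_real (r * \<xi> $ i)) * complex_of_real (z $ i * f z))
        + (\<Sum>j\<in>UNIV. ?c j * complex_of_real ((z $ fst j * z $ snd j) * f z))"
      unfolding s q unfolding distrib_left mult_1_right l sum_distrib_left of_real_mult
      by (intro arg_cong2[where f = "(+)"] refl sum.cong) (simp_all only: mult_ac)
  qed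
  also have "\<dots> = complex_of_real (LINT z|lborel. f z) + (\<Sum>i\<in>UNIV. (- \<i> * complex_of_real (r * \<xi> $ i)) * complex_of_real (LINT z|lborel. z $ i * f z))
        + (\<Sum>j\<in>UNIV. ?c j * complex_of_real (LINT z|lborel. (z $ fst j * z $ snd j) * f z))"
    using f mi mik by (simp add: Bochner_Integration.integral_sum Bochner_Integration.integrable_sum del: of_real_mult)
  also have "\<dots> = complex_of_real (LINT z|lborel. f z) + complex_of_real (r ^ 2) *
      (\<Sum>(i, k)\<in>UNIV. complex_of_real (1 / 2 * (LINT x|lborel. (x $ i * x $ k) * f x)) * (derivative_symbol i \<xi> * derivative_symbol k \<xi>))"
    unfolding m0 sum_distrib_left by (simp add: case_prod_unfold mult_ac)
  finally show ?thesis .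
qed

theorem theorem1p3:
  fixes M :: "'a measure"
    and X :: "real \<Rightarrow> 'a \<Rightarrow> real ^ 'd::finite"
    and f :: "real ^ 'd \<Rightarrow> real"
    and y :: "real ^ 'd"
    and H t p :: real
    and \<beta> :: nat
  assumes "prob_space M"
    and "\<beta> \<in> {1, 2}"
    and "0 < H"
    and "H < 1 / (2 * real \<beta> + real CARD('d))"
    and "X \<in> G_class M H"
    and "f \<in> Theta \<beta>"
    and "t > 0"
    and "p \<ge> 1"
  shows "Lp_converges M p
    (\<lambda>n w. real n powr (H * real \<beta>) *
       (real n powr (H * real CARD('d)) *
          (LINT s:{0..t}|lborel. f ((real n powr H) *\<^sub>R (X s w - y)))
        - local_time M X t y w * (LINT x|lborel. f x)))
    (\<lambda>w. if \<beta> = 1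
       then LINT x|lborel. (\<Sum>i\<in>UNIV. local_time_deriv M X i t y w * x $ i) * f x
       else LINT x|lborel.
         (1 / 2 * (\<Sum>i\<in>UNIV. \<Sum>k\<in>UNIV. x $ i * local_time_deriv2 M X i k t y w * x $ k)) * f x)
    sequentially"
proof -
  interpret V: vector_process M "\<lambda>s. X (max 0 s)" H
    by (rule stopped_at_zero_vector_process[OF assms(1,5,3)])
  let ?X = "\<lambda>s. X (max 0 s)"
  have occ: "occupation ?X g t w = (LINT s:{0..t}|lborel. g (X s w))" for g w
    unfolding occupation_def by (rule set_lebesgue_integral_cong) auto
  have occ': "occupation ?X g t = (\<lambda>w. LINT s:{0..t}|lborel. g (X s w))" for g
    by (rule ext) (rule occ)
  have small: "H * (real CARD('d) + 2 * real \<beta>) < 1"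
    using assms(4) by (simp add: pos_less_divide_eq add_pos_nonneg add.commute)
  have L: "Lp_lim M (\<lambda>\<epsilon>. occupation ?X (\<lambda>x. heat_kernel \<epsilon> (x - y)) t) (at_right 0) = local_time M X t y"
    unfolding local_time_def occ' ..
  consider "\<beta> = 1" | "\<beta> = 2" using assms(2) by auto
  then show ?thesis
  proof cases
    case 1
    have f2: "f \<in> Lp_space lborel 2" and fm: "integrable lborel (\<lambda>x. \<bar>f x\<bar> * norm x ^ 1)"
      using assms(6) 1 by (auto simp: Theta_def Theta1_def)
    have f: "integrable lborel f" by (rule Theta_integrable[OF f2 fm])
    have small1: "H * (real CARD('d) + 2 * real 1) < 1" using small 1 by simp
    have mi: "integrable lborel (\<lambda>x. x $ i * f x)" for i
      by (rule moment_integrable[OF f fm, where k = 1]) (auto simp: component_le_norm_cart)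
    have \<Lambda>: "Lp_lim M (\<lambda>\<epsilon>. occupation ?X (\<lambda>x. partial_deriv i (\<lambda>z. heat_kernel \<epsilon> (x - z)) y) t) (at_right 0)
        = local_time_deriv M X i t y" for i
      unfolding local_time_deriv_def occ' ..
    have "Lp_converges M p
      (\<lambda>n w. real n powr (H * real 1) *
       (real n powr (H * real CARD('d)) * occupation ?X (\<lambda>x. f ((real n powr H) *\<^sub>R (x - y))) t w
        - Lp_lim M (\<lambda>\<epsilon>. occupation ?X (\<lambda>x. heat_kernel \<epsilon> (x - y)) t) (at_right 0) w * (LINT x|lborel. f x)))
      (\<lambda>w. \<Sum>i\<in>UNIV. (LINT x|lborel. x $ i * f x) *
         Lp_lim M (\<lambda>\<epsilon>. occupation ?X (\<lambda>x. partial_deriv i (\<lambda>z. heat_kernel \<epsilon> (x - z)) y) t) (at_right 0) w) sequentially"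
    proof (rule V.rescaled_occupation_Lp_converges[OF f fm assms(7) small1 derivative_symbol_measurable _ taylor_first_order[OF f fm] heat_kernel_deriv_mollified assms(8)])
      show "norm (derivative_symbol i \<xi>) \<le> (1 + norm \<xi>) ^ 1" for i and \<xi> :: "real ^ 'd"
        using norm_derivative_symbol_le[of i \<xi>] by simp
    qed
    then show ?thesis
    proof (rule Lp_converges_cong)
      have "(LINT x|lborel. (\<Sum>i\<in>UNIV. local_time_deriv M X i t y w * x $ i) * f x)
        = (\<Sum>i\<in>UNIV. (LINT x|lborel. x $ i * f x) * local_time_deriv M X i t y w)" for w
      proof -
        have "(\<Sum>i\<in>UNIV. local_time_deriv M X i t y w * x $ i) * f x = (\<Sum>i\<in>UNIV. local_time_deriv M X i t y w * (x $ i * f x))" for x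
          by (simp add: sum_distrib_right mult.assoc)
        then show ?thesis using mi by (simp add: Bochner_Integration.integral_sum mult.commute)
      qed
      then show "(\<lambda>w. \<Sum>i\<in>UNIV. (LINT x|lborel. x $ i * f x) *
         Lp_lim M (\<lambda>\<epsilon>. occupation ?X (\<lambda>x. partial_deriv i (\<lambda>z. heat_kernel \<epsilon> (x - z)) y) t) (at_right 0) w)
        = (\<lambda>w. if \<beta> = 1
       then LINT x|lborel. (\<Sum>i\<in>UNIV. local_time_deriv M X i t y w * x $ i) * f x
       else LINT x|lborel.
         (1 / 2 * (\<Sum>i\<in>UNIV. \<Sum>k\<in>UNIV. x $ i * local_time_deriv2 M X i k t y w * x $ k)) * f x)"
        unfolding \<Lambda> using 1 by simp
    qed (simp add: 1 L occ)
  next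
    case 2
    have f2: "f \<in> Lp_space lborel 2" and fm: "integrable lborel (\<lambda>x. \<bar>f x\<bar> * norm x ^ 2)"
      and mean: "(LINT x|lborel. f x *\<^sub>R x) = 0"
      using assms(6) 2 by (auto simp: Theta_def Theta2_def)
    have f: "integrable lborel f" by (rule Theta_integrable[OF f2 fm])
    have small2: "H * (real CARD('d) + 2 * real 2) < 1" using small 2 by simp
    have mik: "integrable lborel (\<lambda>x. (x $ i * x $ k) * f x)" for i k
      by (rule moment_integrable[OF f fm, where k = 2])
        (auto simp: abs_mult power2_eq_square intro!: mult_mono component_le_norm_cart)
    define a where "a j = 1 / 2 * (LINT x|lborel. (x $ fst j * x $ snd j) * f x)" for j :: "'d \<times> 'd"
    define \<sigma> where "\<sigma> j \<xi> = derivative_symbol (fst j) \<xi> * derivative_symbol (snd j) \<xi>" for j :: "'d \<times> 'd" and \<xi>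
    define g where "g j \<epsilon> x = partial_deriv (fst j) (partial_deriv (snd j) (\<lambda>z. heat_kernel \<epsilon> (x - z))) y" for j :: "'d \<times> 'd" and \<epsilon> x
    have \<Lambda>: "Lp_lim M (\<lambda>\<epsilon>. occupation ?X (g j \<epsilon>) t) (at_right 0) = local_time_deriv2 M X (fst j) (snd j) t y" for j
      unfolding local_time_deriv2_def occ' g_def ..
    have "Lp_converges M p
      (\<lambda>n w. real n powr (H * real 2) *
       (real n powr (H * real CARD('d)) * occupation ?X (\<lambda>x. f ((real n powr H) *\<^sub>R (x - y))) t w
        - Lp_lim M (\<lambda>\<epsilon>. occupation ?X (\<lambda>x. heat_kernel \<epsilon> (x - y)) t) (at_right 0) w * (LINT x|lborel. f x)))
      (\<lambda>w. \<Sum>j\<in>UNIV. a j * Lp_lim M (\<lambda>\<epsilon>. occupation ?X (g j \<epsilon>) t) (at_right 0) w) sequentially"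
    proof (rule V.rescaled_occupation_Lp_converges[where \<sigma> = \<sigma>, OF f fm assms(7) small2 _ _ _ _ assms(8)])
      show "\<sigma> j \<in> borel_measurable borel" for j unfolding \<sigma>_def[abs_def] by measurable
      show "norm (\<sigma> j \<xi>) \<le> (1 + norm \<xi>) ^ 2" for j \<xi>
        unfolding \<sigma>_def norm_mult power2_eq_square by (intro mult_mono norm_derivative_symbol_le) auto
      show "(LINT z|lborel. complex_of_real (f z) * (\<Sum>k\<le>2. (\<i> * complex_of_real (- (r * (\<xi> \<bullet> z)))) ^ k / fact k))
        = complex_of_real (LINT z|lborel. f z) + complex_of_real (r ^ 2) * (\<Sum>j\<in>UNIV. complex_of_real (a j) * \<sigma> j \<xi>)" for r \<xi>
        unfolding taylor_second_order[OF f fm mean] a_def \<sigma>_def by (simp only: case_prod_unfold)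
      show "mollified (\<lambda>\<xi>. \<sigma> j \<xi> * phase y \<xi>) (g j)" for j
        using heat_kernel_deriv2_mollified[of "fst j" "snd j" y] unfolding \<sigma>_def g_def[abs_def] mult.assoc .
    qed
    then show ?thesis
    proof (rule Lp_converges_cong)
      have "(LINT x|lborel. (1 / 2 * (\<Sum>i\<in>UNIV. \<Sum>k\<in>UNIV. x $ i * local_time_deriv2 M X i k t y w * x $ k)) * f x)
        = (\<Sum>j\<in>UNIV. a j * local_time_deriv2 M X (fst j) (snd j) t y w)" for w
      proof -
        have e: "(1 / 2 * (\<Sum>i\<in>UNIV. \<Sum>k\<in>UNIV. x $ i * local_time_deriv2 M X i k t y w * x $ k)) * f x
          = (\<Sum>j\<in>UNIV. (1 / 2 * local_time_deriv2 M X (fst j) (snd j) t y w) * ((x $ fst j * x $ snd j) * f x))" for x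
        proof -
          have "(\<Sum>i\<in>UNIV. \<Sum>k\<in>UNIV. x $ i * local_time_deriv2 M X i k t y w * x $ k)
            = (\<Sum>j\<in>UNIV. x $ fst j * local_time_deriv2 M X (fst j) (snd j) t y w * x $ snd j)"
            by (simp add: sum.cartesian_product case_prod_unfold)
          then show ?thesis by (simp add: sum_distrib_left sum_distrib_right mult_ac)
        qed
        have "(LINT x|lborel. (\<Sum>j\<in>UNIV. (1 / 2 * local_time_deriv2 M X (fst j) (snd j) t y w) * ((x $ fst j * x $ snd j) * f x)))
          = (\<Sum>j\<in>UNIV. LINT x|lborel. (1 / 2 * local_time_deriv2 M X (fst j) (snd j) t y w) * ((x $ fst j * x $ snd j) * f x))"
          by (rule Bochner_Integration.integral_sum) (rule integrable_mult_right[OF mik])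
        then show ?thesis unfolding e integral_mult_right_zero by (simp add: a_def mult_ac)
      qed
      then show "(\<lambda>w. \<Sum>j\<in>UNIV. a j * Lp_lim M (\<lambda>\<epsilon>. occupation ?X (g j \<epsilon>) t) (at_right 0) w)
        = (\<lambda>w. if \<beta> = 1
       then LINT x|lborel. (\<Sum>i\<in>UNIV. local_time_deriv M X i t y w * x $ i) * f x
       else LINT x|lborel.
         (1 / 2 * (\<Sum>i\<in>UNIV. \<Sum>k\<in>UNIV. x $ i * local_time_deriv2 M X i k t y w * x $ k)) * f x)"
        unfolding \<Lambda> using 2 by simp
    qed (simp add: 2 L occ)
  qed
qed

end
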